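(* Let $A\in\mathbb{R}^{n\times n}$ be a symmetric positive definite matrix, consider the QUBO cost $C(z)=z^TAz$ for $z\in\{-1,1\}^n$, and let $\mathcal{G}=(V,E)$ be the graph on $\{1,\ldots,n\}$ with an edge $(i,j)$, $i\ne j$, whenever $A_{ij}\ne0$; let $\Delta$ be its maximum degree. Let $p\in[0,1]$ and let $\rho=[\mathcal{C}]_{\mathcal{N}_{DP}}$ be the $n$-qubit state produced by the noisy version, with local depolarizing noise of strength $p$, of a depth-$D$ quantum circuit $\mathcal{C}$. Let $\Sigma_{ij}=\operatorname{tr}(\rho Z_iZ_j)$, let $\mathcal{A}$ be the output distribution of the Gaussian rounding algorithm applied to $\Sigma$, and $\mathcal{M}(\rho)$ the computational-basis measurement distribution of $\rho$. Then $$\frac{\mathbb{E}_{z\sim\mathcal{A}}[C(z)]}{\mathbb{E}_{z\sim\mathcal{M}(\rho)}[C(z)]}=\frac{2\sum_{i,j}A_{ij}\arcsin\Sigma_{ij}}{\pi\sum_{i,j}A_{ij}\Sigma_{ij}}\ \ge\ 1-\frac{\sqrt{2}(2\pi-4)}{\pi}\,\Delta\, n\,(1-p)^D.$$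
   Context: $Z_i$ is the Pauli $Z$ operator on qubit $i$. A depth-$D$ circuit is $\mathcal{C}=\mathcal{C}^{(D)}\circ\cdots\circ\mathcal{C}^{(1)}$ with each layer a unitary channel made of one- and two-qubit gates; its noisy version with local depolarizing noise of strength $p$ is $\mathcal{N}^{\otimes n}\circ\mathcal{C}^{(D)}\circ\cdots\circ\mathcal{N}^{\otimes n}\circ\mathcal{C}^{(1)}$ where $\mathcal{N}(\sigma)=(1-p)\sigma+p\operatorname{tr}(\sigma)I/2$, applied to some input state. The measurement distribution $\mathcal{M}(\rho)$ gives $z\in\{-1,1\}^n$ with probability $\langle z|\rho|z\rangle$, with $z_i=\pm1$ the eigenvalue of $Z_i$; thus $\mathbb{E}_{z\sim\mathcal{M}(\rho)}[C(z)]=\operatorname{tr}(A\Sigma)$. The Gaussian rounding algorithm: sample $y\sim\mathcal{N}(0,\Sigma)$ and output $z_i=+1$ if $y_i\ge0$, $z_i=-1$ otherwise. *)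

theory Defs
  imports "HOL-Probability.Probability" "Jordan_Normal_Form.Matrix"
begin

section \<open>Qubit registers: basis index k < 2^n, bit i of k is the state of qubit i\<close>

definition qbit :: "nat \<Rightarrow> nat \<Rightarrow> nat" where
  "qbit k i = (k div 2 ^ i) mod 2"

definition set_qbit :: "nat \<Rightarrow> nat \<Rightarrow> nat \<Rightarrow> nat" where
  "set_qbit k i b = k - qbit k i * 2 ^ i + b * 2 ^ i"

definition adj :: "complex mat \<Rightarrow> complex mat" where
  "adj U = mat (dim_col U) (dim_row U) (\<lambda>(i, j). cnj (U $$ (j, i)))"

definition unitary_mat :: "nat \<Rightarrow> complex mat \<Rightarrow> bool" where
  "unitary_mat d U \<longleftrightarrow> U \<in> carrier_mat d d \<and> U * adj U = 1\<^sub>m d \<and> adj U * U = 1\<^sub>m d"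

definition mtrace :: "complex mat \<Rightarrow> complex" where
  "mtrace M = (\<Sum>k<dim_row M. M $$ (k, k))"

definition density_matrix :: "nat \<Rightarrow> complex mat \<Rightarrow> bool" where
  "density_matrix n \<rho> \<longleftrightarrow> \<rho> \<in> carrier_mat (2 ^ n) (2 ^ n) \<and> adj \<rho> = \<rho> \<and>
     (\<forall>v \<in> carrier_vec (2 ^ n). 0 \<le> Re (\<Sum>k<2 ^ n. cnj (Matrix.vec_index v k) * Matrix.vec_index (\<rho> *\<^sub>v v) k)) \<and>
     mtrace \<rho> = 1"

definition Zop :: "nat \<Rightarrow> nat \<Rightarrow> complex mat" where
  "Zop n i = mat (2 ^ n) (2 ^ n) (\<lambda>(k, l). if k = l then (if qbit k i = 0 then 1 else -1) else 0)"

datatype gate = Gate1 nat "complex mat" | Gate2 nat nat "complex mat"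

definition gate_support :: "gate \<Rightarrow> nat set" where
  "gate_support g = (case g of Gate1 q U \<Rightarrow> {q} | Gate2 q1 q2 U \<Rightarrow> {q1, q2})"

definition valid_gate :: "nat \<Rightarrow> gate \<Rightarrow> bool" where
  "valid_gate n g = (case g of
      Gate1 q U \<Rightarrow> q < n \<and> unitary_mat 2 U
    | Gate2 q1 q2 U \<Rightarrow> q1 < n \<and> q2 < n \<and> q1 \<noteq> q2 \<and> unitary_mat 4 U)"

text \<open>The 2^n x 2^n matrix of a gate acting on its qubits (identity on the others).\<close>
definition gate_mat :: "nat \<Rightarrow> gate \<Rightarrow> complex mat" where
  "gate_mat n g = (case g of
      Gate1 q U \<Rightarrow> mat (2 ^ n) (2 ^ n) (\<lambda>(k, l).
         if set_qbit k q 0 = set_qbit l q 0 then U $$ (qbit k q, qbit l q) else 0)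
    | Gate2 q1 q2 U \<Rightarrow> mat (2 ^ n) (2 ^ n) (\<lambda>(k, l).
         if set_qbit (set_qbit k q1 0) q2 0 = set_qbit (set_qbit l q1 0) q2 0
         then U $$ (2 * qbit k q1 + qbit k q2, 2 * qbit l q1 + qbit l q2) else 0))"

definition valid_layer :: "nat \<Rightarrow> gate list \<Rightarrow> bool" where
  "valid_layer n L \<longleftrightarrow> (\<forall>g \<in> set L. valid_gate n g) \<and>
     (\<forall>a < length L. \<forall>b < length L. a \<noteq> b \<longrightarrow> gate_support (L ! a) \<inter> gate_support (L ! b) = {})"

definition layer_mat :: "nat \<Rightarrow> gate list \<Rightarrow> complex mat" where
  "layer_mat n L = foldr (\<lambda>g M. gate_mat n g * M) L (1\<^sub>m (2 ^ n))"

text \<open>Depolarizing channel N(s) = (1-p) s + p tr(s) I/2 on qubit i (identity elsewhere).\<close>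
definition depol1 :: "nat \<Rightarrow> real \<Rightarrow> nat \<Rightarrow> complex mat \<Rightarrow> complex mat" where
  "depol1 n p i \<sigma> = mat (2 ^ n) (2 ^ n) (\<lambda>(k, l).
      complex_of_real (1 - p) * \<sigma> $$ (k, l) +
      (if qbit k i = qbit l i
       then complex_of_real (p / 2) * (\<Sum>b<2. \<sigma> $$ (set_qbit k i b, set_qbit l i b))
       else 0))"

text \<open>N tensor n = composition of the single-qubit channels on all qubits.\<close>
definition depol_all :: "nat \<Rightarrow> real \<Rightarrow> complex mat \<Rightarrow> complex mat" where
  "depol_all n p \<sigma> = foldr (depol1 n p) [0..<n] \<sigma>"

definition noisy_circuit :: "nat \<Rightarrow> real \<Rightarrow> gate list list \<Rightarrow> complex mat \<Rightarrow> complex mat" where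
  "noisy_circuit n p C \<rho>0 =
     foldl (\<lambda>\<sigma> L. depol_all n p (layer_mat n L * \<sigma> * adj (layer_mat n L))) \<rho>0 C"

definition pos_def_sym :: "nat \<Rightarrow> real mat \<Rightarrow> bool" where
  "pos_def_sym n A \<longleftrightarrow> A \<in> carrier_mat n n \<and> transpose_mat A = A \<and>
     (\<forall>v \<in> carrier_vec n. v \<noteq> 0\<^sub>v n \<longrightarrow> Matrix.scalar_prod v (A *\<^sub>v v) > 0)"

definition qubo_cost :: "nat \<Rightarrow> real mat \<Rightarrow> (nat \<Rightarrow> real) \<Rightarrow> real" where
  "qubo_cost n A z = (\<Sum>i<n. \<Sum>j<n. A $$ (i, j) * z i * z j)"

definition max_degree :: "nat \<Rightarrow> real mat \<Rightarrow> nat" where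
  "max_degree n A = Max ((\<lambda>i. card {j. j < n \<and> j \<noteq> i \<and> A $$ (i, j) \<noteq> 0}) ` {..<n})"

text \<open>Outcome z in {-1,1}^n of basis state k: z_i = eigenvalue of Z_i.\<close>
definition zvec :: "nat \<Rightarrow> nat \<Rightarrow> (nat \<Rightarrow> real)" where
  "zvec n k = (\<lambda>i\<in>{..<n}. if qbit k i = 0 then 1 else -1)"

definition meas_expect :: "nat \<Rightarrow> complex mat \<Rightarrow> ((nat \<Rightarrow> real) \<Rightarrow> real) \<Rightarrow> real" where
  "meas_expect n \<rho> f = (\<Sum>k<2 ^ n. Re (\<rho> $$ (k, k)) * f (zvec n k))"

text \<open>Correlation matrix Sigma_ij = tr(rho Z_i Z_j) (real part; it is real for Hermitian rho).\<close>
definition corr_mat :: "nat \<Rightarrow> complex mat \<Rightarrow> real mat" where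
  "corr_mat n \<rho> = mat n n (\<lambda>(i, j). Re (mtrace (\<rho> * Zop n i * Zop n j)))"

definition std_normal_measure :: "real measure" where
  "std_normal_measure = density lborel std_normal_density"

text \<open>N(0,Sigma) as the law of L g with g standard normal in R^n and L L^T = Sigma.\<close>
definition gauss_factor :: "nat \<Rightarrow> real mat \<Rightarrow> real mat" where
  "gauss_factor n \<Sigma> = (SOME L. L \<in> carrier_mat n n \<and> L * transpose_mat L = \<Sigma>)"

definition gaussian_measure :: "nat \<Rightarrow> real mat \<Rightarrow> (nat \<Rightarrow> real) measure" where
  "gaussian_measure n \<Sigma> =
     distr (PiM {..<n} (\<lambda>_. std_normal_measure)) (PiM {..<n} (\<lambda>_. borel))
       (\<lambda>g. \<lambda>i\<in>{..<n}. \<Sum>k<n. gauss_factor n \<Sigma> $$ (i, k) * g k)"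

definition gaussian_rounding :: "nat \<Rightarrow> real mat \<Rightarrow> (nat \<Rightarrow> real) measure" where
  "gaussian_rounding n \<Sigma> =
     distr (gaussian_measure n \<Sigma>) (PiM {..<n} (\<lambda>_. borel))
       (\<lambda>y. \<lambda>i\<in>{..<n}. if y i \<ge> 0 then 1 else -1)"

end

theory Submission
  imports Defs
begin

text \<open>
  In the Heisenberg picture \<open>\<Sigma>\<^sub>i\<^sub>j\<close> is the expectation in the input state of an observable \<open>O\<close> that is
  obtained from \<open>Z\<^sub>i Z\<^sub>j\<close> by alternating noise and unitary conjugation. The key point is the bound
  \<open>\<bar>\<Sigma>\<^sub>i\<^sub>j\<bar> \<le> \<surd>2 n (1-p)\<^sup>D\<close> for \<open>i \<noteq> j\<close>. Each noise layer shrinks the normalized Schatten norms of \<open>O\<close>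
  for \<open>k = 2, 4, 8, \<dots>\<close> by the factor \<open>1-p\<close>, if the \<open>k\<close>-norm is measured in units of about \<open>0.7 k\<close>.
  For \<open>k = 2\<close> this holds because \<open>O\<close> is traceless. If the \<open>k\<close>-norm of \<open>O\<close> is much larger than its
  \<open>k/2\<close>-norm, then the noise semigroup makes it decay at rate at least one: this follows from a
  2-to-4 hypercontractive inequality, proved qubit by qubit from the Pauli expansion, applied to the
  powers of \<open>O\<close>. At \<open>k\<close> close to \<open>n\<close> the \<open>k\<close>-norm dominates the operator norm up to a constant.

  Rounding replaces \<open>\<Sigma>\<^sub>i\<^sub>j\<close> by \<open>2/\<pi> arcsin \<Sigma>\<^sub>i\<^sub>j\<close>, which differs from it by at most \<open>(1 - 2/\<pi>) \<bar>\<Sigma>\<^sub>i\<^sub>j\<bar>\<close>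
  and agrees with it on the diagonal. Since \<open>2 \<bar>A\<^sub>i\<^sub>j\<bar> \<le> A\<^sub>i\<^sub>i + A\<^sub>j\<^sub>j\<close>, with \<open>\<epsilon> = \<surd>2 n (1-p)\<^sup>D\<close> the cost changes
  by at most \<open>(1 - 2/\<pi>) \<Delta> \<epsilon> tr A\<close>. If \<open>\<Delta> \<epsilon> \<le> 1/2\<close>, then \<open>tr (A \<Sigma>) \<ge> tr A / 2\<close> and the theorem follows;
  otherwise it follows from Nesterov's bound \<open>2/\<pi>\<close> on the ratio.
\<close>

section \<open>A type of operators on infinitely many qubits\<close>

text \<open>The obstacle is that the unitary layers are arbitrary: after one of them an observable
  that sat on two qubits may have any distribution over Pauli weights. The induction over layers can
  therefore carry only data invariant under conjugation, namely tr O = 0 and traces of powers of O;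
  this is what \<open>tame\<close> records. The 2-norm is invariant and contracts, but turning it
  into a bound on an expectation costs a factor 2^(n/2); the k-norm costs 2^(n/k), a constant at k
  near n. In exchange, a k-norm is only known to shrink at rate 1-p while it dominates the k/2-norm,
  hence the growing units \<open>nfac k\<close>, which produce the factor n of the correlation
  bound. Exponents double so that, for k = 2h, tr (O^k) is the squared 2-norm of P = O^h, and P is
  itself the square of a power of O once h is even; so tr P acts as the 1-norm of P.
  Hypercontractivity with constant 7/2 asks for a ratio (7/2)^(h/(2h-1)) between consecutive units.
  It tends to sqrt (7/2) < 2, so units linear in k suffice.\<close>

text \<open>An operator on the first \<open>n\<close> qubits is represented by the infinite matrix of its tensor
  product with the identity on all further qubits. This makes operators on any finite number of
  qubits elements of a single ring type.\<close>

definition level :: "nat \<Rightarrow> (nat \<Rightarrow> nat \<Rightarrow> complex) \<Rightarrow> bool" where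
  "level n X \<longleftrightarrow> (\<forall>k l. X k l = (if k div 2^n = l div 2^n then X (k mod 2^n) (l mod 2^n) else 0))"

lemma level_add: "level n X \<Longrightarrow> level (n + m) X"
  unfolding level_def
proof (intro allI)
  fix k l :: nat
  assume L: "\<forall>k l. X k l = (if k div 2^n = l div 2^n then X (k mod 2^n) (l mod 2^n) else 0)"
  let ?k = "k mod 2^(n+m)" and ?l = "l mod 2^(n+m)"
  have kd: "?k div 2^n = k div 2^n mod 2^m" "?l div 2^n = l div 2^n mod 2^m"
    by (simp_all add: power_add mod_mult2_eq)
  have km: "?k mod 2^n = k mod 2^n" "?l mod 2^n = l mod 2^n"
    by (simp_all add: power_add mod_mult2_eq)
  have dd: "k div 2^(n+m) = k div 2^n div 2^m" "l div 2^(n+m) = l div 2^n div 2^m"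
    by (simp_all add: power_add div_mult2_eq)
  have eq: "k div 2^n = l div 2^n \<longleftrightarrow> k div 2^(n+m) = l div 2^(n+m) \<and> ?k div 2^n = ?l div 2^n"
    unfolding kd dd by (metis div_mult_mod_eq)
  show "X k l = (if k div 2^(n+m) = l div 2^(n+m) then X ?k ?l else 0)"
    using L[rule_format, of k l] L[rule_format, of ?k ?l] eq km by auto
qed

lemma level_mono: "level n X \<Longrightarrow> n \<le> m \<Longrightarrow> level m X"
  using level_add[of n X "m - n"] by simp

lemma level_common: "level n X \<Longrightarrow> level m Y \<Longrightarrow> \<exists>N. level N X \<and> level N Y"
  by (metis level_mono max.cobounded1 max.cobounded2)

section \<open>Products of block diagonal matrices\<close>

lemma sum_block:
  fixes f :: "nat \<Rightarrow> 'a::comm_monoid_add"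
  shows "(\<Sum>l | l div 2^n = a. f (l mod 2^n)) = (\<Sum>j<2^n. f j)"
proof (rule sum.reindex_bij_witness[where i = "\<lambda>j. a * 2^n + j" and j = "\<lambda>l. l mod 2^n"])
qed (auto simp: div_mult_mod_eq)

lemma finite_block: "finite {l::nat. l div 2^n = a}"
proof (rule finite_subset)
  show "{l. l div 2^n = a} \<subseteq> {..<Suc a * 2^n}"
    using dividend_less_div_times[of "2^n::nat"] by (auto simp: add.commute)
qed simp

text \<open>A row of a matrix with a level is supported in one block, so summing over its support is
  a finite sum and defines the product without reference to a level.\<close>

definition mprod :: "(nat \<Rightarrow> nat \<Rightarrow> complex) \<Rightarrow> (nat \<Rightarrow> nat \<Rightarrow> complex) \<Rightarrow> nat \<Rightarrow> nat \<Rightarrow> complex" where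
  "mprod X Y k m = (\<Sum>l | X k l \<noteq> 0. X k l * Y l m)"

lemma mprod_level:
  assumes "level n X" "level n Y"
  shows "mprod X Y k m = (if k div 2^n = m div 2^n
           then \<Sum>j<2^n. X (k mod 2^n) j * Y j (m mod 2^n) else 0)"
proof -
  have X: "X k l = (if k div 2^n = l div 2^n then X (k mod 2^n) (l mod 2^n) else 0)" for l
    using assms(1) unfolding level_def by blast
  have Y: "Y l m = (if l div 2^n = m div 2^n then Y (l mod 2^n) (m mod 2^n) else 0)" for l
    using assms(2) unfolding level_def by blast
  have "mprod X Y k m = (\<Sum>l | l div 2^n = k div 2^n. X k l * Y l m)"
    unfolding mprod_def
  proof (rule sum.mono_neutral_left[OF finite_block])
    show "{l. X k l \<noteq> 0} \<subseteq> {l. l div 2^n = k div 2^n}"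
      using X by (auto split: if_splits)
  qed simp
  also have "\<dots> = (\<Sum>l | l div 2^n = k div 2^n. if k div 2^n = m div 2^n
       then X (k mod 2^n) (l mod 2^n) * Y (l mod 2^n) (m mod 2^n) else 0)"
    by (rule sum.cong) (use X Y in auto)
  also have "\<dots> = (if k div 2^n = m div 2^n
           then \<Sum>j<2^n. X (k mod 2^n) j * Y j (m mod 2^n) else 0)"
    using sum_block[where n = n and a = "k div 2^n" and f = "\<lambda>j. X (k mod 2^n) j * Y j (m mod 2^n)"] by (cases "k div 2^n = m div 2^n") simp_all
  finally show ?thesis .
qed

lemma level_mprod: "level n X \<Longrightarrow> level n Y \<Longrightarrow> level n (mprod X Y)"
  unfolding level_def[of n "mprod X Y"] by (simp add: mprod_level)

lemma level_one: "level n (\<lambda>k l. if k = l then 1 else 0)"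
  unfolding level_def by (metis div_mult_mod_eq)

lemma level_map:
  assumes "level n X" "level n Y" "f 0 0 = 0"
  shows "level n (\<lambda>k l. f (X k l) (Y k l))"
  unfolding level_def
proof (intro allI)
  fix k l
  have "X k l = (if k div 2^n = l div 2^n then X (k mod 2^n) (l mod 2^n) else 0)"
    "Y k l = (if k div 2^n = l div 2^n then Y (k mod 2^n) (l mod 2^n) else 0)"
    using assms unfolding level_def by blast+
  then show "f (X k l) (Y k l) = (if k div 2^n = l div 2^n
      then f (X (k mod 2^n) (l mod 2^n)) (Y (k mod 2^n) (l mod 2^n)) else 0)"
    by (metis assms(3))
qed

lemma level_map1: "level n X \<Longrightarrow> f 0 = 0 \<Longrightarrow> level n (\<lambda>k l. f (X k l))"
  by (rule level_map[where f = "\<lambda>x _. f x" and Y = X])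

lemma level_map_exists:
  assumes "\<exists>n. level n X" "\<exists>n. level n Y" "f 0 0 = 0"
  shows "\<exists>n. level n (\<lambda>k l. f (X k l) (Y k l))"
  using assms by (metis (lifting) level_common level_map)

typedef uhf = "{X. \<exists>n. level n X}"
  by (rule exI[of _ "\<lambda>_ _. 0"]) (simp add: level_def)

setup_lifting type_definition_uhf

lift_definition ent :: "uhf \<Rightarrow> nat \<Rightarrow> nat \<Rightarrow> complex" is "\<lambda>X. X" .
lift_definition lev :: "nat \<Rightarrow> uhf \<Rightarrow> bool" is level .

lemma lev_exists: "\<exists>n. lev n X" by transfer
lemma lev_mono: "lev n X \<Longrightarrow> n \<le> m \<Longrightarrow> lev m X" by transfer (rule level_mono)
lemma lev_common2: "\<exists>n. lev n X \<and> lev n Y"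
  by (metis lev_exists lev_mono max.cobounded1 max.cobounded2)
lemma lev_common3: "\<exists>n. lev n X \<and> lev n Y \<and> lev n Z"
  by (metis lev_common2 lev_exists lev_mono max.cobounded1 max.cobounded2)
lemma uhf_eqI: "(\<And>k l. ent X k l = ent Y k l) \<Longrightarrow> X = Y"
  by transfer blast
lemma ent_lev: "lev n X \<Longrightarrow> ent X k l = (if k div 2^n = l div 2^n then ent X (k mod 2^n) (l mod 2^n) else 0)"
  by transfer (unfold level_def, blast)
lemma levI: "(\<And>k l. ent X k l = (if k div 2^n = l div 2^n then ent X (k mod 2^n) (l mod 2^n) else 0)) \<Longrightarrow> lev n X"
  by transfer (unfold level_def, blast)
lemma lev_eqI:
  assumes "lev n X" "lev n Y" "\<And>k l. k < 2^n \<Longrightarrow> l < 2^n \<Longrightarrow> ent X k l = ent Y k l"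
  shows "X = Y"
  by (rule uhf_eqI, subst ent_lev[OF assms(1)], subst ent_lev[OF assms(2)]) (simp add: assms(3))

instantiation uhf :: ring_1
begin
lift_definition zero_uhf :: uhf is "\<lambda>_ _. 0" by (simp add: level_def)
lift_definition one_uhf :: uhf is "\<lambda>k l. if k = l then 1 else 0" using level_one by blast
lift_definition plus_uhf :: "uhf \<Rightarrow> uhf \<Rightarrow> uhf" is "\<lambda>X Y k l. X k l + Y k l"
  by (rule level_map_exists) simp_all
lift_definition minus_uhf :: "uhf \<Rightarrow> uhf \<Rightarrow> uhf" is "\<lambda>X Y k l. X k l - Y k l"
  by (rule level_map_exists) simp_all
lift_definition uminus_uhf :: "uhf \<Rightarrow> uhf" is "\<lambda>X k l. - X k l"
  by (elim exE, rule exI, rule level_map1) simp_all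
lift_definition times_uhf :: "uhf \<Rightarrow> uhf \<Rightarrow> uhf" is mprod
  using level_common level_mprod by blast

lemma ent_add [simp]: "ent (X + Y) k l = ent X k l + ent Y k l" by transfer simp
lemma ent_diff [simp]: "ent (X - Y) k l = ent X k l - ent Y k l" by transfer simp
lemma ent_uminus [simp]: "ent (- X) k l = - ent X k l" by transfer simp
lemma ent_0 [simp]: "ent 0 k l = 0" by transfer simp
lemma ent_1: "ent 1 k l = (if k = l then 1 else 0)" by transfer simp
lemma ent_mult_lev: "lev n X \<Longrightarrow> lev n Y \<Longrightarrow> ent (X * Y) k l = (if k div 2^n = l div 2^n
   then \<Sum>j<2^n. ent X (k mod 2^n) j * ent Y j (l mod 2^n) else 0)"
  by transfer (rule mprod_level)
lemma ent_mult: "lev n X \<Longrightarrow> lev n Y \<Longrightarrow> k < 2^n \<Longrightarrow> l < 2^n \<Longrightarrow>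
   ent (X * Y) k l = (\<Sum>j<2^n. ent X k j * ent Y j l)"
  by (simp add: ent_mult_lev)
lemma lev_mult: "lev n X \<Longrightarrow> lev n Y \<Longrightarrow> lev n (X * Y)" by transfer (rule level_mprod)
lemma lev_add: "lev n X \<Longrightarrow> lev n Y \<Longrightarrow> lev n (X + Y)" by transfer (rule level_map; simp)
lemma lev_diff: "lev n X \<Longrightarrow> lev n Y \<Longrightarrow> lev n (X - Y)" by transfer (rule level_map; simp)
lemma lev_uminus: "lev n X \<Longrightarrow> lev n (- X)" by transfer (rule level_map1; simp)
lemma lev_0: "lev n 0" by transfer (simp add: level_def)
lemma lev_1: "lev n 1" by transfer (rule level_one)

instance
proof
  fix a b c :: uhf
  obtain n where n: "lev n a" "lev n b" "lev n c" using lev_common3 by blast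
  show "a + b + c = a + (b + c)" by (rule uhf_eqI) simp
  show "a + b = b + a" by (rule uhf_eqI) simp
  show "0 + a = a" by (rule uhf_eqI) simp
  show "- a + a = 0" by (rule uhf_eqI) simp
  show "a - b = a + - b" by (rule uhf_eqI) simp
  show "a * b * c = a * (b * c)"
  proof (rule lev_eqI)
    fix k l :: nat assume kl: "k < 2^n" "l < 2^n"
    have "ent (a * b * c) k l = (\<Sum>j<2^n. \<Sum>i<2^n. ent a k i * ent b i j * ent c j l)"
      using n kl by (simp add: ent_mult[of n] lev_mult sum_distrib_right)
    also have "\<dots> = (\<Sum>i<2^n. \<Sum>j<2^n. ent a k i * ent b i j * ent c j l)"
      by (rule sum.swap)
    also have "\<dots> = ent (a * (b * c)) k l"
      using n kl by (simp add: ent_mult[of n] lev_mult sum_distrib_left mult.assoc)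
    finally show "ent (a * b * c) k l = ent (a * (b * c)) k l" .
  qed (auto intro: lev_mult n)
  show "1 * a = a"
    by (rule lev_eqI[OF lev_mult[OF lev_1 n(1)] n(1)])
      (simp add: ent_mult[OF lev_1 n(1)] ent_1 if_distrib[of "\<lambda>x. x * _"] sum.delta' cong: if_cong)
  show "a * 1 = a"
    by (rule lev_eqI[OF lev_mult[OF n(1) lev_1] n(1)])
      (simp add: ent_mult[OF n(1) lev_1] ent_1 if_distrib[of "\<lambda>x. _ * x"] sum.delta cong: if_cong)
  show "(a + b) * c = a * c + b * c"
    by (rule lev_eqI[of n])
      (use n in \<open>auto simp: ent_mult[of n] lev_add lev_mult sum.distrib algebra_simps\<close>)
  show "a * (b + c) = a * b + a * c"
    by (rule lev_eqI[of n])
      (use n in \<open>auto simp: ent_mult[of n] lev_add lev_mult sum.distrib algebra_simps\<close>)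
  show "(0::uhf) \<noteq> 1"
    by (metis ent_0 ent_1 zero_neq_one)
qed
end

instantiation uhf :: real_algebra_1
begin
lift_definition scaleR_uhf :: "real \<Rightarrow> uhf \<Rightarrow> uhf" is "\<lambda>r X k l. of_real r * X k l"
  by (elim exE, rule exI, rule level_map1) simp_all
lemma ent_scaleR [simp]: "ent (r *\<^sub>R X) k l = of_real r * ent X k l" by transfer simp
lemma lev_scaleR: "lev n X \<Longrightarrow> lev n (r *\<^sub>R X)" by transfer (rule level_map1; simp)
instance
proof
  fix a b :: real and x y :: uhf
  obtain n where n: "lev n x" "lev n y" using lev_common2 by blast
  show "a *\<^sub>R (x + y) = a *\<^sub>R x + a *\<^sub>R y" by (rule uhf_eqI) (simp add: algebra_simps)
  show "(a + b) *\<^sub>R x = a *\<^sub>R x + b *\<^sub>R x" by (rule uhf_eqI) (simp add: algebra_simps)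
  show "a *\<^sub>R b *\<^sub>R x = (a * b) *\<^sub>R x" by (rule uhf_eqI) (simp add: algebra_simps)
  show "1 *\<^sub>R x = x" by (rule uhf_eqI) simp
  show "a *\<^sub>R x * y = a *\<^sub>R (x * y)"
    by (rule lev_eqI[of n])
      (use n in \<open>auto simp: ent_mult[of n] lev_scaleR lev_mult sum_distrib_left algebra_simps\<close>)
  show "x * a *\<^sub>R y = a *\<^sub>R (x * y)"
    by (rule lev_eqI[of n])
      (use n in \<open>auto simp: ent_mult[of n] lev_scaleR lev_mult sum_distrib_left algebra_simps\<close>)
qed
end

text \<open>The scalars of the type are real, so the imaginary unit enters as a central ring
  element; Pauli Y is built from it.\<close>

lift_definition imag :: uhf is "\<lambda>k l. if k = l then \<i> else 0"
  by (rule exI[of _ 0]) (simp add: level_def)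

lift_definition star :: "uhf \<Rightarrow> uhf" is "\<lambda>X k l. cnj (X l k)"
  subgoal for X
    apply (elim exE)
    subgoal for n
      apply (rule exI[of _ n])
      apply (unfold level_def)
      apply (intro allI)
      subgoal premises p for k l
        by (subst p[rule_format]) simp
      done
    done
  done

lemma ent_imag: "ent imag k l = (if k = l then \<i> else 0)" by transfer simp
lemma ent_star [simp]: "ent (star X) k l = cnj (ent X l k)" by transfer simp
lemma lev_star: "lev n X \<Longrightarrow> lev n (star X)"
  by (rule levI) (subst ent_star, subst ent_lev, auto)
lemma lev_imag: "lev n imag"
  by (rule levI) (simp add: ent_imag, metis div_mult_mod_eq)

lemma star_add: "star (X + Y) = star X + star Y" by (rule uhf_eqI) simp
lemma star_diff: "star (X - Y) = star X - star Y" by (rule uhf_eqI) simp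
lemma star_uminus: "star (- X) = - star X" by (rule uhf_eqI) simp
lemma star_scaleR: "star (r *\<^sub>R X) = r *\<^sub>R star X" by (rule uhf_eqI) simp
lemma star_0: "star 0 = 0" by (rule uhf_eqI) simp
lemma star_1: "star 1 = 1" by (rule uhf_eqI) (simp add: ent_1)
lemma star_imag: "star imag = - imag" by (rule uhf_eqI) (simp add: ent_imag)
lemma star_star: "star (star X) = X" by (rule uhf_eqI) simp
lemma star_mult: "star (X * Y) = star Y * star X"
proof -
  obtain n where n: "lev n X" "lev n Y" using lev_common2 by blast
  show ?thesis
    by (rule lev_eqI[of n]) (use n in \<open>auto simp: ent_mult[of n] lev_mult lev_star mult.commute\<close>)
qed
lemma star_power: "star (X ^ k) = star X ^ k"
  by (induction k) (simp_all add: star_1 star_mult power_commutes)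
lemma star_sum: "star (sum f A) = (\<Sum>a\<in>A. star (f a))"
  by (induction A rule: infinite_finite_induct) (simp_all add: star_0 star_add)

lemma imag_square: "imag * imag = - 1"
  by (rule lev_eqI[of 0])
    (auto simp: ent_mult[of 0, OF lev_imag lev_imag] ent_imag ent_1 intro: lev_mult lev_imag lev_uminus lev_1)
lemma imag_commute: "X * imag = imag * X"
proof -
  obtain n where n: "lev n X" using lev_exists by blast
  show ?thesis
    by (rule lev_eqI[of n])
      (use n in \<open>auto simp: ent_mult[of n] lev_mult lev_imag ent_imag if_distrib[of "\<lambda>x. x * _"]
          if_distrib[of "\<lambda>x. _ * x"] sum.delta sum.delta' cong: if_cong\<close>)
qed

lemma lev_power: "lev n X \<Longrightarrow> lev n (X ^ k)"
  by (induction k) (simp_all add: lev_1 lev_mult)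
lemma lev_sum: "(\<And>a. a \<in> A \<Longrightarrow> lev n (f a)) \<Longrightarrow> lev n (sum f A)"
  by (induction A rule: infinite_finite_induct) (simp_all add: lev_0 lev_add)

lemmas lev_intros = lev_add lev_diff lev_uminus lev_mult lev_scaleR lev_star lev_imag lev_0 lev_1
  lev_power lev_sum

subsection \<open>The normalized trace\<close>

text \<open>Only the real part of the trace is ever needed.\<close>

definition tr :: "uhf \<Rightarrow> real" where
  "tr X = (let n = (SOME n. lev n X) in Re (\<Sum>k<2^n. ent X k k) / 2^n)"

lemma sum_lessThan_two_pow_add:
  fixes f :: "nat \<Rightarrow> 'a::comm_semiring_1"
  shows "(\<Sum>k<2^(n+m). f (k mod 2^n)) = 2^m * (\<Sum>k<2^n. f k)"
proof -
  have "(\<Sum>k<2^(n+m). f (k mod 2^n)) = (\<Sum>a<2^m. \<Sum>k | k div 2^n = a. f (k mod 2^n))"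
  proof -
    have *: "{..<2^(n+m)} = (\<Union>a\<in>{..<2^m}. {k::nat. k div 2^n = a})"
      by (auto simp: power_add less_mult_imp_div_less mult.commute div_less_iff_less_mult)
    show ?thesis unfolding *
      by (rule sum.UNION_disjoint) (auto simp: finite_block)
  qed
  then show ?thesis by (simp add: sum_block)
qed

text \<open>The level picked by \<open>SOME\<close> is immaterial: going from level n to n + m
  repeats the diagonal 2^m times, which the normalization cancels. Two arbitrary levels m and n are
  compared at level m + n.\<close>

lemma tr_eq:
  assumes "lev n X" shows "tr X = Re (\<Sum>k<2^n. ent X k k) / 2^n"
proof -
  have *: "Re (\<Sum>k<2^(n+m). ent X k k) / 2^(n+m) = Re (\<Sum>k<2^n. ent X k k) / 2^n"
    if "lev n X" for n m
  proof -
    have "(\<Sum>k<2^(n+m). ent X k k) = (\<Sum>k<2^(n+m). (\<lambda>k. ent X k k) (k mod 2^n))"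
      by (rule sum.cong[OF refl]) (subst ent_lev[OF that], simp)
    also have "\<dots> = of_real (2^m) * (\<Sum>k<2^n. ent X k k)"
      by (subst sum_lessThan_two_pow_add) simp
    finally have "Re (\<Sum>k<2^(n+m). ent X k k) = 2^m * Re (\<Sum>k<2^n. ent X k k)"
      by (simp del: of_real_power)
    then show ?thesis by (simp add: power_add)
  qed
  define m where "m = (SOME n. lev n X)"
  have m: "lev m X" unfolding m_def by (rule someI_ex[OF lev_exists])
  have "tr X = Re (\<Sum>k<2^m. ent X k k) / 2^m" by (simp add: tr_def m_def Let_def)
  also have "\<dots> = Re (\<Sum>k<2^n. ent X k k) / 2^n"
    using *[OF m, of n] *[OF assms, of m] by (simp add: add.commute)
  finally show ?thesis .
qed

lemma tr_add [simp]: "tr (X + Y) = tr X + tr Y"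
proof -
  obtain n where n: "lev n X" "lev n Y" using lev_common2 by blast
  show ?thesis using n lev_add[OF n] by (simp add: tr_eq[of n] sum.distrib add_divide_distrib)
qed
lemma tr_scaleR [simp]: "tr (r *\<^sub>R X) = r * tr X"
proof -
  obtain n where n: "lev n X" using lev_exists by blast
  show ?thesis using n lev_scaleR[OF n]
    by (simp add: tr_eq[of n] sum_distrib_left[symmetric] del: Re_sum)
qed
lemma tr_uminus [simp]: "tr (- X) = - tr X"
  using tr_scaleR[of "-1" X] by simp
lemma tr_diff [simp]: "tr (X - Y) = tr X - tr Y"
  using tr_add[of X "- Y"] by simp
lemma tr_0 [simp]: "tr 0 = 0" using tr_scaleR[of 0 0] by simp
lemma tr_1 [simp]: "tr 1 = 1" by (simp add: tr_eq[OF lev_1[of 0]] ent_1)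
lemma tr_sum: "tr (sum f A) = (\<Sum>a\<in>A. tr (f a))"
  by (induction A rule: infinite_finite_induct) simp_all
lemma tr_star [simp]: "tr (star X) = tr X"
proof -
  obtain n where n: "lev n X" using lev_exists by blast
  show ?thesis using n lev_star[OF n] by (simp add: tr_eq[of n])
qed
lemma tr_commute: "tr (X * Y) = tr (Y * X)"
proof -
  obtain n where n: "lev n X" "lev n Y" using lev_common2 by blast
  have "(\<Sum>k<2^n. \<Sum>j<2^n. ent X k j * ent Y j k) = (\<Sum>k<2^n. \<Sum>j<2^n. ent Y k j * ent X j k)"
    by (subst sum.swap) (simp add: mult.commute)
  then show ?thesis using n lev_mult[OF n] lev_mult[OF n(2,1)]
    by (simp add: tr_eq[of n] ent_mult[of n] del: Re_sum)
qed
lemma tr_square_eq: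
  assumes "lev n X"
  shows "tr (X * star X) = (\<Sum>k<2^n. \<Sum>l<2^n. (cmod (ent X k l))\<^sup>2) / 2^n"
  using assms by (simp add: tr_eq[of n] lev_intros ent_mult[of n] cmod_power2[symmetric] complex_mult_cnj)
lemma tr_square_nonneg: "0 \<le> tr (X * star X)"
proof -
  obtain n where n: "lev n X" using lev_exists by blast
  show ?thesis by (subst tr_square_eq[OF n]) (simp add: sum_nonneg)
qed
lemma tr_square_eq_0: "tr (X * star X) = 0 \<Longrightarrow> X = 0"
proof -
  assume t: "tr (X * star X) = 0"
  obtain n where n: "lev n X" using lev_exists by blast
  have "(\<Sum>k<2^n. \<Sum>l<2^n. (cmod (ent X k l))\<^sup>2) = 0"
    using t n by (simp add: tr_square_eq)
  then have "ent X k l = 0" if "k < 2^n" "l < 2^n" for k l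
    using that by (subst (asm) sum_nonneg_eq_0_iff) (auto simp: sum_nonneg sum_nonneg_eq_0_iff)
  then show ?thesis by (intro lev_eqI[OF n lev_0]) simp
qed

lemma tr_Cauchy_Schwarz: "(tr (X * star Y))\<^sup>2 \<le> tr (X * star X) * tr (Y * star Y)"
proof -
  have sym: "tr (Y * star X) = tr (X * star Y)"
    using tr_star[of "X * star Y"] by (simp add: star_mult star_star)
  define a b c where "a = tr (Y * star Y)" and "b = tr (X * star Y)" and "c = tr (X * star X)"
  have q: "0 \<le> c - 2 * t * b + t\<^sup>2 * a" for t
  proof -
    have "0 \<le> tr ((X - t *\<^sub>R Y) * star (X - t *\<^sub>R Y))" by (rule tr_square_nonneg)
    also have "\<dots> = c - 2 * t * b + t\<^sup>2 * a"
      by (simp add: star_diff star_scaleR algebra_simps sym a_def b_def c_def power2_eq_square)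
    finally show ?thesis .
  qed
  have "b\<^sup>2 \<le> c * a"
  proof (cases "a = 0")
    case True
    have "b = 0"
    proof (rule ccontr)
      assume b: "b \<noteq> 0"
      show False using q[of "(c + 1) / (2 * b)"] True b by (simp add: field_simps)
    qed
    then show ?thesis using True by simp
  next
    case False
    moreover have "a \<ge> 0" unfolding a_def by (rule tr_square_nonneg)
    ultimately have a: "a > 0" by simp
    show ?thesis using q[of "b / a"] a by (simp add: field_simps power2_eq_square)
  qed
  then show ?thesis by (simp add: a_def b_def c_def)
qed

section \<open>Pauli operators and conditional expectations\<close>

lemma less_two_pow_iff: "(k::nat) < 2^n \<longleftrightarrow> take_bit n k = k"
  by (simp add: take_bit_nat_eq_self_iff)

lemma flip_bit_less: "i < n \<Longrightarrow> k < 2^n \<Longrightarrow> flip_bit i k < (2::nat)^n"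
  unfolding less_two_pow_iff by (simp add: take_bit_flip_bit_eq)

lemma flip_bit_flip_bit [simp]: "flip_bit i (flip_bit i k) = (k::nat)"
  by (rule bit_eqI) (auto simp: bit_flip_bit_iff)

lemma nat_eq_div_mod: "(k::nat) = l \<longleftrightarrow> k div 2^n = l div 2^n \<and> k mod 2^n = l mod 2^n"
  by (metis div_mult_mod_eq)

lemma div_flip_bit: "i < n \<Longrightarrow> flip_bit i (k::nat) div 2^n = k div 2^n"
  by (simp flip: drop_bit_eq_div) (rule bit_eqI, auto simp: bit_simps)

lemma mod_flip_bit: "i < n \<Longrightarrow> flip_bit i (k::nat) mod 2^n = flip_bit i (k mod 2^n)"
  by (simp flip: take_bit_eq_mod add: take_bit_flip_bit_eq)

lemma flip_bit_eq_iff: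
  assumes "i < n"
  shows "flip_bit i (k::nat) = l \<longleftrightarrow> k div 2^n = l div 2^n \<and> flip_bit i (k mod 2^n) = l mod 2^n"
  by (subst nat_eq_div_mod[of _ _ n]) (simp add: assms div_flip_bit mod_flip_bit)

lemma level_flip: "i < n \<Longrightarrow> level n (\<lambda>k l. if flip_bit i k = l then 1 else 0)"
  unfolding level_def by (intro allI) (subst flip_bit_eq_iff, auto)

lift_definition sx :: "nat \<Rightarrow> uhf" is "\<lambda>i k l. if flip_bit i k = l then 1 else 0"
  using level_flip lessI by blast

definition sgn_bit :: "nat \<Rightarrow> nat \<Rightarrow> real" where
  "sgn_bit i k = (if bit k i then -1 else 1)"

lemma bit_mod_two_pow: "i < n \<Longrightarrow> bit ((k::nat) mod 2^n) i = bit k i"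
  by (simp flip: take_bit_eq_mod add: bit_take_bit_iff)

lemma bit_div_two_pow: "bit ((k::nat) div 2^n) i = bit k (n + i)"
  by (simp flip: drop_bit_eq_div add: bit_drop_bit_eq)

lemma level_sgn_bit: "i < n \<Longrightarrow> level n (\<lambda>k l. if k = l then of_real (sgn_bit i k) else 0)"
  unfolding level_def
proof (intro allI)
  fix k l :: nat assume "i < n"
  then show "(if k = l then complex_of_real (sgn_bit i k) else 0) =
    (if k div 2^n = l div 2^n then if k mod 2^n = l mod 2^n
       then of_real (sgn_bit i (k mod 2^n)) else 0 else 0)"
    using nat_eq_div_mod[of k l n] by (auto simp: sgn_bit_def bit_mod_two_pow)
qed

lift_definition sz :: "nat \<Rightarrow> uhf" is "\<lambda>i k l. if k = l then of_real (sgn_bit i k) else 0"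
  using level_sgn_bit lessI by blast

lemma ent_sx: "ent (sx i) k l = (if flip_bit i k = l then 1 else 0)" by transfer simp
lemma ent_sz: "ent (sz i) k l = (if k = l then of_real (sgn_bit i k) else 0)" by transfer simp

lemma lev_sx: "i < n \<Longrightarrow> lev n (sx i)"
  by transfer (rule level_flip)

lemma lev_sz: "i < n \<Longrightarrow> lev n (sz i)"
  by transfer (rule level_sgn_bit)

lemma lev_large: "\<exists>n. lev n X \<and> i < n \<and> k < (2::nat)^n \<and> l < (2::nat)^n"
proof -
  obtain m where m: "lev m X" using lev_exists by blast
  define n where "n = m + i + k + l + 1"
  have "k < 2^n" "l < 2^n"
    using less_exp[of n] by (simp_all add: n_def)
  then show ?thesis using lev_mono[OF m, of n] by (intro exI[of _ n]) (simp add: n_def)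
qed

section \<open>Entries of products with Pauli X and Z\<close>

lemma ent_sx_mult: "ent (sx i * X) k l = ent X (flip_bit i k) l"
proof -
  obtain n where n: "lev n X" "i < n" "k < 2^n" "l < 2^n" using lev_large by blast
  then show ?thesis
    by (subst ent_mult[of n]) (auto simp: lev_sx ent_sx flip_bit_less if_distrib[of "\<lambda>x. x * _"]
        sum.delta' cong: if_cong)
qed

lemma ent_mult_sx: "ent (X * sx i) k l = ent X k (flip_bit i l)"
proof -
  obtain n where n: "lev n X" "i < n" "k < 2^n" "l < 2^n" using lev_large by blast
  have *: "flip_bit i j = l \<longleftrightarrow> j = flip_bit i l" for j
    by auto
  show ?thesis using n
    by (subst ent_mult[of n]) (auto simp: lev_sx ent_sx * flip_bit_less if_distrib[of "\<lambda>x. _ * x"]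
        sum.delta cong: if_cong)
qed

lemma ent_sz_mult: "ent (sz i * X) k l = of_real (sgn_bit i k) * ent X k l"
proof -
  obtain n where n: "lev n X" "i < n" "k < 2^n" "l < 2^n" using lev_large by blast
  then show ?thesis
    by (subst ent_mult[of n]) (auto simp: lev_sz ent_sz if_distrib[of "\<lambda>x. x * _"]
        sum.delta' cong: if_cong)
qed

lemma ent_mult_sz: "ent (X * sz i) k l = of_real (sgn_bit i l) * ent X k l"
proof -
  obtain n where n: "lev n X" "i < n" "k < 2^n" "l < 2^n" using lev_large by blast
  then show ?thesis
    by (subst ent_mult[of n]) (auto simp: lev_sz ent_sz if_distrib[of "\<lambda>x. _ * x"]
        sum.delta cong: if_cong)
qed

lemma flip_bit_commute: "flip_bit i (flip_bit j k) = flip_bit j (flip_bit i (k::nat))"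
  by (rule bit_eqI) (auto simp: bit_flip_bit_iff)

lemma sgn_bit_flip: "sgn_bit i (flip_bit j k) = (if i = j then - sgn_bit i k else sgn_bit i k)"
  by (auto simp: sgn_bit_def bit_flip_bit_iff)

lemma sx_square: "sx i * sx i = 1"
  by (rule uhf_eqI) (auto simp: ent_sx_mult ent_sx ent_1)
lemma sz_square: "sz i * sz i = 1"
  by (rule uhf_eqI) (auto simp: ent_sz_mult ent_sz ent_1 sgn_bit_def)
lemma sz_sx: "sz i * sx i = - (sx i * sz i)"
  by (rule uhf_eqI) (auto simp: ent_sz_mult ent_sx_mult ent_sx ent_sz sgn_bit_flip)
lemma star_sx: "star (sx i) = sx i"
  by (rule uhf_eqI) (auto simp: ent_sx)
lemma star_sz: "star (sz i) = sz i"
  by (rule uhf_eqI) (auto simp: ent_sz)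
lemma sx_commute: "sx i * sx j = sx j * sx i"
  by (rule uhf_eqI) (auto simp: ent_sx_mult ent_sx flip_bit_commute)
lemma sz_commute: "sz i * sz j = sz j * sz i"
  by (rule uhf_eqI) (auto simp: ent_sz_mult ent_sz)
lemma sx_sz_commute: "i \<noteq> j \<Longrightarrow> sx i * sz j = sz j * sx i"
  by (rule uhf_eqI) (auto simp: ent_sz_mult ent_sx_mult ent_sx ent_sz sgn_bit_flip)

text \<open>The product i X Z is Pauli Y, so the indices 0 to 3 stand for I, X, Y, Z. Larger indices
  also give Z, so that the algebraic rules hold for every index.\<close>

definition pauli :: "nat \<Rightarrow> nat \<Rightarrow> uhf" where
  "pauli i a = (if a = 0 then 1 else if a = 1 then sx i
     else if a = 2 then imag * (sx i * sz i) else sz i)"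

lemma pauli_simps [simp]:
  "pauli i 0 = 1" "pauli i (Suc 0) = sx i" "pauli i 2 = imag * (sx i * sz i)" "pauli i 3 = sz i"
  by (simp_all add: pauli_def)

lemma lev_pauli: "i < n \<Longrightarrow> lev n (pauli i a)"
  by (simp add: pauli_def lev_intros lev_sx lev_sz)

lemma sum_upto_4: "(\<Sum>a<4. f a) = f 0 + f (Suc 0) + f 2 + (f (3::nat) :: 'a::comm_monoid_add)"
  by (simp add: eval_nat_numeral)

lemma star_pauli: "star (pauli i a) = pauli i a"
  by (simp add: pauli_def star_1 star_sx star_sz star_mult star_imag sz_sx imag_commute[of "_ * _"]
      mult.assoc) (metis imag_commute mult.assoc)

lemma mult_assoc_rule: "a * b = c \<Longrightarrow> a * (b * y) = c * (y::uhf)"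
  by (simp flip: mult.assoc)

lemmas sx_square' = mult_assoc_rule[OF sx_square, simplified]
lemmas sz_square' = mult_assoc_rule[OF sz_square, simplified]
lemmas sz_sx' = mult_assoc_rule[OF sz_sx, simplified mult.assoc mult_minus_left]
lemmas imag_square' = mult_assoc_rule[OF imag_square, simplified]
lemma imag_commutes:
  "sx i * imag = imag * sx i" "sz i * imag = imag * sz i"
  "sx i * (imag * y) = imag * (sx i * y)" "sz i * (imag * y) = imag * (sz i * y)"
  by (simp_all add: imag_commute flip: mult.assoc)

lemmas pauli_rules = sx_square sz_square sz_sx sx_square' sz_square' sz_sx' imag_square
  imag_square' imag_commutes mult.assoc

lemma pauli_square: "pauli i a * pauli i a = 1"
  by (simp add: pauli_def pauli_rules)

text \<open>Averaging the Pauli conjugations of qubit i gives the partial trace over that qubit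
  tensored with I/2: the trace preserving projection onto the operators that commute with the qubit.
  Written as an average of conjugations it visibly respects adjoints and positivity and is symmetric
  for the trace.\<close>

definition cexp :: "nat \<Rightarrow> uhf \<Rightarrow> uhf" where
  "cexp i X = (1/4) *\<^sub>R (\<Sum>a<4. pauli i a * X * pauli i a)"

lemma cexp_eq: "cexp i X = (1/4) *\<^sub>R (X + sx i * X * sx i + sx i * sz i * X * (sz i * sx i) + sz i * X * sz i)"
proof -
  have "imag * (sx i * sz i) * X * (imag * (sx i * sz i)) = imag * imag * (sx i * sz i * X * (sx i * sz i))"
    by (metis imag_commute mult.assoc)
  also have "\<dots> = sx i * sz i * X * (sz i * sx i)"
    by (simp add: imag_square sz_sx)
  finally show ?thesis by (simp add: cexp_def sum_upto_4)
qed

lemma cexp_add: "cexp i (X + Y) = cexp i X + cexp i Y"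
  by (simp add: cexp_def algebra_simps sum.distrib)
lemma cexp_scaleR: "cexp i (r *\<^sub>R X) = r *\<^sub>R cexp i X"
  by (simp add: cexp_def scaleR_sum_right)
lemma cexp_uminus: "cexp i (- X) = - cexp i X"
  using cexp_scaleR[of i "-1" X] by simp
lemma cexp_diff: "cexp i (X - Y) = cexp i X - cexp i Y"
  using cexp_add[of i X "- Y"] by (simp add: cexp_uminus)
lemma cexp_imag: "cexp i (imag * X) = imag * cexp i X"
proof -
  have "p * (imag * X) * p = imag * (p * X * p)" for p
    by (metis imag_commute mult.assoc)
  then show ?thesis by (simp add: cexp_def sum_distrib_left)
qed
lemma cexp_star: "star (cexp i X) = cexp i (star X)"
  by (simp add: cexp_def star_scaleR star_sum star_mult star_pauli mult.assoc)
lemma lev_cexp: "lev n X \<Longrightarrow> i < n \<Longrightarrow> lev n (cexp i X)"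
  by (simp add: cexp_def lev_intros lev_pauli)
lemma tr_cexp_mult: "tr (X * cexp i Y) = tr (cexp i X * Y)"
proof -
  have "tr (X * (p * Y * p)) = tr (p * X * p * Y)" for p
    using tr_commute[of "X * p * Y" p] by (simp add: mult.assoc)
  then show ?thesis
    by (simp add: cexp_def sum_distrib_left sum_distrib_right tr_sum)
qed
lemma cexp_sx: "sx i * cexp i X = cexp i X * sx i"
  by (simp add: cexp_eq pauli_rules algebra_simps)
lemma cexp_sz: "sz i * cexp i X = cexp i X * sz i"
  by (simp add: cexp_eq pauli_rules algebra_simps)
lemma cexp_pauli: "pauli i a * cexp i X = cexp i X * pauli i a"
proof -
  have "sx i * sz i * cexp i X = cexp i X * (sx i * sz i)"
    by (metis cexp_sx cexp_sz mult.assoc)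
  then show ?thesis
    unfolding pauli_def using cexp_sx cexp_sz by (simp add: mult.assoc) (metis imag_commute mult.assoc)
qed
lemma cexp_id:
  assumes "sx i * X = X * sx i" "sz i * X = X * sz i" shows "cexp i X = X"
proof -
  have "sx i * X * sx i = X" "sz i * X * sz i = X"
    by (simp_all add: assms mult.assoc sx_square sz_square)
  moreover have "sx i * sz i * X * (sz i * sx i) = sx i * (sz i * X * sz i) * sx i"
    by (simp add: mult.assoc)
  ultimately have "cexp i X = (1/4) *\<^sub>R (X + X + X + X)" by (simp add: cexp_eq)
  also have "\<dots> = (1/4 + 1/4 + 1/4 + 1/4) *\<^sub>R X"
    by (simp only: scaleR_add_left scaleR_add_right)
  finally show ?thesis by simp
qed
lemma cexp_1: "cexp i 1 = 1"
  by (rule cexp_id) simp_all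
lemma tr_cexp: "tr (cexp i X) = tr X"
  using tr_cexp_mult[of 1 i X] by (simp add: cexp_1)
lemma cexp_idem: "cexp i (cexp i X) = cexp i X"
  by (rule cexp_id[OF cexp_sx cexp_sz])

lemma cexp_sx_mult: "cexp i (sx i * X) = cexp i (X * sx i)"
  by (simp add: cexp_eq pauli_rules algebra_simps)
lemma cexp_sz_mult: "cexp i (sz i * X) = cexp i (X * sz i)"
  by (simp add: cexp_eq pauli_rules algebra_simps)
lemma cexp_pauli_mult: "cexp i (pauli i a * X) = cexp i (X * pauli i a)"
proof -
  have "cexp i (sx i * sz i * X) = cexp i (X * (sx i * sz i))"
    by (metis cexp_sx_mult cexp_sz_mult mult.assoc)
  then show ?thesis
    unfolding pauli_def using cexp_sx_mult cexp_sz_mult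
    by (simp add: mult.assoc cexp_imag) (metis imag_commute mult.assoc cexp_imag)
qed

lemma pauli_commute:
  assumes "i \<noteq> j" shows "pauli i a * pauli j b = pauli j b * pauli i a"
proof -
  have x: "sx i * pauli j b = pauli j b * sx i"
    using assms sx_commute[of i j] sx_sz_commute[of i j] unfolding pauli_def
    by simp (metis imag_commute mult.assoc)
  have z: "sz i * pauli j b = pauli j b * sz i"
    using assms sz_commute[of i j] sx_sz_commute[of j i] unfolding pauli_def
    by simp (metis imag_commute mult.assoc)
  have xz: "sx i * sz i * pauli j b = pauli j b * (sx i * sz i)"
    by (metis x z mult.assoc)
  show ?thesis
    using x z xz unfolding pauli_def[of i a] by simp (metis imag_commute mult.assoc)
qed

lemma cexp_mult_commuting:
  assumes "\<And>a. pauli i a * Y = Y * pauli i a"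
  shows "cexp i (X * Y) = cexp i X * Y" "cexp i (Y * X) = Y * cexp i X"
proof -
  have "p * (X * Y) * p = p * X * p * Y" "p * (Y * X) * p = Y * (p * X * p)"
    if "p * Y = Y * p" for p
    using that by (metis mult.assoc)+
  then show "cexp i (X * Y) = cexp i X * Y" "cexp i (Y * X) = Y * cexp i X"
    by (simp_all add: cexp_def sum_distrib_left sum_distrib_right assms)
qed

lemma cexp_pauli_other:
  assumes "i \<noteq> j" shows "cexp i (pauli j b * X) = pauli j b * cexp i X"
  by (rule cexp_mult_commuting) (rule pauli_commute[OF assms])

lemma cexp_pauli_other':
  assumes "i \<noteq> j" shows "cexp i (X * pauli j b) = cexp i X * pauli j b"
  by (rule cexp_mult_commuting) (rule pauli_commute[OF assms])

lemma cexp_sum: "cexp i (sum f A) = (\<Sum>a\<in>A. cexp i (f a))"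
  by (induction A rule: infinite_finite_induct) (simp_all add: cexp_add cexp_scaleR[of i 0 0, simplified])

lemma cexp_cexp: "cexp i (cexp j X) = cexp j (cexp i X)"
proof (cases "i = j")
  case False
  then show ?thesis
    by (subst (1 2) cexp_def[of j])
      (simp add: cexp_scaleR cexp_sum cexp_pauli_other cexp_pauli_other')
qed simp

text \<open>Commuting with Z on qubit m annihilates the entries whose bits m differ, and commuting
  with X makes the two remaining diagonal blocks equal. This drop in level drives the inductions
  over qubits.\<close>

lemma lev_cexp_last:
  assumes "lev (Suc m) X" shows "lev m (cexp m X)"
proof -
  define Y where "Y = cexp m X"
  have Y: "lev (Suc m) Y" unfolding Y_def using assms by (rule lev_cexp) simp
  have x: "ent Y (flip_bit m k) l = ent Y k (flip_bit m l)" for k l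
    using arg_cong[OF cexp_sx[of m X], of "\<lambda>Z. ent Z k l"]
    by (simp add: ent_sx_mult ent_mult_sx Y_def)
  have z: "sgn_bit m k * ent Y k l = sgn_bit m l * ent Y k l" for k l
    using arg_cong[OF cexp_sz[of m X], of "\<lambda>Z. ent Z k l"]
    by (simp add: ent_sz_mult ent_mult_sz Y_def)
  have "ent Y k l = (if k div 2^m = l div 2^m then ent Y (k mod 2^m) (l mod 2^m) else 0)" for k l
  proof (cases "bit k m = bit l m \<and> k div 2^Suc m = l div 2^Suc m")
    case False
    then have "k div 2^m \<noteq> l div 2^m"
      using bit_div_two_pow[of k m 0] bit_div_two_pow[of l m 0]
      by (auto simp: power_Suc2 div_mult2_eq simp del: power_Suc)
    moreover have "ent Y k l = 0"
    proof (cases "bit k m = bit l m")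
      case True
      with False show ?thesis by (subst ent_lev[OF Y]) auto
    next
      case False
      with z[of k l] show ?thesis by (auto simp: sgn_bit_def split: if_splits)
    qed
    ultimately show ?thesis by simp
  next
    case True
    let ?k = "k mod 2^Suc m" and ?l = "l mod 2^Suc m"
    have kd: "k div 2^m = l div 2^m"
      using True bit_div_two_pow[of k m 0] bit_div_two_pow[of l m 0]
      by (simp add: power_Suc2 div_mult2_eq bit_0 del: power_Suc) (metis div_mult_mod_eq even_iff_mod_2_eq_zero odd_iff_mod_2_eq_one)
    have e: "ent Y k l = ent Y ?k ?l" using True by (subst ent_lev[OF Y]) auto
    have f: "j mod 2^Suc m = (if bit j m then flip_bit m (j mod 2^m) else j mod 2^m)" for j :: nat
      by (simp flip: take_bit_eq_mod del: power_Suc)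
        (rule conjI; rule impI; rule bit_eqI; auto simp: bit_simps less_Suc_eq)
    have "ent Y ?k ?l = ent Y (k mod 2^m) (l mod 2^m)"
      unfolding f using True x[of "k mod 2^m" "flip_bit m (l mod 2^m)"] by simp
    with kd e show ?thesis by simp
  qed
  then show ?thesis unfolding Y_def by (rule levI)
qed

subsection \<open>Pauli components\<close>

text \<open>Expanding X in the Pauli basis of qubit i, with operators on the other qubits as
  coefficients, this is the coefficient of the a-th Pauli operator.\<close>

definition cmp :: "nat \<Rightarrow> nat \<Rightarrow> uhf \<Rightarrow> uhf" where
  "cmp i a X = cexp i (pauli i a * X)"

lemma cmp_0: "cmp i 0 X = cexp i X" by (simp add: cmp_def)

text \<open>The sum over a of P_a P_b P_a vanishes for b other than 0 and is 4 for b = 0, so of the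
  sixteen terms only four copies of X survive.\<close>

lemma cmp_expand: "X = (\<Sum>a<4. pauli i a * cmp i a X)"
proof -
  have "(\<Sum>a<4. pauli i a * cmp i a X) = (1/4) *\<^sub>R (X + X + X + X)"
    by (simp add: sum_upto_4 cmp_def cexp_eq pauli_rules algebra_simps)
  also have "\<dots> = (1/4 + 1/4 + 1/4 + 1/4) *\<^sub>R X"
    by (simp only: scaleR_add_left scaleR_add_right)
  finally show ?thesis by simp
qed

lemma cmp_star: "star X = X \<Longrightarrow> star (cmp i a X) = cmp i a X"
  by (simp add: cmp_def cexp_star star_mult star_pauli cexp_pauli_mult)

lemma pauli_cmp: "pauli i b * cmp i a X = cmp i a X * pauli i b"
  by (simp add: cmp_def cexp_pauli)

lemma lev_cmp_last: "lev (Suc m) X \<Longrightarrow> lev m (cmp m a X)"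
  unfolding cmp_def by (rule lev_cexp_last) (simp add: lev_mult lev_pauli)

text \<open>Parseval's identity in one qubit; iterated over the qubits it turns traces into sums
  over Pauli strings.\<close>

lemma tr_mult_cmp: "tr (X * Y) = (\<Sum>a<4. tr (cmp i a X * cmp i a Y))"
proof -
  have "tr (X * Y) = (\<Sum>a<4. tr (X * (pauli i a * cmp i a Y)))"
    by (subst (1) cmp_expand[of Y i]) (simp add: sum_distrib_left tr_sum)
  also have "\<dots> = (\<Sum>a<4. tr (cmp i a X * cmp i a Y))"
  proof (rule sum.cong[OF refl])
    fix a
    have "tr (X * (pauli i a * cmp i a Y)) = tr (X * pauli i a * cexp i (cmp i a Y))"
      by (simp add: cmp_def cexp_idem mult.assoc)
    also have "\<dots> = tr (cmp i a X * cmp i a Y)"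
      by (simp add: tr_cexp_mult cmp_def cexp_pauli_mult)
    finally show "tr (X * (pauli i a * cmp i a Y)) = tr (cmp i a X * cmp i a Y)" .
  qed
  finally show ?thesis .
qed

subsection \<open>Depolarizing noise\<close>

text \<open>The parameter r is the retained fraction 1 - p: the identity component of qubit i is
  kept and the three others are scaled by r. As r varies, this is the noise semigroup written
  multiplicatively.\<close>

definition dep :: "nat \<Rightarrow> real \<Rightarrow> uhf \<Rightarrow> uhf" where
  "dep i r X = cexp i X + r *\<^sub>R (X - cexp i X)"

fun deps :: "nat \<Rightarrow> real \<Rightarrow> uhf \<Rightarrow> uhf" where
  "deps 0 r X = X"
| "deps (Suc m) r X = dep m r (deps m r X)"

lemma dep_star: "star (dep i r X) = dep i r (star X)"
  by (simp add: dep_def star_add star_scaleR star_diff cexp_star)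
lemma deps_star: "star (deps m r X) = deps m r (star X)"
  by (induction m) (simp_all add: dep_star)
lemma lev_dep: "lev n X \<Longrightarrow> i < n \<Longrightarrow> lev n (dep i r X)"
  by (simp add: dep_def lev_intros lev_cexp)
lemma lev_deps: "lev n X \<Longrightarrow> m \<le> n \<Longrightarrow> lev n (deps m r X)"
  by (induction m) (simp_all add: lev_dep)
lemma tr_dep: "tr (dep i r X) = tr X"
  by (simp add: dep_def tr_cexp)
lemma tr_deps: "tr (deps m r X) = tr X"
  by (induction m) (simp_all add: tr_dep)
lemma dep_add: "dep i r (X + Y) = dep i r X + dep i r Y"
  by (simp add: dep_def cexp_add algebra_simps)
lemma dep_scaleR: "dep i r (s *\<^sub>R X) = s *\<^sub>R dep i r X"
  by (simp add: dep_def cexp_scaleR algebra_simps)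
lemma dep_diff: "dep i r (X - Y) = dep i r X - dep i r Y"
  by (simp add: dep_def cexp_diff algebra_simps)
lemma cexp_dep: "cexp j (dep i r X) = dep i r (cexp j X)"
  by (simp add: dep_def cexp_add cexp_scaleR cexp_diff cexp_cexp[of j i])
lemma cexp_deps: "cexp j (deps m r X) = deps m r (cexp j X)"
  by (induction m) (simp_all add: cexp_dep)
lemma dep_dep: "dep i r (dep j s X) = dep j s (dep i r X)"
  by (subst (1 3) dep_def) (simp add: dep_add dep_scaleR dep_diff cexp_dep)
lemma dep_deps: "dep i r (deps m s X) = deps m s (dep i r X)"
  by (induction m) (simp_all add: dep_dep[of i])
lemma tr_dep_mult: "tr (X * dep i r Y) = tr (dep i r X * Y)"
  by (simp add: dep_def algebra_simps tr_cexp_mult)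
lemma tr_deps_mult: "tr (X * deps m r Y) = tr (deps m r X * Y)"
  by (induction m arbitrary: X) (simp_all add: tr_dep_mult flip: dep_deps)
lemma deps_pauli_other:
  "m \<le> i \<Longrightarrow> deps m r (pauli i a * X) = pauli i a * deps m r X"
  by (induction m) (simp_all add: dep_def cexp_pauli_other algebra_simps)
lemma cmp_deps: "m \<le> i \<Longrightarrow> cmp i a (deps m r X) = deps m r (cmp i a X)"
  by (simp add: cmp_def cexp_deps flip: deps_pauli_other)
lemma cmp_dep: "a < 4 \<Longrightarrow> cmp i a (dep i r X) = (if a = 0 then 1 else r) *\<^sub>R cmp i a X"
proof -
  assume "a < 4"
  then consider "a = 0" | "a = 1" | "a = 2" | "a = 3" by linarith
  moreover have "cmp i a (cexp i X) = 0" if "a \<in> {1,2,3}"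
    using that by (auto simp: cmp_def cexp_eq pauli_rules algebra_simps)
  ultimately show ?thesis
    by cases (simp_all add: cmp_0 dep_def cexp_add cexp_scaleR cexp_diff cexp_idem,
      simp_all add: cmp_def dep_def cexp_add cexp_scaleR cexp_diff algebra_simps)
qed

lemma lev_0_scalar:
  assumes "lev 0 X" "star X = X" shows "X = tr X *\<^sub>R 1"
proof (rule lev_eqI)
  have "cnj (ent X 0 0) = ent X 0 0"
    using arg_cong[OF assms(2), of "\<lambda>Y. ent Y 0 0"] by simp
  then show "ent X k l = ent (tr X *\<^sub>R 1) k l" if "k < 2^0" "l < 2^0" for k l
    using that by (simp add: tr_eq[OF assms(1)] ent_1 complex_eq_iff)
qed (simp_all add: assms lev_intros)

lemma deps_0_lev: "lev n X \<Longrightarrow> star X = X \<Longrightarrow> deps n 0 X = tr X *\<^sub>R 1"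
proof (induction n arbitrary: X)
  case (Suc n)
  have "deps (Suc n) 0 X = deps n 0 (cexp n X)"
    by (simp add: dep_def cexp_deps)
  also have "\<dots> = tr X *\<^sub>R 1"
    using Suc by (simp add: lev_cexp_last cexp_star tr_cexp)
  finally show ?case .
qed (simp add: lev_0_scalar[symmetric])

section \<open>Hypercontractivity\<close>

definition norm2 :: "uhf \<Rightarrow> real" where
  "norm2 X = sqrt (tr (X * star X))"

lemma norm2_nonneg [simp]: "0 \<le> norm2 X"
  by (simp add: norm2_def tr_square_nonneg)

lemma norm2_square: "(norm2 X)\<^sup>2 = tr (X * star X)"
  by (simp add: norm2_def tr_square_nonneg)

lemma tr_mult_le_norm2: "tr (X * star Y) \<le> norm2 X * norm2 Y"
proof (rule power2_le_imp_le)
  show "(tr (X * star Y))\<^sup>2 \<le> (norm2 X * norm2 Y)\<^sup>2"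
    using tr_Cauchy_Schwarz[of X Y] by (simp add: power_mult_distrib norm2_square)
qed simp

lemma norm2_triangle: "norm2 (X + Y) \<le> norm2 X + norm2 Y"
proof (rule power2_le_imp_le)
  have "tr (Y * star X) = tr (X * star Y)"
    using tr_star[of "X * star Y"] by (simp add: star_mult star_star)
  then have "(norm2 (X + Y))\<^sup>2 = (norm2 X)\<^sup>2 + (norm2 Y)\<^sup>2 + 2 * tr (X * star Y)"
    by (simp add: norm2_square star_add algebra_simps)
  also have "\<dots> \<le> (norm2 X + norm2 Y)\<^sup>2"
    using tr_mult_le_norm2[of X Y] by (simp add: power2_sum)
  finally show "(norm2 (X + Y))\<^sup>2 \<le> (norm2 X + norm2 Y)\<^sup>2" .
qed simp

lemma norm2_uminus: "norm2 (- X) = norm2 X"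
  by (simp add: norm2_def star_uminus)

lemma norm2_diff: "norm2 (X - Y) \<le> norm2 X + norm2 Y"
  using norm2_triangle[of X "- Y"] by (simp add: norm2_uminus)

lemma norm2_imag: "norm2 (imag * X) = norm2 X"
proof -
  have "tr (imag * X * (star X * - imag)) = tr (X * star X)"
    using tr_commute[of "imag * X * star X" "- imag"]
    by (simp add: mult.assoc imag_square')
  then show ?thesis by (simp add: norm2_def star_mult star_imag)
qed

lemma tr_square_mult_le:
  assumes "star A = A" "star B = B" "tr (A^4) \<le> a^4" "tr (B^4) \<le> b^4" "0 \<le> a" "0 \<le> b"
  shows "tr (A * A * (B * B)) \<le> a\<^sup>2 * b\<^sup>2"
proof -
  have le: "norm2 (C * C) \<le> c\<^sup>2" if "star C = C" "tr (C^4) \<le> c^4" for C c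
  proof (rule power2_le_imp_le)
    have "(norm2 (C * C))\<^sup>2 = tr (C^4)"
      by (simp only: norm2_square star_mult that power4_eq_xxxx mult.assoc)
    then show "(norm2 (C * C))\<^sup>2 \<le> (c\<^sup>2)\<^sup>2"
      using that(2) by (simp flip: power_mult)
  qed simp
  have "norm2 (A * A) \<le> a\<^sup>2" "norm2 (B * B) \<le> b\<^sup>2"
    by (rule le; fact assms)+
  then have "norm2 (A * A) * norm2 (B * B) \<le> a\<^sup>2 * b\<^sup>2"
    by (intro mult_mono) auto
  moreover have "tr (A * A * (B * B)) \<le> norm2 (A * A) * norm2 (B * B)"
    using tr_mult_le_norm2[of "A * A" "B * B"] assms by (simp add: star_mult)
  ultimately show ?thesis by linarith
qed

text \<open>Hoelder's inequality with exponents 4 and 4: by cyclicity the squared 2-norm of A B is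
  tr (A^2 B^2), the inner product of two squares, to which Cauchy-Schwarz applies.\<close>

lemma norm2_mult_le:
  assumes "star A = A" "star B = B" "tr (A^4) \<le> a^4" "tr (B^4) \<le> b^4" "0 \<le> a" "0 \<le> b"
  shows "norm2 (A * B) \<le> a * b"
proof (rule power2_le_imp_le)
  have "(norm2 (A * B))\<^sup>2 = tr (A * A * (B * B))"
    using tr_commute[of "A * (B * B)" A] assms
    by (simp add: norm2_square star_mult mult.assoc)
  also have "\<dots> \<le> (a * b)\<^sup>2"
    using tr_square_mult_le[OF assms] by (simp add: power_mult_distrib)
  finally show "(norm2 (A * B))\<^sup>2 \<le> (a * b)\<^sup>2" .
qed (use assms in simp)

text \<open>Here a, x, y, z stand for the 4-norms of the four Pauli components of an operator. The
  terms a^2 x^2 rule out a constant below 3. Taking 7/2 leaves a^2 (x^2 + y^2 + z^2) in hand, which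
  completes the mixed term - 24 a x y z to squares.\<close>

lemma real_four_norm_ineq:
  fixes a x y z :: real
  shows "(a\<^sup>2 + x\<^sup>2 + y\<^sup>2 + z\<^sup>2)\<^sup>2 + (2*a*x + 2*y*z)\<^sup>2 + (2*a*y + 2*x*z)\<^sup>2 + (2*a*z + 2*x*y)\<^sup>2
    \<le> (a\<^sup>2 + 7/2 * (x\<^sup>2 + y\<^sup>2 + z\<^sup>2))\<^sup>2"
proof -
  have "(a\<^sup>2 + 7/2 * (x\<^sup>2 + y\<^sup>2 + z\<^sup>2))\<^sup>2 - ((a\<^sup>2 + x\<^sup>2 + y\<^sup>2 + z\<^sup>2)\<^sup>2 + (2*a*x + 2*y*z)\<^sup>2 + (2*a*y + 2*x*z)\<^sup>2 + (2*a*z + 2*x*y)\<^sup>2)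
    = (a*x - 4*y*z)\<^sup>2 + (a*y - 4*x*z)\<^sup>2 + (a*z - 4*x*y)\<^sup>2
      + 5 * ((x\<^sup>2 - y\<^sup>2)\<^sup>2 + (y\<^sup>2 - z\<^sup>2)\<^sup>2 + (z\<^sup>2 - x\<^sup>2)\<^sup>2)
      + 5/4 * (x^4 + y^4 + z^4) + 25/2 * (x\<^sup>2 * y\<^sup>2 + y\<^sup>2 * z\<^sup>2 + z\<^sup>2 * x\<^sup>2)"
    by (simp add: power2_eq_square power4_eq_xxxx field_simps)
  also have "\<dots> \<ge> 0"
    by (intro add_nonneg_nonneg mult_nonneg_nonneg) auto
  finally show ?thesis by simp
qed

text \<open>Uniqueness of the Pauli expansion, from the orthogonality of the Pauli operators under
  \<open>cexp\<close>; it allows the components of a square to be read off.\<close>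

lemma cmp_sum_pauli:
  assumes "\<And>a. cexp i (N a) = N a" "c < 4"
  shows "cmp i c (\<Sum>a<4. pauli i a * N a) = N c"
proof -
  have *: "cmp i c (pauli i a * N a) = cexp i (pauli i c * pauli i a) * N a" for a
    unfolding cmp_def mult.assoc[symmetric]
    by (rule cexp_mult_commuting) (metis assms(1) cexp_pauli)
  have "(1/4::real) *\<^sub>R (of_real 4 :: uhf) = 1"
    unfolding of_real_def by simp
  then have quarter: "(1/4::real) *\<^sub>R (4 :: uhf) = 1" by simp
  have "cexp i (pauli i c * pauli i a) = (if a = c then 1 else 0)" if "a < 4" for a
  proof -
    have "a = 0 \<or> a = 1 \<or> a = 2 \<or> a = 3" "c = 0 \<or> c = 1 \<or> c = 2 \<or> c = 3"
      using that assms(2) by auto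
    then show ?thesis
      using quarter by (elim disjE) (simp_all add: pauli_rules cexp_1 cexp_eq)
  qed
  then have "cmp i c (\<Sum>a<4. pauli i a * N a) = (\<Sum>a<4. (if a = c then 1 else 0) * N a)"
    using * by (simp add: cmp_def sum_distrib_left cexp_sum)
  also have "\<dots> = N c"
    using assms(2) by (simp add: if_distrib[of "\<lambda>x. x * _"] cong: if_cong)
  finally show ?thesis .
qed

text \<open>The fourth moment of X is the squared 2-norm of X * X, which Parseval splits into the
  components of the square. Each of these is a sum of products of two components of X, so Hoelder
  bounds it by their 4-norms and the operator inequality becomes one about four real
  numbers.\<close>

lemma four_norm_split:
  assumes X: "star X = X" and x: "\<And>a. a < 4 \<Longrightarrow> tr (cmp i a X ^ 4) \<le> (x a)\<^sup>2" "\<And>a. a < 4 \<Longrightarrow> 0 \<le> x a"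
  shows "tr (X^4) \<le> (x 0 + 7/2 * (x 1 + x 2 + x 3))\<^sup>2"
proof -
  define A where "A a = cmp i a X" for a
  define s where "s a = sqrt (x a)" for a
  have s: "0 \<le> s a" "(s a)\<^sup>2 = x a" "tr (A a ^ 4) \<le> s a ^ 4" if "a < 4" for a
    using x[OF that] by (simp_all add: s_def A_def) (simp flip: power_mult add: power4_eq_xxxx power2_eq_square mult.assoc)
  have A: "star (A a) = A a" for a unfolding A_def by (rule cmp_star[OF X])
  have Ax: "A a * sx i = sx i * A a" "A a * (sx i * Y) = sx i * (A a * Y)"
    "A a * sz i = sz i * A a" "A a * (sz i * Y) = sz i * (A a * Y)"
    "A a * imag = imag * A a" "A a * (imag * Y) = imag * (A a * Y)" for a Y
    using pauli_cmp[of i 1 a X] pauli_cmp[of i 3 a X] imag_commute[of "A a"]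
    by (simp_all add: A_def flip: mult.assoc)
  \<comment> \<open>The components of the square. Besides the products with the identity component
    there are commutators of the two other components, with a factor i from P_2 P_3 = i P_1 and its
    cyclic shifts.\<close>
  define N where "N c = (if c = 0 then A 0 * A 0 + A 1 * A 1 + A 2 * A 2 + A 3 * A 3
    else if c = 1 then A 0 * A 1 + A 1 * A 0 + (imag * (A 2 * A 3) - imag * (A 3 * A 2))
    else if c = 2 then A 0 * A 2 + A 2 * A 0 + (imag * (A 3 * A 1) - imag * (A 1 * A 3))
    else A 0 * A 3 + A 3 * A 0 + (imag * (A 1 * A 2) - imag * (A 2 * A 1)))" for c :: nat
  have NX: "X * X = (\<Sum>c<4. pauli i c * N c)"
    apply (subst (1 2) cmp_expand[of X i])
    apply (fold A_def)
    apply (simp add: sum_upto_4 N_def pauli_rules Ax algebra_simps)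
    done
  have NA: "cexp i (A a * A b) = A a * A b" for a b
    by (rule cexp_id) (metis Ax(1) mult.assoc, metis Ax(3) mult.assoc)
  have "cexp i (N c) = N c" for c
    by (simp add: N_def cexp_add cexp_diff cexp_imag NA)
  then have cN: "cmp i c (X * X) = N c" if "c < 4" for c
    unfolding NX using that by (intro cmp_sum_pauli) auto
  have m: "norm2 (A a * A b) \<le> s a * s b" if "a < 4" "b < 4" for a b
    using that by (intro norm2_mult_le A s)
  have n4: "norm2 (a + b + (imag * c - imag * d)) \<le> norm2 a + norm2 b + (norm2 c + norm2 d)" for a b c d
    using norm2_triangle[of "a + b" "imag * c - imag * d"] norm2_triangle[of a b]
      norm2_diff[of "imag * c" "imag * d"] by (simp add: norm2_imag)
  have N0: "norm2 (N 0) \<le> (s 0)\<^sup>2 + (s 1)\<^sup>2 + (s 2)\<^sup>2 + (s 3)\<^sup>2"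
    using norm2_triangle[of "A 0 * A 0 + A 1 * A 1 + A 2 * A 2" "A 3 * A 3"]
      norm2_triangle[of "A 0 * A 0 + A 1 * A 1" "A 2 * A 2"]
      norm2_triangle[of "A 0 * A 0" "A 1 * A 1"] m[of 0 0] m[of 1 1] m[of 2 2] m[of 3 3]
    by (simp add: N_def power2_eq_square)
  have N1: "norm2 (N 1) \<le> 2 * s 0 * s 1 + 2 * s 2 * s 3"
    using n4[of "A 0 * A 1" "A 1 * A 0" "A 2 * A 3" "A 3 * A 2"] m[of 0 1] m[of 1 0] m[of 2 3] m[of 3 2]
    by (simp add: N_def mult.commute mult.left_commute)
  have N2: "norm2 (N 2) \<le> 2 * s 0 * s 2 + 2 * s 1 * s 3"
    using n4[of "A 0 * A 2" "A 2 * A 0" "A 3 * A 1" "A 1 * A 3"] m[of 0 2] m[of 2 0] m[of 1 3] m[of 3 1]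
    by (simp add: N_def mult.commute mult.left_commute)
  have N3: "norm2 (N 3) \<le> 2 * s 0 * s 3 + 2 * s 1 * s 2"
    using n4[of "A 0 * A 3" "A 3 * A 0" "A 1 * A 2" "A 2 * A 1"] m[of 0 3] m[of 3 0] m[of 1 2] m[of 2 1]
    by (simp add: N_def mult.commute mult.left_commute)
  have sN: "star (N c) = N c" if "c < 4" for c
    unfolding cN[OF that, symmetric] by (rule cmp_star) (simp add: star_mult X)
  have "tr (X^4) = tr (X * X * (X * X))"
    by (simp add: power4_eq_xxxx mult.assoc)
  also have "\<dots> = (\<Sum>c<4. (norm2 (N c))\<^sup>2)"
    by (subst tr_mult_cmp[of _ _ i], rule sum.cong) (simp_all add: cN norm2_square sN)
  also have "\<dots> = (norm2 (N 0))\<^sup>2 + (norm2 (N 1))\<^sup>2 + (norm2 (N 2))\<^sup>2 + (norm2 (N 3))\<^sup>2"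
    by (simp add: sum_upto_4)
  also have "\<dots> \<le> ((s 0)\<^sup>2 + (s 1)\<^sup>2 + (s 2)\<^sup>2 + (s 3)\<^sup>2)\<^sup>2 + (2 * s 0 * s 1 + 2 * s 2 * s 3)\<^sup>2
      + (2 * s 0 * s 2 + 2 * s 1 * s 3)\<^sup>2 + (2 * s 0 * s 3 + 2 * s 1 * s 2)\<^sup>2"
    using N0 N1 N2 N3 by (intro add_mono power_mono) auto
  also have "\<dots> \<le> ((s 0)\<^sup>2 + 7/2 * ((s 1)\<^sup>2 + (s 2)\<^sup>2 + (s 3)\<^sup>2))\<^sup>2"
    by (rule real_four_norm_ineq)
  finally show ?thesis by (simp add: s)
qed

text \<open>\<open>pweight s m X\<close> is the sum of \<open>s\<^sup>w (tr (P X))\<^sup>2\<close> over the Pauli strings \<open>P\<close> on the first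
  \<open>m\<close> qubits, where \<open>w\<close> is the weight of \<open>P\<close>.\<close>

fun pweight :: "real \<Rightarrow> nat \<Rightarrow> uhf \<Rightarrow> real" where
  "pweight s 0 X = (tr X)\<^sup>2"
| "pweight s (Suc m) X = pweight s m (cmp m 0 X)
     + s * (pweight s m (cmp m 1 X) + pweight s m (cmp m 2 X) + pweight s m (cmp m 3 X))"

lemma pweight_nonneg: "0 \<le> s \<Longrightarrow> 0 \<le> pweight s m X"
  by (induction m arbitrary: X) simp_all

lemma pweight_scaleR: "pweight s m (c *\<^sub>R X) = c\<^sup>2 * pweight s m X"
proof (induction m arbitrary: X)
  case (Suc m)
  have "cmp m a (c *\<^sub>R X) = c *\<^sub>R cmp m a X" for a
    by (simp add: cmp_def cexp_scaleR)
  with Suc show ?case by (simp add: algebra_simps)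
qed (simp add: power_mult_distrib)

text \<open>Noise scales the coefficient of a string of weight w by r^w, hence its square by
  (r^2)^w.\<close>

lemma pweight_deps: "pweight s m (deps m r X) = pweight (s * r\<^sup>2) m X"
proof (induction m arbitrary: X)
  case (Suc m)
  have "cmp m a (deps (Suc m) r X) = (if a = 0 then 1 else r) *\<^sub>R deps m r (cmp m a X)" if "a < 4" for a
    using that by (simp add: cmp_dep cmp_deps)
  with Suc show ?case
    by (simp add: pweight_scaleR algebra_simps del: deps.simps)
qed simp

lemma pweight_1: "lev m X \<Longrightarrow> star X = X \<Longrightarrow> pweight 1 m X = tr (X * X)"
proof (induction m arbitrary: X)
  case 0
  obtain c where "X = c *\<^sub>R 1" using lev_0_scalar[OF 0] by blast
  then show ?case by (simp add: power2_eq_square)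
next
  case (Suc m)
  then show ?case
    by (subst tr_mult_cmp[of X X m]) (simp add: sum_upto_4 lev_cmp_last cmp_star)
qed

text \<open>Induction over the qubits, each nonidentity Pauli factor costing 7/2. After noise with
  r^2 = 2/7 the right side becomes the squared second moment, which is the 2-to-4 hypercontractive
  inequality.\<close>

theorem four_norm_le_pweight:
  "lev m X \<Longrightarrow> star X = X \<Longrightarrow> tr (X^4) \<le> (pweight (7/2) m X)\<^sup>2"
proof (induction m arbitrary: X)
  case 0
  obtain c where "X = c *\<^sub>R 1" using lev_0_scalar[OF 0] by blast
  then show ?case by (simp add: power4_eq_xxxx power2_eq_square)
next
  case (Suc m)
  have "tr (X^4) \<le> (pweight (7/2) m (cmp m 0 X) + 7/2 *
     (pweight (7/2) m (cmp m 1 X) + pweight (7/2) m (cmp m 2 X) + pweight (7/2) m (cmp m 3 X)))\<^sup>2"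
    by (rule four_norm_split[OF Suc.prems(2), of m "\<lambda>a. pweight (7/2) m (cmp m a X)"])
      (use Suc in \<open>auto intro!: Suc.IH lev_cmp_last cmp_star pweight_nonneg\<close>)
  then show ?case by simp
qed

text \<open>The number operator: a Pauli string with w nonidentity factors on the first m qubits is
  an eigenvector with eigenvalue w. It generates the noise semigroup, and
  \<open>tr (X * lap m X)\<close> is the Dirichlet form.\<close>

definition lap :: "nat \<Rightarrow> uhf \<Rightarrow> uhf" where
  "lap m X = (\<Sum>i<m. X - cexp i X)"

lemma cmp_lap: "cmp m a (lap m X) = lap m (cmp m a X)"
proof -
  have "cmp m a (X - cexp i X) = cmp m a X - cexp i (cmp m a X)" if "i < m" for i
    using that by (simp add: cmp_def algebra_simps cexp_diff cexp_cexp[of m i] flip: cexp_pauli_other[of i m])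
  then show ?thesis
    by (simp add: lap_def cmp_def sum_distrib_left cexp_sum)
qed

lemma tr_lap_Suc:
  "tr (X * lap (Suc m) X) = (\<Sum>a<4. tr (cmp m a X * lap m (cmp m a X)))
     + (\<Sum>a\<in>{1,2,3}. tr (cmp m a X * cmp m a X))"
proof -
  have "tr (X * cexp m X) = tr (cexp m X * cexp m X)"
    by (metis cexp_idem tr_cexp_mult)
  then have "tr (X * (X - cexp m X)) = (\<Sum>a\<in>{1,2,3}. tr (cmp m a X * cmp m a X))"
    using tr_mult_cmp[of X X m] by (simp add: sum_upto_4 cmp_0 algebra_simps)
  moreover have "tr (X * lap m X) = (\<Sum>a<4. tr (cmp m a X * lap m (cmp m a X)))"
    by (subst tr_mult_cmp[of X _ m]) (simp add: cmp_lap)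
  ultimately show ?thesis
    by (simp add: lap_def algebra_simps)
qed

text \<open>The witness q w is the squared 2-norm of the part of X of weight w. That one q serves
  every s allows the effect of noise at a single s to be compared with the mean weight.\<close>

lemma pweight_expansion:
  assumes "lev m X" "star X = X"
  shows "\<exists>q. (\<forall>w. 0 \<le> q w) \<and> (\<forall>s. pweight s m X = (\<Sum>w\<le>m. q w * s^w)) \<and>
    tr (X * lap m X) = (\<Sum>w\<le>m. q w * real w)"
  using assms
proof (induction m arbitrary: X)
  case 0
  show ?case
    by (rule exI[of _ "\<lambda>_. (tr X)\<^sup>2"]) (simp add: lap_def)
next
  case (Suc m)
  have "\<exists>q. (\<forall>w. 0 \<le> q w) \<and> (\<forall>s. pweight s m (cmp m a X) = (\<Sum>w\<le>m. q w * s^w)) \<and>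
    tr (cmp m a X * lap m (cmp m a X)) = (\<Sum>w\<le>m. q w * real w)" for a
    by (rule Suc.IH) (use Suc.prems in \<open>auto intro: lev_cmp_last cmp_star\<close>)
  then obtain q where q: "\<And>a w. 0 \<le> q a w" "\<And>a s. pweight s m (cmp m a X) = (\<Sum>w\<le>m. q a w * s^w)"
    "\<And>a. tr (cmp m a X * lap m (cmp m a X)) = (\<Sum>w\<le>m. q a w * real w)"
    by metis
  define p where "p w = q 1 w + q 2 w + q 3 w" for w :: nat
  \<comment> \<open>A nonidentity factor on the new qubit raises the weight by one, so these
    contributions move from w to w + 1.\<close>
  define q' where "q' w = (if w \<le> m then q 0 w else 0) + (case w of 0 \<Rightarrow> 0 | Suc v \<Rightarrow> p v)" for w
  have nonneg: "0 \<le> q' w" for w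
    using q(1) by (auto simp: q'_def p_def split: nat.split)
  have sum_q': "(\<Sum>w\<le>Suc m. q' w * f w) = (\<Sum>w\<le>m. q 0 w * f w) + (\<Sum>w\<le>m. p w * f (Suc w))" for f :: "nat \<Rightarrow> real"
  proof -
    have "(\<Sum>w\<le>Suc m. q' w * f w) = (\<Sum>w\<le>Suc m. (if w \<le> m then q 0 w else 0) * f w)
        + (\<Sum>w\<le>Suc m. (case w of 0 \<Rightarrow> 0 | Suc v \<Rightarrow> p v) * f w)"
      by (simp add: q'_def algebra_simps sum.distrib)
    moreover have "(\<Sum>w\<le>Suc m. (case w of 0 \<Rightarrow> 0 | Suc v \<Rightarrow> p v) * f w) = (\<Sum>w\<le>m. p w * f (Suc w))"
      by (subst sum.atMost_Suc_shift) simp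
    ultimately show ?thesis by simp
  qed
  have pw: "pweight s (Suc m) X = (\<Sum>w\<le>Suc m. q' w * s^w)" for s
    unfolding sum_q' by (simp add: q(2) p_def sum.distrib algebra_simps sum_distrib_left)
  have "tr (cmp m a X * cmp m a X) = (\<Sum>w\<le>m. q a w)" for a
    using q(2)[of 1 a] pweight_1[of m "cmp m a X"] Suc.prems by (simp add: lev_cmp_last cmp_star)
  then have "tr (X * lap (Suc m) X) = (\<Sum>w\<le>Suc m. q' w * real w)"
    unfolding sum_q' tr_lap_Suc by (simp add: q(3) sum_upto_4 p_def sum.distrib algebra_simps)
  with nonneg pw show ?case by blast
qed

text \<open>A substitute for the logarithmic Sobolev inequality. The weight generating function
  \<open>\<Sum>w. q w * s^w\<close> of \<open>P\<close> at \<open>s = 2/7\<close> is small because noise maps the 2-norm to the 4-norm, and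
  by convexity in the exponent this forces the mean weight to be large.\<close>

theorem tr_lap_lower_bound:
  assumes Z: "lev n Z" "star Z = Z" and c: "(7/2) powr c * tr (Z * Z) \<le> sqrt (tr (Z * Z * (Z * Z)))"
  shows "c * tr (Z * Z * (Z * Z)) \<le> tr (Z * Z * lap n (Z * Z))"
proof -
  define P where "P = Z * Z"
  define M where "M = tr (P * P)"
  \<comment> \<open>With this value 7/2 * \<rho>^2 = 1, so noise turns \<open>pweight (7/2)\<close>
    into \<open>pweight 1\<close>.\<close>
  define \<rho> :: real where "\<rho> = sqrt (2/7)"
  have P: "lev n P" "star P = P" using Z by (simp_all add: P_def lev_mult star_mult)
  have trP: "0 \<le> tr P" using tr_square_nonneg[of Z] Z by (simp add: P_def)
  have M0: "0 \<le> M" using tr_square_nonneg[of P] P by (simp add: M_def)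
  define W where "W = deps n \<rho> P"
  define Y where "Y = deps n \<rho> W"
  have W: "lev n W" "star W = W" using P by (simp_all add: W_def lev_deps deps_star)
  have Y: "lev n Y" "star Y = Y" using W by (simp_all add: Y_def lev_deps deps_star)
  define b where "b = tr (W * W)"
  have b: "b = pweight (2/7) n P"
    using pweight_1[OF W] by (simp add: b_def W_def pweight_deps \<rho>_def)
  have b0: "0 \<le> b" unfolding b by (rule pweight_nonneg) simp
  have "pweight (7/2) n Y = b"
    using pweight_1[OF W] by (simp add: b_def Y_def pweight_deps \<rho>_def)
  then have Y4: "tr (Y * Y * (Y * Y)) \<le> b\<^sup>2"
    using four_norm_le_pweight[OF Y] by (simp add: power4_eq_xxxx mult.assoc)
  \<comment> \<open>This is b = tr (P Y) with P = Z * Z. Cauchy-Schwarz, with one factor Z on each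
    side, bounds b^2 by tr P * tr (P Y^2); a second use and the fourth moment of Y bound tr (P Y^2)
    by sqrt M * b. Dividing by b leaves b \<le> tr P * sqrt M.\<close>
  have "b = tr (Z * star (Y * Z))"
    unfolding b_def by (subst (2) W_def) (simp add: tr_deps_mult Y_def[symmetric] star_mult Y Z P_def,
      metis tr_commute mult.assoc)
  then have "b\<^sup>2 \<le> tr P * tr (Y * Z * star (Y * Z))"
    using tr_Cauchy_Schwarz[of Z "Y * Z"] by (simp add: Z P_def)
  also have "tr (Y * Z * star (Y * Z)) = tr (P * star (Y * Y))"
    using tr_commute[of Y "Z * Z * Y"] by (simp add: star_mult Y Z P_def mult.assoc)
  finally have b2: "b\<^sup>2 \<le> tr P * tr (P * star (Y * Y))" .
  have "(tr (P * star (Y * Y)))\<^sup>2 \<le> M * b\<^sup>2"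
    using tr_Cauchy_Schwarz[of P "Y * Y"] mult_left_mono[OF Y4 M0]
    by (simp add: P star_mult Y M_def)
  then have "tr (P * star (Y * Y)) \<le> sqrt M * b"
    using b0 M0 by (metis real_le_rsqrt real_sqrt_mult real_sqrt_abs abs_of_nonneg)
  then have "b * b \<le> (tr P * sqrt M) * b"
    using b2 mult_left_mono[OF _ trP] by (fastforce simp: power2_eq_square mult.assoc)
  then have "b \<le> tr P * sqrt M"
    using b0 trP M0 by (cases "b = 0") auto
  also have "\<dots> \<le> ((7/2) powr (-c) * sqrt M) * sqrt M"
  proof (rule mult_right_mono)
    have "(7/2) powr (-c) * ((7/2) powr c * tr P) \<le> (7/2) powr (-c) * sqrt M"
      using c by (intro mult_left_mono) (simp_all add: P_def M_def)
    then show "tr P \<le> (7/2) powr (-c) * sqrt M"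
      by (simp add: powr_minus field_simps)
  qed (use M0 in simp)
  finally have bM: "b \<le> (7/2) powr (-c) * M" using M0 by (simp add: mult.assoc)
  obtain q where q: "\<And>w. 0 \<le> q w" "\<And>s. pweight s n P = (\<Sum>w\<le>n. q w * s^w)"
    "tr (P * lap n P) = (\<Sum>w\<le>n. q w * real w)"
    using pweight_expansion[OF P] by blast
  have qM: "M = (\<Sum>w\<le>n. q w)" using pweight_1[OF P] q(2)[of 1] by (simp add: M_def)
  define l :: real where "l = ln (7/2)"
  have l: "0 < l" by (simp add: l_def)
  \<comment> \<open>The right side is convex in w and lies above its tangent at w = c.\<close>
  have tangent: "(7/2) powr (-c) * (1 - (real w - c) * l) \<le> (2/7)^w" for w
  proof -
    have "(2/7::real)^w = (7/2) powr (- real w)"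
      by (simp add: powr_minus powr_realpow power_divide)
    also have "\<dots> = (7/2) powr (-c) * exp (- ((real w - c) * l))"
      by (simp add: powr_def l_def algebra_simps flip: exp_add)
    finally show ?thesis
      using exp_ge_add_one_self[of "- ((real w - c) * l)"] by simp
  qed
  have "(7/2) powr (-c) * (M - (tr (P * lap n P) - c * M) * l)
      = (\<Sum>w\<le>n. q w * ((7/2) powr (-c) * (1 - (real w - c) * l)))"
    unfolding qM q(3) by (simp add: algebra_simps sum.distrib sum_subtractf sum_distrib_left sum_distrib_right)
  also have "\<dots> \<le> b"
    unfolding b q(2) using tangent q(1) by (intro sum_mono mult_left_mono) auto
  also note bM
  finally have "(tr (P * lap n P) - c * M) * l \<ge> 0" by simp
  then have "c * M \<le> tr (P * lap n P)" using l by (simp add: zero_le_mult_iff)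
  then show ?thesis by (simp add: P_def M_def)
qed

section \<open>The Dirichlet form of powers\<close>

lemma Bernstein_integral:
  "((\<lambda>t::real. real (m choose i) * t^i * (1 - t)^(m - i)) has_integral (1 / real (Suc m))) {0..1}"
  if "i \<le> m"
proof -
  have "((\<lambda>t. t powr (real (Suc i) - 1) * (1 - t) powr (real (Suc (m - i)) - 1))
      has_integral Beta (real (Suc i)) (real (Suc (m - i)))) {0..1}"
    by (rule has_integral_Beta_real) auto
  \<comment> \<open>At an endpoint \<open>0 powr 0\<close> is 0 while \<open>0 ^ 0\<close> is 1, so
    the two kinds of powers are exchanged on the open interval.\<close>
  then have "((\<lambda>t. t powr (real (Suc i) - 1) * (1 - t) powr (real (Suc (m - i)) - 1))
      has_integral Beta (real (Suc i)) (real (Suc (m - i)))) {0<..<1}"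
    by (simp only: has_integral_Icc_iff_Ioo)
  then have "((\<lambda>t. t^i * (1 - t)^(m - i)) has_integral Beta (real (Suc i)) (real (Suc (m - i)))) {0<..<1}"
    by (rule has_integral_eq[rotated]) (simp add: powr_realpow)
  then have "((\<lambda>t. t^i * (1 - t)^(m - i)) has_integral Beta (real (Suc i)) (real (Suc (m - i)))) {0..1}"
    by (simp only: has_integral_Icc_iff_Ioo)
  then have "((\<lambda>t. real (m choose i) * (t^i * (1 - t)^(m - i))) has_integral
      real (m choose i) * Beta (real (Suc i)) (real (Suc (m - i)))) {0..1}"
    by (rule has_integral_mult_right)
  moreover have "real (m choose i) * Beta (real (Suc i)) (real (Suc (m - i))) = 1 / real (Suc m)"
  proof -
    have g: "Gamma (real (Suc k)) = fact k" for k
      using Gamma_fact[of k, where 'a = real] by (simp add: add.commute)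
    have "real (Suc i) + real (Suc (m - i)) = real (Suc (Suc m))"
      using that by simp
    then have "Beta (real (Suc i)) (real (Suc (m - i))) = fact i * fact (m - i) / fact (Suc m)"
      unfolding Beta_def by (simp only: g)
    moreover have "real (m choose i) = fact m / (fact i * fact (m - i))"
      using that by (rule binomial_fact)
    moreover have "(fact (Suc m) :: real) = real (Suc m) * fact m"
      by (rule fact_Suc)
    ultimately show ?thesis by (simp del: of_nat_Suc fact_Suc)
  qed
  ultimately show ?thesis by (simp add: mult.assoc)
qed

lemma sum_square_reindex:
  fixes f :: "nat \<Rightarrow> nat \<Rightarrow> real"
  shows "(\<Sum>i\<le>m. \<Sum>j\<le>m. f i j) = (\<Sum>s\<le>2*m. \<Sum>i | i \<le> m \<and> i \<le> s \<and> s - i \<le> m. f i (s - i))"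
proof -
  have "(\<Sum>i\<le>m. \<Sum>j\<le>m. f i j) = (\<Sum>(i,j)\<in>{..m}\<times>{..m}. f i j)"
    by (simp add: sum.cartesian_product)
  also have "\<dots> = (\<Sum>(s,i)\<in>(SIGMA s:{..2*m}. {i. i \<le> m \<and> i \<le> s \<and> s - i \<le> m}). f i (s - i))"
    by (rule sum.reindex_bij_witness[where i = "\<lambda>(s,i). (i, s - i)" and j = "\<lambda>(i,j). (i + j, i)"]) auto
  also have "\<dots> = (\<Sum>s\<le>2*m. \<Sum>i | i \<le> m \<and> i \<le> s \<and> s - i \<le> m. f i (s - i))"
    by (subst sum.Sigma) auto
  finally show ?thesis .
qed

text \<open>Collecting by s = i + j, Vandermonde's identity merges the products of two Bernstein
  polynomials of degree m into the one of degree 2m with index s.\<close>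

lemma sum_Bernstein_square:
  fixes w :: "nat \<Rightarrow> real" and t :: real
  shows "(\<Sum>i\<le>m. \<Sum>j\<le>m. (real (m choose i) * t^i * (1 - t)^(m - i)) *
     (real (m choose j) * t^j * (1 - t)^(m - j)) * w (i + j))
   = (\<Sum>s\<le>2*m. w s * (real (2*m choose s) * t^s * (1 - t)^(2*m - s)))"
proof -
  have "(\<Sum>i | i \<le> m \<and> i \<le> s \<and> s - i \<le> m. (real (m choose i) * t^i * (1 - t)^(m - i)) *
     (real (m choose (s - i)) * t^(s - i) * (1 - t)^(m - (s - i))) * w (i + (s - i)))
    = w s * (real (2*m choose s) * t^s * (1 - t)^(2*m - s))" if "s \<le> 2*m" for s
  proof -
    have "(\<Sum>i | i \<le> m \<and> i \<le> s \<and> s - i \<le> m. (real (m choose i) * t^i * (1 - t)^(m - i)) *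
     (real (m choose (s - i)) * t^(s - i) * (1 - t)^(m - (s - i))) * w (i + (s - i)))
      = (\<Sum>i | i \<le> m \<and> i \<le> s \<and> s - i \<le> m. w s * t^s * (1 - t)^(2*m - s) * real ((m choose i) * (m choose (s - i))))"
    proof (rule sum.cong[OF refl], clarify)
      fix i assume i: "i \<le> m" "i \<le> s" "s - i \<le> m"
      have "t^i * t^(s - i) = t^s" "(1 - t)^(m - i) * (1 - t)^(m - (s - i)) = (1 - t)^(2*m - s)"
        using i by (simp_all add: mult_2 flip: power_add)
      moreover have "i + (s - i) = s" using i by simp
      ultimately show "(real (m choose i) * t^i * (1 - t)^(m - i)) *
        (real (m choose (s - i)) * t^(s - i) * (1 - t)^(m - (s - i))) * w (i + (s - i))
        = w s * t^s * (1 - t)^(2*m - s) * real ((m choose i) * (m choose (s - i)))"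
        by (simp only: of_nat_mult) (simp flip: \<open>t^i * t^(s - i) = t^s\<close> \<open>(1 - t)^(m - i) * (1 - t)^(m - (s - i)) = (1 - t)^(2*m - s)\<close>)
    qed
    also have "\<dots> = w s * t^s * (1 - t)^(2*m - s) *
        real (\<Sum>i | i \<le> m \<and> i \<le> s \<and> s - i \<le> m. (m choose i) * (m choose (s - i)))"
      by (simp only: of_nat_sum sum_distrib_left)
    also have "(\<Sum>i | i \<le> m \<and> i \<le> s \<and> s - i \<le> m. (m choose i) * (m choose (s - i)))
      = (\<Sum>i\<le>s. (m choose i) * (m choose (s - i)))"
      by (rule sum.mono_neutral_left) (auto simp: binomial_eq_0)
    also have "\<dots> = 2*m choose s"
      using vandermonde[of m m s] by (simp add: mult_2)
    finally show ?thesis by simp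
  qed
  then show ?thesis
    unfolding sum_square_reindex by (intro sum.cong refl) auto
qed

text \<open>Applied to \<open>A\<^sup>i D B\<^sup>j\<close>, this is the integral form of the Cauchy-Schwarz inequality
  \<open>(a\<^sup>h - b\<^sup>h)\<^sup>2 \<le> h\<^sup>2 / (2h - 1) (a - b) (a\<^sup>2\<^sup>h\<^sup>-\<^sup>1 - b\<^sup>2\<^sup>h\<^sup>-\<^sup>1)\<close>; the integral over the segment from \<open>b\<close> to \<open>a\<close>
  becomes an integral of Bernstein polynomials, which makes sense for noncommuting arguments.\<close>

lemma Hankel_sum_ineq:
  fixes w :: "nat \<Rightarrow> real"
  assumes pos: "\<And>c :: nat \<Rightarrow> real. 0 \<le> (\<Sum>i\<le>m. \<Sum>j\<le>m. c i * c j * w (i + j))"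
  shows "(\<Sum>i\<le>m. \<Sum>j\<le>m. w (i + j)) / (real (Suc m))\<^sup>2 \<le> (\<Sum>s\<le>2*m. w s) / real (Suc (2*m))"
proof -
  define u where "u = 1 / real (Suc m)"
  define b where "b M i t = real (M choose i) * t^i * (1 - t)^(M - i)" for M i and t :: real
  define T where "T = (\<Sum>i\<le>m. \<Sum>j\<le>m. w (i + j))"
  \<comment> \<open>The positive form at the coefficients \<open>b m i t - u\<close>. Since u is the
    mean of every \<open>b m i\<close> over the unit interval, this centering makes the integral of
    f the difference of the two sides.\<close>
  define f where "f t = (\<Sum>s\<le>2*m. w s * b (2*m) s t) - u * (\<Sum>i\<le>m. \<Sum>j\<le>m. (b m i t + b m j t) * w (i + j)) + u\<^sup>2 * T" for t
  have bint: "(b M i has_integral (1 / real (Suc M))) {0..1}" if "i \<le> M" for M i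
    using Bernstein_integral[OF that] unfolding b_def by simp
  have f: "f t = (\<Sum>i\<le>m. \<Sum>j\<le>m. (b m i t - u) * (b m j t - u) * w (i + j))" for t
  proof -
    have "(\<Sum>i\<le>m. \<Sum>j\<le>m. (b m i t - u) * (b m j t - u) * w (i + j)) =
      (\<Sum>i\<le>m. \<Sum>j\<le>m. b m i t * b m j t * w (i + j))
      - u * (\<Sum>i\<le>m. \<Sum>j\<le>m. (b m i t + b m j t) * w (i + j)) + u\<^sup>2 * T"
      by (simp add: T_def sum_distrib_left algebra_simps sum.distrib sum_subtractf power2_eq_square)
    then show ?thesis
      unfolding f_def using sum_Bernstein_square[of m t w] by (simp add: b_def)
  qed
  have "(f has_integral ((\<Sum>s\<le>2*m. w s * (1 / real (Suc (2*m))))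
     - u * (\<Sum>i\<le>m. \<Sum>j\<le>m. (1 / real (Suc m) + 1 / real (Suc m)) * w (i + j)) + u\<^sup>2 * T)) {0..1}"
    unfolding f_def
    by (intro has_integral_add has_integral_diff has_integral_sum has_integral_mult_right
        has_integral_mult_left bint has_integral_const_real[of "u\<^sup>2 * T" 0 1, simplified]) auto
  then have "0 \<le> (\<Sum>s\<le>2*m. w s * (1 / real (Suc (2*m))))
     - u * (\<Sum>i\<le>m. \<Sum>j\<le>m. (1 / real (Suc m) + 1 / real (Suc m)) * w (i + j)) + u\<^sup>2 * T"
    by (rule has_integral_nonneg) (unfold f, rule pos)
  also have "(\<Sum>s\<le>2*m. w s * (1 / real (Suc (2*m)))) = (\<Sum>s\<le>2*m. w s) / real (Suc (2*m))"
    by (simp add: sum_divide_distrib)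
  also have "(\<Sum>i\<le>m. \<Sum>j\<le>m. (1 / real (Suc m) + 1 / real (Suc m)) * w (i + j)) = (u + u) * T"
    by (simp only: T_def u_def sum_distrib_left)
  finally have "u\<^sup>2 * T \<le> (\<Sum>s\<le>2*m. w s) / real (Suc (2*m))"
    by (simp add: power2_eq_square algebra_simps)
  then show ?thesis by (simp add: u_def T_def power_divide)
qed

section \<open>Trace inequalities for differences of powers\<close>

lemma power_diff_telescope:
  fixes A B :: "'a::ring_1"
  shows "A ^ Suc k - B ^ Suc k = (\<Sum>i\<le>k. A^i * (A - B) * B^(k - i))"
proof (induction k)
  case (Suc k)
  have "A ^ Suc (Suc k) - B ^ Suc (Suc k) = A ^ Suc k * (A - B) + (A ^ Suc k - B ^ Suc k) * B"
    by (simp add: algebra_simps power_commutes)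
  also have "(A ^ Suc k - B ^ Suc k) * B = (\<Sum>i\<le>k. A^i * (A - B) * B^(Suc k - i))"
    unfolding Suc sum_distrib_right
    by (rule sum.cong) (simp_all add: Suc_diff_le power_commutes mult.assoc)
  finally show ?case by simp
qed simp

text \<open>Telescoping writes the difference of powers as a sum of terms A^i D B^(m-i). By
  cyclicity the trace pairing of two such terms depends only on i + j, so their Gram matrix is a
  Hankel matrix.\<close>

lemma tr_power_diff_ineq:
  assumes A: "star A = A" and B: "star B = B"
  shows "tr ((A^Suc m - B^Suc m) * (A^Suc m - B^Suc m)) / (real (Suc m))\<^sup>2
    \<le> tr ((A^Suc (2*m) - B^Suc (2*m)) * (A - B)) / real (Suc (2*m))"
proof -
  define D where "D = A - B"
  have D: "star D = D" by (simp add: D_def star_diff A B)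
  define w where "w s = tr (A^s * D * B^(2*m - s) * D)" for s
  have square: "tr (M c * star (M c)) = (\<Sum>i\<le>m. \<Sum>j\<le>m. c i * c j * w (i + j))"
    if M_def: "\<And>c. M c = (\<Sum>i\<le>m. c i *\<^sub>R (A^i * D * B^(m - i)))" for M and c :: "nat \<Rightarrow> real"
  proof -
    have "tr (A^i * D * B^(m - i) * (B^(m - j) * D * A^j)) = w (i + j)" if "i \<le> m" "j \<le> m" for i j
    proof -
      have "B^(m - i) * B^(m - j) = B^(2*m - (i + j))"
        using that by (simp flip: power_add) (rule arg_cong[of _ _ "\<lambda>k. B^k"], simp)
      then have "A^i * D * B^(m - i) * (B^(m - j) * D * A^j) = A^i * D * B^(2*m - (i + j)) * D * A^j"
        by (metis mult.assoc)
      moreover have "tr (A^i * D * B^(2*m - (i + j)) * D * A^j) = tr (A^j * (A^i * D * B^(2*m - (i + j)) * D))"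
        by (rule tr_commute)
      moreover have "A^j * A^i = A^(i + j)" by (simp add: add.commute flip: power_add)
      ultimately show ?thesis by (simp add: w_def mult.assoc[symmetric])
    qed
    then have w: "tr (A^i * D * B^(m - i) * star (A^j * D * B^(m - j))) = w (i + j)" if "i \<le> m" "j \<le> m" for i j
      using that by (simp add: star_mult star_power A B D mult.assoc)
    have "tr (M c * star (M c)) = (\<Sum>i\<le>m. \<Sum>j\<le>m. c i * c j * tr (A^i * D * B^(m - i) * star (A^j * D * B^(m - j))))"
      by (simp only: M_def star_sum star_scaleR sum_product tr_sum mult_scaleR_left mult_scaleR_right tr_scaleR)
        (simp only: mult.assoc, simp only: mult.left_commute)
    also have "\<dots> = (\<Sum>i\<le>m. \<Sum>j\<le>m. c i * c j * w (i + j))"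
      by (intro sum.cong refl) (simp only: w atMost_iff)
    finally show ?thesis .
  qed
  define M where "M c = (\<Sum>i\<le>m. c i *\<^sub>R (A^i * D * B^(m - i)))" for c :: "nat \<Rightarrow> real"
  have pos: "0 \<le> (\<Sum>i\<le>m. \<Sum>j\<le>m. c i * c j * w (i + j))" for c
    using square[of M c] tr_square_nonneg[of "M c"] by (simp add: M_def)
  have M1: "M (\<lambda>_. 1) = A^Suc m - B^Suc m"
    unfolding power_diff_telescope by (simp add: M_def D_def)
  then have "star (M (\<lambda>_. 1)) = M (\<lambda>_. 1)"
    by (simp add: star_diff star_power A B del: power_Suc)
  then have T: "tr ((A^Suc m - B^Suc m) * (A^Suc m - B^Suc m)) = (\<Sum>i\<le>m. \<Sum>j\<le>m. w (i + j))"
    using square[of M "\<lambda>_. 1"] by (simp add: M_def[symmetric] M1[symmetric] del: power_Suc)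
  have S: "tr ((A^Suc (2*m) - B^Suc (2*m)) * (A - B)) = (\<Sum>s\<le>2*m. w s)"
    unfolding power_diff_telescope by (simp add: w_def D_def sum_distrib_right tr_sum)
  show ?thesis using Hankel_sum_ineq[OF pos] unfolding T S .
qed

lemma conj_power: "\<sigma> * \<sigma> = 1 \<Longrightarrow> (\<sigma> * X * \<sigma>)^k = \<sigma> * X^k * (\<sigma>::uhf)"
proof (induction k)
  case (Suc k)
  have "\<sigma> * X * \<sigma> * (\<sigma> * X^k * \<sigma>) = \<sigma> * X * (\<sigma> * \<sigma>) * X^k * \<sigma>"
    by (simp only: mult.assoc)
  with Suc show ?case by (simp add: mult.assoc)
qed simp

lemma cexp_diff_eq: "X - cexp i X = (1/4) *\<^sub>R (\<Sum>a<4. X - pauli i a * X * pauli i a)"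
proof -
  have "X - cexp i X = (1/4) *\<^sub>R (\<Sum>a<(4::nat). X) - (1/4) *\<^sub>R (\<Sum>a<4. pauli i a * X * pauli i a)"
    by (simp add: cexp_def sum_constant_scaleR del: sum_constant)
  then show ?thesis by (simp add: sum_subtractf scaleR_diff_right)
qed

text \<open>An inequality of Stroock-Varopoulos type. The generator averages differences X -
  \<sigma> X \<sigma> over Pauli operators \<sigma>, and conjugation by \<sigma> commutes with
  powers, so \<open>tr_power_diff_ineq\<close> applies with B = \<sigma> X \<sigma>.\<close>

theorem tr_power_lap_ineq:
  assumes X: "star X = X"
  shows "real (Suc (2*m)) / (real (Suc m))\<^sup>2 * tr (X^Suc m * lap n (X^Suc m))
    \<le> tr (X^Suc (2*m) * lap n X)"
proof -
  define c where "c = real (Suc (2*m)) / (real (Suc m))\<^sup>2"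
  have pauli: "c * tr (X^Suc m * (X^Suc m - \<sigma> * X^Suc m * \<sigma>)) \<le> tr (X^Suc (2*m) * (X - \<sigma> * X * \<sigma>))"
    if \<sigma>: "\<sigma> * \<sigma> = 1" "star \<sigma> = \<sigma>" for \<sigma>
  proof -
    define B where "B = \<sigma> * X * \<sigma>"
    have B: "star B = B" by (simp add: B_def star_mult \<sigma> X mult.assoc)
    have Bk: "\<sigma> * X^k * \<sigma> = B^k" for k
      unfolding B_def by (rule conj_power[OF \<sigma>(1), symmetric])
    \<comment> \<open>Conjugation by \<sigma> preserves the trace and exchanges X with B, so the
      symmetric form is twice the one-sided one.\<close>
    have half: "tr ((X^k - B^k) * (X^l - B^l)) = 2 * tr (X^k * (X^l - B^l))" for k l
    proof -
      have "tr (B^k * B^l) = tr (X^k * X^l)"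
      proof -
        have "B^k * B^l = \<sigma> * X^(k + l) * \<sigma>" by (metis Bk power_add)
        also have "tr \<dots> = tr (X^(k + l))"
          using tr_commute[of "\<sigma> * X^(k + l)" \<sigma>] by (simp add: mult.assoc[symmetric] \<sigma>)
        finally show ?thesis by (simp only: power_add)
      qed
      moreover have "tr (B^k * X^l) = tr (X^k * B^l)"
        using tr_commute[of \<sigma> "X^k * \<sigma> * X^l"] by (simp add: Bk[symmetric] mult.assoc)
      ultimately show ?thesis by (simp add: algebra_simps)
    qed
    have "tr ((X^Suc m - B^Suc m) * (X^Suc m - B^Suc m)) / (real (Suc m))\<^sup>2
       \<le> tr ((X^Suc (2*m) - B^Suc (2*m)) * (X^1 - B^1)) / real (Suc (2*m))"
      using tr_power_diff_ineq[OF X B] by (simp del: power_Suc)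
    then have "2 * tr (X^Suc m * (X^Suc m - B^Suc m)) / (real (Suc m))\<^sup>2
       \<le> 2 * tr (X^Suc (2*m) * (X - B)) / real (Suc (2*m))"
      unfolding half by (simp del: power_Suc of_nat_Suc)
    moreover have "2 * p / (real (Suc m))\<^sup>2 \<le> 2 * q / real (Suc (2*m)) \<Longrightarrow> c * p \<le> q" for p q
      by (simp add: c_def field_simps del: of_nat_Suc)
    ultimately show ?thesis
      unfolding Bk B_def[symmetric] by blast
  qed
  have "c * tr (X^Suc m * (X^Suc m - cexp i (X^Suc m))) \<le> tr (X^Suc (2*m) * (X - cexp i X))" for i
  proof -
    have "c * tr (X^Suc m * (X^Suc m - cexp i (X^Suc m)))
      = 1/4 * (\<Sum>a<4. c * tr (X^Suc m * (X^Suc m - pauli i a * X^Suc m * pauli i a)))"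
      unfolding cexp_diff_eq by (simp add: sum_distrib_left tr_sum mult.left_commute del: power_Suc)
    also have "\<dots> \<le> 1/4 * (\<Sum>a<4. tr (X^Suc (2*m) * (X - pauli i a * X * pauli i a)))"
      by (intro mult_left_mono sum_mono pauli) (simp_all add: pauli_square star_pauli)
    also have "\<dots> = tr (X^Suc (2*m) * (X - cexp i X))"
      unfolding cexp_diff_eq by (simp add: sum_distrib_left tr_sum del: power_Suc)
    finally show ?thesis .
  qed
  then show ?thesis
    unfolding lap_def sum_distrib_left tr_sum c_def[symmetric] by (rule sum_mono)
qed

section \<open>Contraction of the power norms under noise\<close>

text \<open>Entries suffice: at a fixed level every ring operation is a finite polynomial in the
  entries.\<close>

definition has_uderiv :: "(real \<Rightarrow> uhf) \<Rightarrow> uhf \<Rightarrow> real \<Rightarrow> bool" where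
  "has_uderiv f F r \<longleftrightarrow> (\<forall>k l. ((\<lambda>r. ent (f r) k l) has_vector_derivative ent F k l) (at r))"

section \<open>Differentiation in the noise parameter\<close>

lemma has_uderiv_const: "has_uderiv (\<lambda>_. X) 0 r"
  by (simp add: has_uderiv_def)

lemma has_uderiv_add: "has_uderiv f F r \<Longrightarrow> has_uderiv g G r \<Longrightarrow> has_uderiv (\<lambda>r. f r + g r) (F + G) r"
  by (auto simp: has_uderiv_def intro!: derivative_intros)

lemma has_uderiv_diff: "has_uderiv f F r \<Longrightarrow> has_uderiv g G r \<Longrightarrow> has_uderiv (\<lambda>r. f r - g r) (F - G) r"
  by (auto simp: has_uderiv_def intro!: derivative_intros)

lemma has_uderiv_scaleR_const: "has_uderiv f F r \<Longrightarrow> has_uderiv (\<lambda>r. c *\<^sub>R f r) (c *\<^sub>R F) r"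
  unfolding has_uderiv_def ent_scaleR by (auto intro!: has_vector_derivative_mult_right)

lemma has_uderiv_scaleR_id: "has_uderiv f F r \<Longrightarrow> has_uderiv (\<lambda>r. r *\<^sub>R f r) (f r + r *\<^sub>R F) r"
proof -
  assume f: "has_uderiv f F r"
  have "((\<lambda>r. complex_of_real r * ent (f r) k l) has_vector_derivative
      complex_of_real r * ent F k l + 1 * ent (f r) k l) (at r)" for k l
    using f unfolding has_uderiv_def
    by (intro has_vector_derivative_mult) (auto intro!: derivative_eq_intros has_vector_derivative_of_real)
  then show ?thesis
    by (simp add: has_uderiv_def add.commute)
qed

lemma has_uderiv_mult:
  assumes "\<And>r. lev n (f r)" "\<And>r. lev n (g r)" "lev n F" "lev n G" "has_uderiv f F r" "has_uderiv g G r"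
  shows "has_uderiv (\<lambda>r. f r * g r) (F * g r + f r * G) r"
  unfolding has_uderiv_def
proof (intro allI)
  fix k l
  show "((\<lambda>r. ent (f r * g r) k l) has_vector_derivative ent (F * g r + f r * G) k l) (at r)"
  proof (cases "k div 2^n = l div 2^n")
    case True
    have "((\<lambda>r. \<Sum>j<2^n. ent (f r) (k mod 2^n) j * ent (g r) j (l mod 2^n)) has_vector_derivative
      (\<Sum>j<2^n. ent (f r) (k mod 2^n) j * ent G j (l mod 2^n) + ent F (k mod 2^n) j * ent (g r) j (l mod 2^n))) (at r)"
      using assms(5,6) unfolding has_uderiv_def
      by (intro has_vector_derivative_sum has_vector_derivative_mult) auto
    then show ?thesis
      using True by (simp add: ent_mult_lev[of n] assms sum.distrib add.commute)
  qed (simp add: ent_mult_lev[of n] assms)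
qed

lemma has_uderiv_cexp:
  assumes "\<And>r. lev n (f r)" "lev n F" "i < n" "has_uderiv f F r"
  shows "has_uderiv (\<lambda>r. cexp i (f r)) (cexp i F) r"
proof -
  have *: "has_uderiv (\<lambda>r. p * f r * p) (p * F * p) r" if "lev n p" for p
    using has_uderiv_mult[of n "\<lambda>r. p * f r" "\<lambda>_. p" "p * F" 0 r]
      has_uderiv_mult[of n "\<lambda>_. p" f 0 F r]
    by (simp add: assms that lev_mult lev_0 has_uderiv_const)
  show ?thesis
    unfolding cexp_def sum_upto_4
    by (intro has_uderiv_scaleR_const has_uderiv_add * lev_pauli assms)
qed

lemma has_uderiv_tr:
  assumes "\<And>r. lev n (f r)" "lev n F" "has_uderiv f F r"
  shows "((\<lambda>r. tr (f r)) has_real_derivative tr F) (at r)"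
proof -
  have "((\<lambda>r. \<Sum>k<2^n. ent (f r) k k) has_vector_derivative (\<Sum>k<2^n. ent F k k)) (at r)"
    using assms(3) unfolding has_uderiv_def by (intro has_vector_derivative_sum) auto
  then have "((\<lambda>r. Re (\<Sum>k<2^n. ent (f r) k k)) has_vector_derivative Re (\<Sum>k<2^n. ent F k k)) (at r)"
    by (rule bounded_linear.has_vector_derivative[OF bounded_linear_Re])
  then have "((\<lambda>r. Re (\<Sum>k<2^n. ent (f r) k k)) has_real_derivative Re (\<Sum>k<2^n. ent F k k)) (at r)"
    by (simp only: has_real_derivative_iff_has_vector_derivative)
  then show ?thesis
    unfolding tr_eq[OF assms(1)] tr_eq[OF assms(2)] by (rule DERIV_cdivide)
qed

text \<open>The derivative of a power is a sum of mixed products of f and F; traced against a power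
  of f they all coincide by cyclicity. The extra exponent j lets the induction step absorb one more
  factor f.\<close>

lemma has_uderiv_power:
  assumes "\<And>r. lev n (f r)" "lev n F" "has_uderiv f F r"
  shows "\<exists>P. lev n P \<and> has_uderiv (\<lambda>r. f r ^ k) P r \<and> (\<forall>j. tr (f r ^ j * P) = real k * tr (f r ^ (j + k - 1) * F))"
proof (induction k)
  case 0
  show ?case by (rule exI[of _ 0]) (simp add: lev_0 has_uderiv_const)
next
  case (Suc k)
  then obtain P where P: "lev n P" "has_uderiv (\<lambda>r. f r ^ k) P r"
    "\<And>j. tr (f r ^ j * P) = real k * tr (f r ^ (j + k - 1) * F)" by blast
  have "tr (f r ^ j * (F * f r ^ k + f r * P)) = real (Suc k) * tr (f r ^ (j + Suc k - 1) * F)" for j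
  proof -
    have "tr (f r ^ j * (F * f r ^ k)) = tr (f r ^ (j + k) * F)"
      using tr_commute[of "f r ^ j * F" "f r ^ k"] by (simp add: mult.assoc power_add add.commute[of j])
    moreover have "tr (f r ^ j * (f r * P)) = tr (f r ^ Suc j * P)"
      by (simp add: power_commutes flip: mult.assoc)
    ultimately show ?thesis by (simp add: P(3) algebra_simps del: power_Suc)
  qed
  then show ?case
    using has_uderiv_mult[OF assms(1) _ assms(2) P(1) assms(3) P(2)] P(1) assms
    by (intro exI[of _ "F * f r ^ k + f r * P"]) (simp add: lev_intros)
qed

lemma lap_dep: "lap m (dep i r X) = dep i r (lap m X)"
  by (induction m) (simp_all add: lap_def dep_add dep_diff cexp_dep dep_scaleR[of i r 0 0, simplified])

text \<open>A string of weight w carries the factor r^w, so the Euler operator r d/dr multiplies it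
  by w and thus acts as \<open>lap\<close>.\<close>

lemma has_uderiv_deps:
  assumes "lev n X"
  shows "m \<le> n \<Longrightarrow> \<exists>G. lev n G \<and> has_uderiv (\<lambda>r. deps m r X) G r \<and> r *\<^sub>R G = lap m (deps m r X)"
proof (induction m)
  case 0
  show ?case by (rule exI[of _ 0]) (simp add: lev_0 has_uderiv_const lap_def)
next
  case (Suc m)
  then obtain G where G: "lev n G" "has_uderiv (\<lambda>r. deps m r X) G r" "r *\<^sub>R G = lap m (deps m r X)"
    by auto
  define Y where "Y r = deps m r X" for r
  have Y: "lev n (Y r)" for r unfolding Y_def using Suc.prems assms by (simp add: lev_deps)
  have YG: "has_uderiv Y G r" using G(2) by (simp add: Y_def[abs_def])
  have c: "has_uderiv (\<lambda>r. cexp m (Y r)) (cexp m G) r"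
    using has_uderiv_cexp[of n Y G m r] Y G(1) YG Suc.prems by simp
  define G' where "G' = cexp m G + ((Y r - cexp m (Y r)) + r *\<^sub>R (G - cexp m G))"
  have "has_uderiv (\<lambda>r. deps (Suc m) r X) G' r"
    unfolding deps.simps dep_def G'_def Y_def[symmetric]
    by (intro has_uderiv_add has_uderiv_scaleR_id has_uderiv_diff c YG)
  moreover have "lev n G'"
    unfolding G'_def using Y G(1) Suc.prems by (intro lev_intros lev_cexp) auto
  moreover have "r *\<^sub>R G' = lap (Suc m) (deps (Suc m) r X)"
  proof -
    have "r *\<^sub>R G' = cexp m (r *\<^sub>R G) + (r *\<^sub>R (Y r - cexp m (Y r)) + r *\<^sub>R (r *\<^sub>R G - cexp m (r *\<^sub>R G)))"
      by (simp add: G'_def cexp_scaleR algebra_simps)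
    also have "\<dots> = dep m r (lap m (Y r)) + r *\<^sub>R (Y r - cexp m (Y r))"
      by (simp add: G Y_def[symmetric] dep_def)
    also have "r *\<^sub>R (Y r - cexp m (Y r)) = dep m r (Y r) - cexp m (dep m r (Y r))"
      by (simp add: dep_def cexp_add cexp_diff cexp_scaleR cexp_idem)
    also have "dep m r (lap m (Y r)) + \<dots> = lap (Suc m) (dep m r (Y r))"
      by (simp only: lap_dep[symmetric]) (simp add: lap_def)
    finally show ?thesis by (simp add: Y_def)
  qed
  ultimately show ?case by blast
qed

lemma has_real_derivative_tr_power_deps:
  assumes "lev n X"
  shows "\<exists>d. ((\<lambda>r. tr (deps n r X ^ Suc k)) has_real_derivative d) (at r) \<and>
    r * d = real (Suc k) * tr (deps n r X ^ k * lap n (deps n r X))"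
proof -
  obtain G where G: "lev n G" "has_uderiv (\<lambda>r. deps n r X) G r" "r *\<^sub>R G = lap n (deps n r X)"
    using has_uderiv_deps[OF assms, of n r] by auto
  have Y: "lev n (deps n r X)" for r using assms by (simp add: lev_deps)
  obtain P where P: "lev n P" "has_uderiv (\<lambda>r. deps n r X ^ Suc k) P r"
    "\<And>j. tr (deps n r X ^ j * P) = real (Suc k) * tr (deps n r X ^ (j + Suc k - 1) * G)"
    using has_uderiv_power[OF Y G(1,2)] by blast
  have "((\<lambda>r. tr (deps n r X ^ Suc k)) has_real_derivative tr P) (at r)"
    using P Y by (intro has_uderiv_tr[of n]) (auto intro: lev_power simp del: power_Suc)
  moreover have "r * tr P = real (Suc k) * tr (deps n r X ^ k * lap n (deps n r X))"
    using P(3)[of 0] by (simp add: G(3)[symmetric])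
  ultimately show ?thesis by blast
qed

text \<open>At the first point c with y c \<le> C, y is at least C on all of [a, c], hence
  nondecreasing there, and y a \<le> y c. The known bound sits at the right end because the noise
  grows as its parameter falls from 1.\<close>

lemma barrier:
  fixes y :: "real \<Rightarrow> real"
  assumes "a \<le> b" "y b \<le> C"
    and der: "\<And>t. a \<le> t \<Longrightarrow> t \<le> b \<Longrightarrow> \<exists>d. (y has_real_derivative d) (at t) \<and> (C \<le> y t \<longrightarrow> 0 \<le> d)"
  shows "y a \<le> C"
proof (rule ccontr)
  assume "\<not> y a \<le> C"
  have cont: "continuous_on {a..b} y"
    using der by (intro continuous_at_imp_continuous_on ballI) (auto dest: DERIV_isCont)
  define S where "S = {a..b} \<inter> y -` {..C}"
  have "closed S" unfolding S_def using cont by (intro continuous_closed_preimage) auto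
  then have "compact S" unfolding S_def by (metis closed_Int_compact compact_Icc inf.commute S_def Int_left_absorb inf.idem Int_assoc)
  moreover have "S \<noteq> {}" using assms by (auto simp: S_def)
  ultimately obtain c where c: "c \<in> S" "\<And>t. t \<in> S \<Longrightarrow> c \<le> t"
    using compact_attains_inf[of S] by blast
  have ac: "a < c" using c(1) \<open>\<not> y a \<le> C\<close> by (cases "a = c") (auto simp: S_def)
  have cb: "c \<le> b" and yc: "y c \<le> C" using c(1) by (auto simp: S_def)
  have above: "C < y t" if "a \<le> t" "t < c" for t
    using c(2)[of t] that cb by (force simp: S_def)
  have "C \<le> y c"
  proof (rule ccontr)
    assume "\<not> C \<le> y c"
    moreover have "continuous_on {a..c} y" by (rule continuous_on_subset[OF cont]) (use cb in auto)
    ultimately obtain t where "a \<le> t" "t \<le> c" "y t = C"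
      using IVT2'[of y c C a] above[of a] ac by auto
    then show False using above[of t] \<open>\<not> C \<le> y c\<close> by (cases "t = c") auto
  qed
  then have ge: "C \<le> y t" if "a \<le> t" "t \<le> c" for t
    using above[of t] that by (cases "t = c") auto
  have "y a \<le> y c"
  proof (rule DERIV_nonneg_imp_nondecreasing[where f = y])
    fix t assume "a \<le> t" "t \<le> c"
    with der[of t] ge[of t] cb show "\<exists>d. (y has_real_derivative d) (at t) \<and> 0 \<le> d"
      by auto
  qed (use ac in simp)
  with yc \<open>\<not> y a \<le> C\<close> show False by simp
qed

text \<open>Dividing the moment by t^(k+1) turns the wanted decay into boundedness by C. By the
  quotient rule, the condition on the Dirichlet form is then the sign condition of
  \<open>barrier\<close>, imposed only where the moment still exceeds its target.\<close>

lemma tr_power_deps_le: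
  assumes X: "lev n X" "tr (X ^ Suc k) \<le> C"
    and r: "0 < r" "r \<le> 1"
    and gap: "\<And>t. 0 < t \<Longrightarrow> t \<le> 1 \<Longrightarrow> C * t ^ Suc k \<le> tr (deps n t X ^ Suc k) \<Longrightarrow>
      tr (deps n t X ^ Suc k) \<le> tr (deps n t X ^ k * lap n (deps n t X))"
  shows "tr (deps n r X ^ Suc k) \<le> C * r ^ Suc k"
proof -
  define y where "y t = tr (deps n t X ^ Suc k) / t ^ Suc k" for t
  have d1: "deps n 1 X = X" for n
    by (induction n) (simp_all add: dep_def)
  have "y r \<le> C"
  proof (rule barrier[of r 1])
    show "y 1 \<le> C" using X(2) by (simp add: y_def d1 del: power_Suc)
  next
    fix t assume t: "r \<le> t" "t \<le> 1"
    with r have t0: "0 < t" by simp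
    obtain d where d: "((\<lambda>r. tr (deps n r X ^ Suc k)) has_real_derivative d) (at t)"
      "t * d = real (Suc k) * tr (deps n t X ^ k * lap n (deps n t X))"
      using has_real_derivative_tr_power_deps[OF X(1)] by blast
    define m where "m = tr (deps n t X ^ Suc k)"
    have "(y has_real_derivative (d * t ^ Suc k - m * (real (Suc k) * t ^ k)) / (t ^ Suc k * t ^ Suc k)) (at t)"
      unfolding y_def[abs_def] m_def using t0
      by (intro DERIV_divide[OF d(1)]) (auto intro!: derivative_eq_intros simp del: power_Suc simp: power_Suc[symmetric])
    moreover have "0 \<le> (d * t ^ Suc k - m * (real (Suc k) * t ^ k)) / (t ^ Suc k * t ^ Suc k)" if "C \<le> y t"
    proof -
      have "C * t ^ Suc k \<le> m"
        using that t0 by (simp add: y_def m_def pos_le_divide_eq del: power_Suc)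
      then have "m \<le> tr (deps n t X ^ k * lap n (deps n t X))"
        unfolding m_def by (rule gap[OF t0 t(2)])
      then have "real (Suc k) * m \<le> t * d"
        unfolding d(2) by (rule mult_left_mono) simp
      then have "real (Suc k) * m * t ^ k \<le> t * d * t ^ k"
        using t0 by (intro mult_right_mono) auto
      then show ?thesis by (intro divide_nonneg_nonneg) (use t0 in \<open>simp_all add: algebra_simps\<close>)
    qed
    ultimately show "\<exists>d. (y has_real_derivative d) (at t) \<and> (C \<le> y t \<longrightarrow> 0 \<le> d)" by blast
  qed (use r in simp)
  then show ?thesis using r by (simp add: y_def pos_divide_le_eq del: power_Suc)
qed

text \<open>The constant relating the \<open>k\<close>-norm to the 2-norm. The formula is a convenient choice subject
  to \<open>nfac 2 = 1\<close>, \<open>2 * nfac k \<le> \<surd>2 * k\<close> and the growth that \<open>tame_deps\<close> requires.\<close>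

definition nfac :: "nat \<Rightarrow> real" where
  "nfac k = (7 * real k - 4) / 10"

text \<open>The exponent is the reciprocal of the factor in \<open>tr_power_lap_ineq\<close> for h =
  m + 1.\<close>

lemma nfac_growth:
  assumes "h = 2 ^ Suc j"
  shows "(7/2) powr ((real h)\<^sup>2 / (2 * real h - 1)) * nfac h ^ h \<le> nfac (2 * h) ^ h"
proof -
  define \<rho> where "\<rho> = nfac (2 * h) / nfac h"
  have h2: "2 \<le> h" using assms one_le_power[of "2::nat" j] by simp
  have pos: "0 < nfac h" "0 < nfac (2 * h)" using h2 by (simp_all add: nfac_def)
  have \<rho>: "0 < \<rho>" using pos by (simp add: \<rho>_def)
  \<comment> \<open>The claim without the real exponent. For h \<ge> 8 the ratio \<rho> \<ge> 2 is
    enough. For h = 2 and h = 4 a ratio of 2 would fail; there the offset 4 in \<open>nfac\<close>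
    raises \<rho> to 12/5 and 13/6.\<close>
  have "(7/2) ^ h \<le> \<rho> ^ (2 * h - 1)"
  proof -
    consider "j = 0" | "j = 1" | "2 \<le> j" by linarith
    then show ?thesis
    proof cases
      case 1
      then show ?thesis by (simp add: \<rho>_def nfac_def assms eval_nat_numeral)
    next
      case 2
      then show ?thesis by (simp add: \<rho>_def nfac_def assms power_divide)
    next
      case 3
      then have "2 ^ 3 \<le> (2::nat) ^ Suc j" by (intro power_increasing) auto
      then have h8: "8 \<le> h" by (simp add: assms)
      have "2 \<le> (8/7 :: real) ^ 8" by (simp add: power_divide)
      also have "\<dots> \<le> (8/7) ^ h" using h8 by (intro power_increasing) auto
      finally have "2 * (7/2 :: real) ^ h \<le> (8/7) ^ h * (7/2) ^ h"
        by (intro mult_right_mono) auto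
      also have "\<dots> = 2 ^ (2 * h)" by (simp flip: power_mult_distrib add: power_mult)
      also have "\<dots> = 2 * 2 ^ (2 * h - 1)" using h2 by (simp flip: power_Suc)
      finally have "(7/2 :: real) ^ h \<le> 2 ^ (2 * h - 1)" by simp
      also have "\<dots> \<le> \<rho> ^ (2 * h - 1)"
        using pos by (intro power_mono) (simp_all add: \<rho>_def nfac_def field_simps)
      finally show ?thesis .
    qed
  qed
  then have "ln ((7/2) ^ h) \<le> ln (\<rho> ^ (2 * h - 1))"
    using \<rho> by (subst ln_le_cancel_iff) auto
  then have "real h * ln (7/2) \<le> (2 * real h - 1) * ln \<rho>"
    using \<rho> h2 by (simp add: ln_realpow of_nat_diff)
  then have "real h * (real h * ln (7/2)) \<le> real h * ((2 * real h - 1) * ln \<rho>)"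
    by (intro mult_left_mono) auto
  then have "(real h)\<^sup>2 / (2 * real h - 1) * ln (7/2) \<le> real h * ln \<rho>"
    using h2 by (simp add: field_simps power2_eq_square)
  then have "(7/2) powr ((real h)\<^sup>2 / (2 * real h - 1)) \<le> exp (real h * ln \<rho>)"
    by (simp add: powr_def)
  also have "\<dots> = \<rho> ^ h" using \<rho> by (simp add: exp_of_nat_mult)
  finally have "(7/2) powr ((real h)\<^sup>2 / (2 * real h - 1)) * nfac h ^ h \<le> \<rho> ^ h * nfac h ^ h"
    using pos by (intro mult_right_mono) auto
  also have "\<dots> = nfac (2 * h) ^ h"
    using pos by (simp add: \<rho>_def flip: power_mult_distrib)
  finally show ?thesis .
qed

section \<open>Contraction of all moments by one noise layer\<close>

lemma pweight_0: "pweight 0 m X = (tr X)\<^sup>2"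
  by (induction m arbitrary: X) (simp_all add: cmp_0 tr_cexp)

text \<open>A traceless operator has no part of weight 0, and noise scales every other squared
  coefficient by at most r^2.\<close>

lemma tr_square_deps:
  assumes X: "lev n X" "star X = X" "tr X = 0" and r: "0 \<le> r" "r \<le> 1"
  shows "tr (deps n r X ^ 2) \<le> r\<^sup>2 * tr (X ^ 2)"
proof -
  obtain q where q: "\<And>w. 0 \<le> q w" "\<And>s. pweight s n X = (\<Sum>w\<le>n. q w * s^w)"
    using pweight_expansion[OF X(1,2)] by blast
  have "q 0 = (\<Sum>w\<le>n. q w * 0^w)"
    by (subst sum.remove[of _ 0]) auto
  then have q0: "q 0 = 0"
    using q(2)[of 0] X(3) by (simp add: pweight_0)
  have "tr (deps n r X ^ 2) = pweight 1 n (deps n r X)"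
    using X by (subst pweight_1) (simp_all add: lev_deps deps_star power2_eq_square)
  also have "\<dots> = (\<Sum>w\<le>n. q w * (r\<^sup>2)^w)"
    by (simp add: pweight_deps q)
  also have "\<dots> \<le> (\<Sum>w\<le>n. r\<^sup>2 * q w)"
  proof (rule sum_mono)
    fix w
    show "q w * (r\<^sup>2)^w \<le> r\<^sup>2 * q w"
    proof (cases w)
      case (Suc v)
      have "(r\<^sup>2)^v \<le> 1" using r by (intro power_le_one) (auto simp: power_le_one)
      then have "r\<^sup>2 * (r\<^sup>2)^v \<le> r\<^sup>2" using mult_left_mono[of "(r\<^sup>2)^v" 1 "r\<^sup>2"] by simp
      then show ?thesis using q(1)[of w] Suc by (simp add: mult.commute mult_left_mono)
    qed (simp add: q0)
  qed
  also have "\<dots> = r\<^sup>2 * pweight 1 n X" by (simp add: q sum_distrib_left)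
  also have "pweight 1 n X = tr (X ^ 2)" using X by (simp add: pweight_1 power2_eq_square)
  finally show ?thesis .
qed

text \<open>The scale s is what a noise layer reduces, while unitary layers keep it. The exponents
  are powers of two because the estimate for exponent 2h rests on the one for h.\<close>

definition tame :: "nat \<Rightarrow> real \<Rightarrow> uhf \<Rightarrow> bool" where
  "tame n s X \<longleftrightarrow> lev n X \<and> star X = X \<and> tr X = 0 \<and>
     (\<forall>j. tr (X ^ (2 ^ Suc j)) \<le> (nfac (2 ^ Suc j) * s) ^ (2 ^ Suc j))"

text \<open>Induction on the exponent. Where the 2h-th moment of the noisy operator reaches its
  target while the h-th obeys its own, \<open>nfac_growth\<close> supplies the hypothesis of
  \<open>tr_lap_lower_bound\<close>. The constant c = h^2/(2h-1) obtained there cancels against the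
  factor of \<open>tr_power_lap_ineq\<close>, which leaves decay at rate at least one.\<close>

theorem tame_deps:
  assumes "tame n s X" and s: "0 < s" and r: "0 \<le> r" "r \<le> 1"
  shows "tame n (s * r) (deps n r X)"
proof -
  have X: "lev n X" "star X = X" "tr X = 0"
    and bound: "\<And>j. tr (X ^ (2 ^ Suc j)) \<le> (nfac (2 ^ Suc j) * s) ^ (2 ^ Suc j)"
    using assms(1) unfolding tame_def by blast+
  have Y: "lev n (deps n t X)" "star (deps n t X) = deps n t X" for t
    using X by (simp_all add: lev_deps deps_star)
  have pos: "tr (deps n t X ^ (2 ^ Suc j)) \<le> (nfac (2 ^ Suc j) * s * t) ^ (2 ^ Suc j)"
    if "0 < t" "t \<le> 1" for t j
    using that
  proof (induction j arbitrary: t)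
    case 0
    then have "tr (deps n t X ^ 2) \<le> t\<^sup>2 * tr (X ^ 2)"
      using X by (intro tr_square_deps) auto
    also have "\<dots> \<le> t\<^sup>2 * s\<^sup>2"
      using bound[of 0] by (intro mult_left_mono) (auto simp: nfac_def)
    finally show ?case by (simp add: nfac_def power_mult_distrib mult.commute)
  next
    case (Suc j)
    \<comment> \<open>The splitting h = g + g exhibits Z^h as the square of the self-adjoint Z^g,
      the form that \<open>tr_lap_lower_bound\<close> takes.\<close>
    define g h :: nat where "g = 2 ^ j" and "h = 2 ^ Suc j"
    have gh: "h = g + g" "2 ^ Suc (Suc j) = 2 * h" "1 \<le> g" by (simp_all add: g_def h_def)
    define k where "k = 2 * h - 1"
    have k: "2 * h = Suc k" using gh by (simp add: k_def)
    define C where "C = (nfac (2 * h) * s) ^ (2 * h)"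
    have nf: "0 < nfac h" "0 < nfac (2 * h)" using gh(1,3) by (simp_all add: nfac_def)
    have "tr (deps n t X ^ Suc k) \<le> C * t ^ Suc k"
    proof (rule tr_power_deps_le[OF X(1) _ Suc.prems])
      show "tr (X ^ Suc k) \<le> C"
        using bound[of "Suc j"] unfolding gh(2) k[symmetric] C_def by simp
    next
      fix u :: real assume u: "0 < u" "u \<le> 1" and ge: "C * u ^ Suc k \<le> tr (deps n u X ^ Suc k)"
      define Z where "Z = deps n u X"
      have Z: "lev n Z" "star Z = Z" using Y by (simp_all add: Z_def)
      define c where "c = (real h)\<^sup>2 / (2 * real h - 1)"
      have Zh: "Z^g * Z^g = Z^h" "Z^h * Z^h = Z ^ Suc k"
        by (simp_all add: gh(1) k[symmetric] mult_2 flip: power_add)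
      have hk: "Suc (h - 1) = h" "Suc (2 * (h - 1)) = k"
        using gh(1,3) by (simp_all add: k_def)
      have ub: "0 < nfac (2 * h) * s * u" "0 < nfac h * s * u" using nf s u by simp_all
      have "(7/2) powr c * tr (Z^h) \<le> (7/2) powr c * (nfac h * s * u) ^ h"
        using Suc.IH[OF u] by (intro mult_left_mono) (auto simp: Z_def h_def)
      also have "\<dots> = ((7/2) powr c * nfac h ^ h) * (s * u) ^ h"
        by (simp add: power_mult_distrib mult.assoc)
      also have "\<dots> \<le> nfac (2 * h) ^ h * (s * u) ^ h"
        using nfac_growth[OF h_def] s u unfolding c_def by (intro mult_right_mono) auto
      also have "\<dots> = (nfac (2 * h) * s * u) ^ h"
        by (simp only: power_mult_distrib mult.assoc)
      also have "\<dots> = sqrt (((nfac (2 * h) * s * u) ^ h)\<^sup>2)"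
        using ub by (simp del: power_mult_distrib add: real_sqrt_abs)
      also have "((nfac (2 * h) * s * u) ^ h)\<^sup>2 = C * u ^ Suc k"
        by (simp only: C_def k[symmetric] power_mult[symmetric] power_mult_distrib mult.commute[of h])
      also have "sqrt \<dots> \<le> sqrt (tr (Z^h * Z^h))"
        using ge unfolding Zh unfolding Z_def by (rule real_sqrt_le_mono)
      finally have "c * tr (Z^h * Z^h) \<le> tr (Z^h * lap n (Z^h))"
        using tr_lap_lower_bound[of n "Z^g" c] Z by (simp only: Zh lev_power star_power)
      moreover have "real k / (real h)\<^sup>2 * tr (Z^h * lap n (Z^h)) \<le> tr (Z^k * lap n Z)"
        using tr_power_lap_ineq[OF Z(2), of "h - 1" n] by (simp only: hk)
      moreover have "real k / (real h)\<^sup>2 * c = 1"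
      proof -
        have "real k = 2 * real h - 1" "1 < 2 * real h" using gh(1,3) by (simp_all add: k_def of_nat_diff)
        then show ?thesis by (simp add: c_def)
      qed
      moreover have "x \<le> z" if "c * x \<le> y" "b * y \<le> z" "b * c = 1" "0 \<le> b" for x y z b :: real
        using mult_left_mono[OF that(1,4)] that(2,3) by (simp flip: mult.assoc)
      ultimately have "tr (Z^h * Z^h) \<le> tr (Z^k * lap n Z)"
        by (smt (verit) divide_nonneg_nonneg of_nat_0_le_iff zero_le_power2)
      then show "tr (deps n u X ^ Suc k) \<le> tr (deps n u X ^ k * lap n (deps n u X))"
        unfolding Zh unfolding Z_def .
    qed
    then show ?case
      unfolding gh(2) by (simp only: C_def k[symmetric] power_mult_distrib)
  qed
  have "tr (deps n r X ^ (2 ^ Suc j)) \<le> (nfac (2 ^ Suc j) * (s * r)) ^ (2 ^ Suc j)" for j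
  \<comment> \<open>The differential argument lives on positive parameters; at r = 0 the noise sends
    X to tr X times the identity, which is 0.\<close>
  proof (cases "r = 0")
    case True
    then show ?thesis using X by (simp add: deps_0_lev power_0_left)
  next
    case False
    then show ?thesis using pos[of r j] r by (simp add: mult.assoc)
  qed
  then show ?thesis using Y X by (simp add: tame_def tr_deps)
qed

section \<open>Noisy circuits\<close>

lift_definition emb :: "nat \<Rightarrow> complex mat \<Rightarrow> uhf" is
  "\<lambda>n M k l. if k div 2^n = l div 2^n then M $$ (k mod 2^n, l mod 2^n) else 0"
  subgoal for n M by (rule exI[of _ n]) (simp add: level_def)
  done

lemma lev_emb: "lev n (emb n M)"
  by (simp add: lev.rep_eq emb.rep_eq level_def)

lemma ent_emb: "k < 2^n \<Longrightarrow> l < 2^n \<Longrightarrow> ent (emb n M) k l = M $$ (k, l)"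
  by (simp add: ent.rep_eq emb.rep_eq)

lemma emb_mult:
  assumes "M \<in> carrier_mat (2^n) (2^n)" "N \<in> carrier_mat (2^n) (2^n)"
  shows "emb n (M * N) = emb n M * emb n N"
proof (rule lev_eqI)
  fix k l :: nat assume kl: "k < 2^n" "l < 2^n"
  have "(M * N) $$ (k, l) = (\<Sum>j<2^n. M $$ (k, j) * N $$ (j, l))"
    using assms kl by (simp add: scalar_prod_def atLeast0LessThan)
  then show "ent (emb n (M * N)) k l = ent (emb n M * emb n N) k l"
    using kl by (simp add: ent_mult[of n] lev_emb ent_emb)
qed (simp_all add: lev_emb lev_mult)

lemma adj_carrier_mat: "M \<in> carrier_mat a b \<Longrightarrow> adj M \<in> carrier_mat b a"
  by (auto simp: adj_def)

lemma emb_adj: "M \<in> carrier_mat (2^n) (2^n) \<Longrightarrow> emb n (adj M) = star (emb n M)"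
  by (rule lev_eqI[of n]) (auto simp: lev_emb lev_star ent_emb adj_def)

lemma emb_one: "emb n (1\<^sub>m (2^n)) = 1"
  by (rule lev_eqI[of n]) (auto simp: lev_emb lev_1 ent_emb ent_1)

lemma tr_emb: "M \<in> carrier_mat (2^n) (2^n) \<Longrightarrow> 2^n * tr (emb n M) = Re (mtrace M)"
  by (simp add: tr_eq[OF lev_emb] ent_emb mtrace_def)

section \<open>Basis indices as bit strings\<close>

lemma qbit_eq: "qbit k i = of_bool (bit k i)"
  by (simp add: qbit_def bit_iff_odd mod2_eq_if)

lemma emb_Zop: "i < n \<Longrightarrow> emb n (Zop n i) = sz i"
  by (rule lev_eqI[of n]) (auto simp: lev_emb lev_sz ent_emb Zop_def ent_sz sgn_bit_def qbit_eq)

lemma set_qbit_0: "set_qbit k i 0 = unset_bit i k"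
proof -
  have "unset_bit i k + of_bool (bit k i) * 2^i = k"
  proof (cases "bit k i")
    case True
    have "set_bit i (unset_bit i k) = k"
      using True by (intro bit_eqI) (auto simp: bit_simps)
    moreover have "\<not> bit (unset_bit i k) i" by (simp add: bit_simps)
    ultimately show ?thesis
      using set_bit_eq[of i "unset_bit i k"] True by simp
  next
    case False
    then have "unset_bit i k = k" by (intro bit_eqI) (auto simp: bit_simps)
    with False show ?thesis by simp
  qed
  then show ?thesis by (simp add: set_qbit_def qbit_eq)
qed

lemma set_qbit_1: "set_qbit k i 1 = set_bit i k"
proof -
  have "set_qbit k i 1 = unset_bit i k + 2^i"
    using set_qbit_0[of k i] by (simp add: set_qbit_def)
  also have "\<dots> = set_bit i (unset_bit i k)"
    by (simp add: set_bit_eq bit_simps)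
  also have "\<dots> = set_bit i k"
    by (intro bit_eqI) (auto simp: bit_simps)
  finally show ?thesis .
qed

lemma bit_set_qbit: "b < 2 \<Longrightarrow> bit (set_qbit k i b) j = (if j = i then b = 1 else bit k j)"
  using set_qbit_0[of k i] set_qbit_1[of k i] less_2_cases[of b] by (auto simp: bit_simps)

lemma set_qbit_less: "b < 2 \<Longrightarrow> i < n \<Longrightarrow> k < 2^n \<Longrightarrow> set_qbit k i b < 2^n"
  unfolding less_two_pow_iff by (intro bit_eqI) (auto simp: bit_set_qbit bit_take_bit_iff intro: ccontr,
    metis bit_take_bit_iff)

lemma sum_less_2: "(\<Sum>b<2. f b) = f 0 + f (1::nat)" for f :: "nat \<Rightarrow> 'a::comm_monoid_add"
  by (simp add: eval_nat_numeral)

lemma ent_cexp: "ent (cexp i X) k l =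
  (if bit k i = bit l i then (ent X k l + ent X (flip_bit i k) (flip_bit i l)) / 2 else 0)"
proof -
  have "ent (sx i * sz i * X * (sz i * sx i)) k l
      = of_real (sgn_bit i (flip_bit i k) * sgn_bit i (flip_bit i l)) * ent X (flip_bit i k) (flip_bit i l)"
    by (simp add: ent_sx_mult ent_mult_sx ent_sz_mult ent_mult_sz flip: mult.assoc)
      (simp add: ent_sx_mult ent_mult_sx ent_sz_mult ent_mult_sz mult.assoc)
  then show ?thesis
    by (simp add: cexp_eq ent_sx_mult ent_mult_sx ent_sz_mult ent_mult_sz mult.assoc[of _ X]
        sgn_bit_def bit_flip_bit_iff)
qed

lemma emb_depol1:
  assumes "i < n" shows "emb n (depol1 n p i M) = dep i (1 - p) (emb n M)"
proof (rule lev_eqI)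
  fix k l :: nat assume kl: "k < 2^n" "l < 2^n"
  have s: "(\<Sum>b<2. M $$ (set_qbit k i b, set_qbit l i b)) = M $$ (k, l) + M $$ (flip_bit i k, flip_bit i l)"
    if "bit k i = bit l i"
  proof (cases "bit k i")
    case True
    then have "set_bit i k = k" "set_bit i l = l" "unset_bit i k = flip_bit i k" "unset_bit i l = flip_bit i l"
      using that by (auto intro!: bit_eqI simp: bit_simps)
    then show ?thesis by (simp add: sum_less_2 set_qbit_0 set_qbit_1[simplified] add.commute)
  next
    case False
    then have "unset_bit i k = k" "unset_bit i l = l" "set_bit i k = flip_bit i k" "set_bit i l = flip_bit i l"
      using that by (auto intro!: bit_eqI simp: bit_simps)
    then show ?thesis by (simp add: sum_less_2 set_qbit_0 set_qbit_1[simplified])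
  qed
  show "ent (emb n (depol1 n p i M)) k l = ent (dep i (1 - p) (emb n M)) k l"
    using kl assms s
    by (simp add: ent_emb depol1_def dep_def ent_cexp flip_bit_less qbit_eq)
      (simp add: field_simps)
qed (simp_all add: lev_emb lev_dep assms)

lemma depol_all_eq:
  assumes "M \<in> carrier_mat (2^n) (2^n)"
  shows "depol_all n p M \<in> carrier_mat (2^n) (2^n)" "emb n (depol_all n p M) = deps n (1 - p) (emb n M)"
proof -
  have "m \<le> n \<Longrightarrow> M \<in> carrier_mat (2^n) (2^n) \<Longrightarrow> foldr (depol1 n p) [0..<m] M \<in> carrier_mat (2^n) (2^n) \<and>
    emb n (foldr (depol1 n p) [0..<m] M) = deps m (1 - p) (emb n M)" for m M
  proof (induction m arbitrary: M)
    case (Suc m)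
    have c: "depol1 n p m M \<in> carrier_mat (2^n) (2^n)" by (simp add: depol1_def)
    show ?case
      using Suc.IH[OF _ c] Suc.prems by (simp add: emb_depol1 dep_deps)
  qed simp
  from this[of n M] assms
  show "depol_all n p M \<in> carrier_mat (2^n) (2^n)" "emb n (depol_all n p M) = deps n (1 - p) (emb n M)"
    unfolding depol_all_def by auto
qed

subsection \<open>Gates are unitary\<close>

text \<open>A gate changes the code \<open>c k < d\<close> of the qubits it acts on and preserves the rest \<open>e k\<close>.\<close>

lemma unitary_local_mat:
  fixes e c :: "nat \<Rightarrow> nat"
  assumes U: "unitary_mat d U"
    and inj: "\<And>k l. e k = e l \<Longrightarrow> c k = c l \<Longrightarrow> k = l"
    and c: "\<And>k. c k < d"
    and ex: "\<And>k b. k < N \<Longrightarrow> b < d \<Longrightarrow> \<exists>l<N. e l = e k \<and> c l = b"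
  shows "unitary_mat N (mat N N (\<lambda>(k, l). if e k = e l then U $$ (c k, c l) else 0))"
proof -
  define F where "F V = mat N N (\<lambda>(k, l). if e k = e l then V $$ (c k, c l) else 0)" for V :: "complex mat"
  have F: "F V \<in> carrier_mat N N" for V by (simp add: F_def)
  have Ud: "U \<in> carrier_mat d d" "adj U \<in> carrier_mat d d" "U * adj U = 1\<^sub>m d" "adj U * U = 1\<^sub>m d"
    using U by (auto simp: unitary_mat_def adj_def)
  have mult: "F V * F W = F (V * W)" if V: "V \<in> carrier_mat d d" "W \<in> carrier_mat d d" for V W
  proof (rule eq_matI)
    fix k m assume "k < dim_row (F (V * W))" "m < dim_col (F (V * W))"
    then have km: "k < N" "m < N" by (simp_all add: F_def)
    have "(F V * F W) $$ (k, m) = (\<Sum>l<N. (if e k = e l then V $$ (c k, c l) else 0) * (if e l = e m then W $$ (c l, c m) else 0))"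
      using km by (simp add: F_def scalar_prod_def atLeast0LessThan)
    also have "\<dots> = (\<Sum>l | l < N \<and> e l = e k. V $$ (c k, c l) * (if e k = e m then W $$ (c l, c m) else 0))"
      by (rule sum.mono_neutral_cong_right) auto
    also have "\<dots> = (\<Sum>b<d. V $$ (c k, b) * (if e k = e m then W $$ (b, c m) else 0))"
    proof (rule sum.reindex_bij_betw)
      show "bij_betw c {l. l < N \<and> e l = e k} {..<d}"
        unfolding bij_betw_def
      proof
        show "inj_on c {l. l < N \<and> e l = e k}" using inj by (auto simp: inj_on_def)
        show "c ` {l. l < N \<and> e l = e k} = {..<d}" using c ex[OF km(1)] by fastforce
      qed
    qed
    also have "\<dots> = F (V * W) $$ (k, m)"
      using km V c by (simp add: F_def scalar_prod_def atLeast0LessThan)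
    finally show "(F V * F W) $$ (k, m) = F (V * W) $$ (k, m)" .
  qed (simp_all add: F_def)
  have one: "F (1\<^sub>m d) = 1\<^sub>m N"
    using c inj by (intro eq_matI) (auto simp: F_def)
  have adj: "adj (F U) = F (adj U)"
    using Ud c by (intro eq_matI) (auto simp: F_def adj_def)
  have "unitary_mat N (F U)"
    unfolding unitary_mat_def adj using F mult one Ud by simp
  then show ?thesis by (simp add: F_def)
qed

lemma unitary_gate_mat:
  assumes "valid_gate n g" shows "unitary_mat (2^n) (gate_mat n g)"
proof (cases g)
  case (Gate1 q U)
  then have q: "q < n" "unitary_mat 2 U" using assms by (simp_all add: valid_gate_def)
  have "unitary_mat (2^n) (mat (2^n) (2^n) (\<lambda>(k, l).
         if set_qbit k q 0 = set_qbit l q 0 then U $$ (qbit k q, qbit l q) else 0))"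
  proof (rule unitary_local_mat[OF q(2)])
    fix k l assume *: "set_qbit k q 0 = set_qbit l q 0" "qbit k q = qbit l q"
    show "k = l"
    proof (rule bit_eqI)
      fix i show "bit k i = bit l i"
        using arg_cong[OF *(1), of "\<lambda>x. bit x i"] *(2)
        by (cases "i = q") (auto simp: bit_set_qbit qbit_eq of_bool_def split: if_splits)
    qed
  next
    fix k b :: nat assume kb: "k < 2^n" "b < 2"
    have "set_qbit (set_qbit k q b) q 0 = set_qbit k q 0"
      using kb by (intro bit_eqI) (simp add: bit_set_qbit)
    moreover have "qbit (set_qbit k q b) q = b"
      using kb by (auto simp: qbit_eq bit_set_qbit)
    ultimately show "\<exists>l<2^n. set_qbit l q 0 = set_qbit k q 0 \<and> qbit l q = b"
      using set_qbit_less[OF kb(2) q(1) kb(1)] by blast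
  qed (simp add: qbit_eq)
  then show ?thesis by (simp add: gate_mat_def Gate1)
next
  case (Gate2 q1 q2 U)
  then have q: "q1 < n" "q2 < n" "q1 \<noteq> q2" "unitary_mat 4 U"
    using assms by (simp_all add: valid_gate_def)
  have "unitary_mat (2^n) (mat (2^n) (2^n) (\<lambda>(k, l).
         if set_qbit (set_qbit k q1 0) q2 0 = set_qbit (set_qbit l q1 0) q2 0
         then U $$ (2 * qbit k q1 + qbit k q2, 2 * qbit l q1 + qbit l q2) else 0))"
  proof (rule unitary_local_mat[OF q(4)])
    fix k l assume *: "set_qbit (set_qbit k q1 0) q2 0 = set_qbit (set_qbit l q1 0) q2 0"
      "2 * qbit k q1 + qbit k q2 = 2 * qbit l q1 + qbit l q2"
    have "bit k q1 = bit l q1" "bit k q2 = bit l q2"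
      using *(2) by (auto simp: qbit_eq of_bool_def split: if_splits)
    then show "k = l"
    proof (intro bit_eqI)
      fix i assume "bit k q1 = bit l q1" "bit k q2 = bit l q2"
      then show "bit k i = bit l i"
        using arg_cong[OF *(1), of "\<lambda>x. bit x i"]
        by (cases "i = q1"; cases "i = q2") (auto simp: bit_set_qbit)
    qed
  next
    fix k b :: nat assume kb: "k < 2^n" "b < 4"
    define l where "l = set_qbit (set_qbit k q1 (b div 2)) q2 (b mod 2)"
    have b: "b div 2 < 2" "b mod 2 < 2" using kb by auto
    have "l < 2^n" unfolding l_def using kb q b by (intro set_qbit_less)
    moreover have "set_qbit (set_qbit l q1 0) q2 0 = set_qbit (set_qbit k q1 0) q2 0"
      unfolding l_def using b by (intro bit_eqI) (simp add: bit_set_qbit)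
    moreover have "2 * qbit l q1 + qbit l q2 = b"
    proof -
      have "qbit l q1 = b div 2" "qbit l q2 = b mod 2"
        using b q by (auto simp: l_def qbit_eq bit_set_qbit of_bool_def)
      then show ?thesis by simp
    qed
    ultimately show "\<exists>l<2^n. set_qbit (set_qbit l q1 0) q2 0 = set_qbit (set_qbit k q1 0) q2 0 \<and>
        2 * qbit l q1 + qbit l q2 = b" by blast
  qed (simp add: qbit_eq)
  then show ?thesis by (simp add: gate_mat_def Gate2)
qed

lemma layer_mat_unitary:
  assumes "valid_layer n L"
  shows "layer_mat n L \<in> carrier_mat (2^n) (2^n) \<and>
    emb n (layer_mat n L) * star (emb n (layer_mat n L)) = 1 \<and>
    star (emb n (layer_mat n L)) * emb n (layer_mat n L) = 1"
proof -
  have "\<forall>g\<in>set L. valid_gate n g" using assms by (simp add: valid_layer_def)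
  then show ?thesis
  proof (induction L)
    case Nil
    then show ?case by (simp add: layer_mat_def emb_one star_1)
  next
    case (Cons g L)
    let ?G = "gate_mat n g" and ?M = "layer_mat n L"
    have M: "?M \<in> carrier_mat (2^n) (2^n)" "emb n ?M * star (emb n ?M) = 1" "star (emb n ?M) * emb n ?M = 1"
      using Cons by simp_all
    have G: "?G \<in> carrier_mat (2^n) (2^n)" "?G * adj ?G = 1\<^sub>m (2^n)" "adj ?G * ?G = 1\<^sub>m (2^n)"
      using unitary_gate_mat[of n g] Cons.prems by (simp_all add: unitary_mat_def)
    note aG = adj_carrier_mat[OF G(1)]
    have G': "emb n ?G * star (emb n ?G) = 1" "star (emb n ?G) * emb n ?G = 1"
      by (simp_all only: G emb_one flip: emb_mult[OF G(1) aG] emb_mult[OF aG G(1)] emb_adj[OF G(1)])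
    have lm: "layer_mat n (g # L) = ?G * ?M" by (simp add: layer_mat_def)
    have "emb n ?G * emb n ?M * star (emb n ?G * emb n ?M)
        = emb n ?G * (emb n ?M * star (emb n ?M)) * star (emb n ?G)"
      by (simp add: star_mult mult.assoc)
    moreover have "star (emb n ?G * emb n ?M) * (emb n ?G * emb n ?M)
        = star (emb n ?M) * (star (emb n ?G) * emb n ?G) * emb n ?M"
      by (simp add: star_mult mult.assoc)
    ultimately show ?case
      unfolding lm emb_mult[OF G(1) M(1)] using mult_carrier_mat[OF G(1) M(1)] M(2,3) G' by simp
  qed
qed

subsection \<open>Evolution of states and observables\<close>

text \<open>Positivity is stated by duality with squares, a form that passes directly through
  conjugations and hence through the noise. Normalization is kept apart; \<open>2^n * tr\<close> is
  the real part of the ordinary trace.\<close>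

definition state :: "nat \<Rightarrow> uhf \<Rightarrow> bool" where
  "state n X \<longleftrightarrow> lev n X \<and> star X = X \<and> (\<forall>Y. lev n Y \<longrightarrow> 0 \<le> tr (X * (Y * star Y)))"

lemma state_conj:
  assumes "state n X" "lev n U" shows "state n (U * X * star U)"
proof -
  have eq: "tr (U * X * star U * (Y * star Y)) = tr (X * ((star U * Y) * star (star U * Y)))" for Y
    using tr_commute[of U "X * star U * (Y * star Y)"] by (simp add: star_mult star_star mult.assoc)
  have "0 \<le> tr (U * X * star U * (Y * star Y))" if "lev n Y" for Y
    unfolding eq using assms that lev_mult lev_star unfolding state_def by blast
  then show ?thesis
    using assms by (simp add: state_def lev_mult lev_star star_mult star_star mult.assoc)
qed

lemma state_dep:
  assumes "state n X" "i < n" "0 \<le> r" "r \<le> 1" shows "state n (dep i r X)"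
proof -
  have "0 \<le> tr (pauli i a * X * pauli i a * (Y * star Y))" if "lev n Y" for a Y
    using state_conj[OF assms(1) lev_pauli[OF assms(2), of a]] that by (simp add: state_def star_pauli)
  then have "0 \<le> tr (cexp i X * (Y * star Y))" if "lev n Y" for Y
    using that by (simp add: cexp_def sum_distrib_right tr_sum sum_nonneg)
  moreover have "tr (dep i r X * Z) = r * tr (X * Z) + (1 - r) * tr (cexp i X * Z)" for Z
    by (simp add: dep_def algebra_simps)
  ultimately show ?thesis
    using assms by (simp add: state_def lev_dep dep_star)
qed

lemma state_deps: "state n X \<Longrightarrow> m \<le> n \<Longrightarrow> 0 \<le> r \<Longrightarrow> r \<le> 1 \<Longrightarrow> state n (deps m r X)"
  by (induction m) (simp_all add: state_dep)

section \<open>The invariant under the two parts of a layer\<close>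

lemma tame_zero: "tame n 0 X \<Longrightarrow> X = 0"
proof -
  assume t: "tame n 0 X"
  then have "tr (X ^ (2 ^ Suc 0)) \<le> (nfac (2 ^ Suc 0) * 0) ^ (2 ^ Suc 0)"
    unfolding tame_def by blast
  then have "tr (X * star X) \<le> 0"
    using t by (simp add: tame_def power2_eq_square)
  then show ?thesis using tr_square_eq_0 tr_square_nonneg[of X] by simp
qed

lemma tame_deps': "tame n s X \<Longrightarrow> 0 \<le> s \<Longrightarrow> 0 \<le> r \<Longrightarrow> r \<le> 1 \<Longrightarrow> tame n (s * r) (deps n r X)"
proof (cases "s = 0")
  case True
  assume t: "tame n s X"
  have "deps m r 0 = 0" for m
    by (induction m) (simp_all add: dep_scaleR[of _ r 0 0, simplified])
  with t True tame_zero[of n X] show ?thesis by simp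
qed (simp add: tame_deps)

lemma tame_conj:
  assumes X: "tame n s X" and U: "lev n U" "U * star U = 1"
  shows "tame n s (star U * X * U)"
proof -
  have pow: "(star U * X * U) ^ k = star U * X ^ k * U" if "k > 0" for k
    using that
  proof (induction k rule: nat_induct_non_zero)
    case (Suc k)
    have "star U * X * U * (star U * X ^ k * U) = star U * X * (U * star U) * X ^ k * U"
      by (simp only: mult.assoc)
    with Suc show ?case by (simp add: U mult.assoc)
  qed simp
  have trc: "tr (star U * Y * U) = tr Y" for Y
    using tr_commute[of "star U * Y" U] by (simp add: U flip: mult.assoc)
  show ?thesis
    using X U by (simp add: tame_def lev_intros star_mult star_star pow trc mult.assoc)
      (simp flip: mult.assoc add: pow trc)
qed

text \<open>Induction from the first layer, for all input matrices: the tail of the circuit already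
  provides an observable, and the first layer pulls it back through its noise and then its unitary.
  Noise moves across the trace by symmetry, the unitary by cyclicity.\<close>

lemma noisy_circuit_Heisenberg:
  assumes "\<forall>L\<in>set C. valid_layer n L" "0 \<le> p" "p \<le> 1" "\<rho> \<in> carrier_mat (2^n) (2^n)"
  shows "noisy_circuit n p C \<rho> \<in> carrier_mat (2^n) (2^n)"
    and "state n (emb n \<rho>) \<Longrightarrow> state n (emb n (noisy_circuit n p C \<rho>))"
    and "tr (emb n (noisy_circuit n p C \<rho>)) = tr (emb n \<rho>)"
    and "0 \<le> s \<Longrightarrow> tame n s X \<Longrightarrow> \<exists>Y. tame n (s * (1 - p) ^ length C) Y \<and>
       tr (emb n (noisy_circuit n p C \<rho>) * X) = tr (emb n \<rho> * Y)"
proof -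
  have "noisy_circuit n p C \<rho> \<in> carrier_mat (2^n) (2^n) \<and>
    (state n (emb n \<rho>) \<longrightarrow> state n (emb n (noisy_circuit n p C \<rho>))) \<and>
    tr (emb n (noisy_circuit n p C \<rho>)) = tr (emb n \<rho>) \<and>
    (\<forall>X s. 0 \<le> s \<longrightarrow> tame n s X \<longrightarrow> (\<exists>Y. tame n (s * (1 - p) ^ length C) Y \<and>
       tr (emb n (noisy_circuit n p C \<rho>) * X) = tr (emb n \<rho> * Y)))"
    using assms(1,4)
  proof (induction C arbitrary: \<rho>)
    case Nil
    then show ?case by (auto simp: noisy_circuit_def)
  next
    case (Cons L C)
    define M where "M = layer_mat n L"
    define U where "U = emb n M"
    define \<sigma> where "\<sigma> = depol_all n p (M * \<rho> * adj M)"
    have M: "M \<in> carrier_mat (2^n) (2^n)" and U: "lev n U" "U * star U = 1" "star U * U = 1"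
      using layer_mat_unitary[of n L] Cons.prems by (simp_all add: M_def U_def lev_emb)
    note aM = adj_carrier_mat[OF M]
    have c: "M * \<rho> * adj M \<in> carrier_mat (2^n) (2^n)" using M aM Cons.prems by simp
    have \<sigma>: "\<sigma> \<in> carrier_mat (2^n) (2^n)" "emb n \<sigma> = deps n (1 - p) (U * emb n \<rho> * star U)"
      using depol_all_eq[OF c, of p] M aM Cons.prems
      by (simp_all add: \<sigma>_def emb_mult[OF _ aM] emb_mult[OF M] emb_adj[OF M] U_def mult.assoc)
    have step: "noisy_circuit n p (L # C) \<rho> = noisy_circuit n p C \<sigma>"
      by (simp add: noisy_circuit_def \<sigma>_def M_def)
    note IH = Cons.IH[OF _ \<sigma>(1)]
    have IH': "noisy_circuit n p C \<sigma> \<in> carrier_mat (2^n) (2^n)"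
      "state n (emb n \<sigma>) \<Longrightarrow> state n (emb n (noisy_circuit n p C \<sigma>))"
      "tr (emb n (noisy_circuit n p C \<sigma>)) = tr (emb n \<sigma>)"
      "\<And>X s. 0 \<le> s \<Longrightarrow> tame n s X \<Longrightarrow> (\<exists>Y. tame n (s * (1 - p) ^ length C) Y \<and>
       tr (emb n (noisy_circuit n p C \<sigma>) * X) = tr (emb n \<sigma> * Y))"
      using IH Cons.prems(1) by auto
    have st: "state n (emb n \<sigma>)" if "state n (emb n \<rho>)"
      unfolding \<sigma> using that U assms by (intro state_deps state_conj) auto
    have tr: "tr (emb n \<sigma>) = tr (emb n \<rho>)"
      unfolding \<sigma> tr_deps using tr_commute[of "U * emb n \<rho>" "star U"] U
      by (simp flip: mult.assoc)
    have "\<exists>Y. tame n (s * (1 - p) ^ length (L # C)) Y \<and>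
       tr (emb n (noisy_circuit n p (L # C) \<rho>) * X) = tr (emb n \<rho> * Y)" if X: "0 \<le> s" "tame n s X" for X s
    proof -
      obtain Y where Y: "tame n (s * (1 - p) ^ length C) Y"
        "tr (emb n (noisy_circuit n p C \<sigma>) * X) = tr (emb n \<sigma> * Y)"
        using IH'(4)[OF X] by blast
      define Z where "Z = star U * deps n (1 - p) Y * U"
      have "tame n (s * (1 - p) ^ length C * (1 - p)) (deps n (1 - p) Y)"
        using Y(1) X(1) assms(2,3) by (intro tame_deps') auto
      then have "tame n (s * (1 - p) ^ length C * (1 - p)) Z"
        unfolding Z_def using U by (intro tame_conj)
      moreover have "tr (emb n \<sigma> * Y) = tr (emb n \<rho> * Z)"
      proof -
        have "tr (emb n \<sigma> * Y) = tr (U * emb n \<rho> * star U * deps n (1 - p) Y)"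
          unfolding \<sigma> by (rule tr_deps_mult[symmetric])
        also have "\<dots> = tr (emb n \<rho> * Z)"
          using tr_commute[of U "emb n \<rho> * star U * deps n (1 - p) Y"] by (simp add: Z_def mult.assoc)
        finally show ?thesis .
      qed
      ultimately show ?thesis
        using Y(2) step by (intro exI[of _ Z]) (simp add: mult_ac)
    qed
    then show ?case unfolding step using IH' st tr by auto
  qed
  then show "noisy_circuit n p C \<rho> \<in> carrier_mat (2^n) (2^n)"
    "state n (emb n \<rho>) \<Longrightarrow> state n (emb n (noisy_circuit n p C \<rho>))"
    "tr (emb n (noisy_circuit n p C \<rho>)) = tr (emb n \<rho>)"
    "0 \<le> s \<Longrightarrow> tame n s X \<Longrightarrow> \<exists>Y. tame n (s * (1 - p) ^ length C) Y \<and>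
       tr (emb n (noisy_circuit n p C \<rho>) * X) = tr (emb n \<rho> * Y)"
    by blast+
qed

subsection \<open>Bounds on expectation values\<close>

text \<open>Principal minors of order two. The vector with entries t at k and cnj \<rho>_kl at l
  gives the quadratic A t^2 + 2 t m + B m, where m is the squared modulus of \<rho>_kl; its
  discriminant inequality, divided by m, is the second claim.\<close>

lemma density_matrix_entry_le:
  assumes \<rho>: "density_matrix n \<rho>" and kl: "k < 2^n" "l < 2^n"
  shows "0 \<le> Re (\<rho> $$ (k, k))" "(cmod (\<rho> $$ (k, l)))\<^sup>2 \<le> Re (\<rho> $$ (k, k)) * Re (\<rho> $$ (l, l))"
proof -
  have carrier: "\<rho> \<in> carrier_mat (2^n) (2^n)" and herm: "adj \<rho> = \<rho>"
    and pos: "\<And>v. v \<in> carrier_vec (2^n) \<Longrightarrow>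
      0 \<le> Re (\<Sum>k<2^n. cnj (Matrix.vec_index v k) * Matrix.vec_index (\<rho> *\<^sub>v v) k)"
    using \<rho> unfolding density_matrix_def by blast+
  have sym: "\<rho> $$ (j, i) = cnj (\<rho> $$ (i, j))" if "i < 2^n" "j < 2^n" for i j
    using arg_cong[OF herm, of "\<lambda>M. M $$ (j, i)"] carrier that by (simp add: adj_def)
  have form: "0 \<le> Re (cnj a * (\<rho> $$ (k, k) * a + \<rho> $$ (k, l) * b) + cnj b * (\<rho> $$ (l, k) * a + \<rho> $$ (l, l) * b))" for a b
  proof -
    define v where "v = Matrix.vec (2^n) (\<lambda>i. (if i = k then a else 0) + (if i = l then b else 0))"
    have v: "v \<in> carrier_vec (2^n)" by (simp add: v_def)
    have "Matrix.vec_index (\<rho> *\<^sub>v v) i = \<rho> $$ (i, k) * a + \<rho> $$ (i, l) * b" if "i < 2^n" for i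
      using that carrier kl
      by (simp add: v_def scalar_prod_def distrib_left sum.distrib if_distrib[of "\<lambda>x. _ * x"] cong: if_cong)
    then have "(\<Sum>i<2^n. cnj (Matrix.vec_index v i) * Matrix.vec_index (\<rho> *\<^sub>v v) i)
      = (\<Sum>i<2^n. ((if i = k then cnj a else 0) + (if i = l then cnj b else 0)) * (\<rho> $$ (i, k) * a + \<rho> $$ (i, l) * b))"
      by (intro sum.cong) (auto simp: v_def)
    also have "\<dots> = cnj a * (\<rho> $$ (k, k) * a + \<rho> $$ (k, l) * b) + cnj b * (\<rho> $$ (l, k) * a + \<rho> $$ (l, l) * b)"
      using kl by (simp add: distrib_right sum.distrib if_distrib[of "\<lambda>x. x * _"] cong: if_cong)
    finally show ?thesis using pos[OF v] by simp
  qed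
  show *: "0 \<le> Re (\<rho> $$ (k, k))" using form[of 1 0] by simp
  define A B m where "A = Re (\<rho> $$ (k, k))" and "B = Re (\<rho> $$ (l, l))" and "m = (cmod (\<rho> $$ (k, l)))\<^sup>2"
  have "0 \<le> A * t\<^sup>2 + 2 * t * m + B * m" for t
  proof -
    have m: "m = Re (\<rho> $$ (k, l)) * Re (\<rho> $$ (k, l)) + Im (\<rho> $$ (k, l)) * Im (\<rho> $$ (k, l))"
      unfolding m_def cmod_power2 by (simp only: power2_eq_square)
    show ?thesis
      using form[of "of_real t" "cnj (\<rho> $$ (k, l))"] kl sym[of k l]
      by (simp add: m A_def B_def algebra_simps power2_eq_square)
  qed
  note q = this
  have A: "0 \<le> A" and m: "0 \<le> m" using * by (simp_all add: A_def m_def)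
  have B: "0 \<le> B" using form[of 0 1] by (simp add: B_def)
  show "m \<le> Re (\<rho> $$ (k, k)) * Re (\<rho> $$ (l, l))"
  proof (cases "m = 0")
    case False
    with m have m0: "0 < m" by simp
    have "A \<noteq> 0"
    proof
      assume "A = 0"
      then show False using q[of "- B"] q[of "- B - 1"] m0 mult_nonneg_nonneg[OF B m] by (simp add: field_simps)
    qed
    with A have A0: "0 < A" by simp
    have "0 \<le> A * (- m / A)\<^sup>2 + 2 * (- m / A) * m + B * m" by (rule q)
    also have "\<dots> = (m / A) * (A * B - m)" using A0 by (simp add: field_simps power2_eq_square)
    finally show ?thesis using m0 A0 by (simp add: zero_le_divide_iff zero_le_mult_iff A_def B_def)
  qed (use A B in \<open>simp add: A_def B_def\<close>)
qed

text \<open>Positivity is tested on the columns of Y. For the purity, the order-two minors bound the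
  sum of squared entries by the square of the trace.\<close>

lemma density_matrix_state:
  assumes \<rho>: "density_matrix n \<rho>"
  shows "state n (emb n \<rho>)" "2^n * tr (emb n \<rho>) = 1" "2^n * tr (emb n \<rho> * emb n \<rho>) \<le> 1"
proof -
  have carrier: "\<rho> \<in> carrier_mat (2^n) (2^n)" and herm: "adj \<rho> = \<rho>" and trace: "mtrace \<rho> = 1"
    and pos: "\<And>v. v \<in> carrier_vec (2^n) \<Longrightarrow>
      0 \<le> Re (\<Sum>k<2^n. cnj (Matrix.vec_index v k) * Matrix.vec_index (\<rho> *\<^sub>v v) k)"
    using \<rho> unfolding density_matrix_def by blast+
  have st: "star (emb n \<rho>) = emb n \<rho>" using emb_adj[OF carrier] herm by simp
  have "0 \<le> tr (emb n \<rho> * (Y * star Y))" if Y: "lev n Y" for Y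
  proof -
    have "0 \<le> Re (\<Sum>j<2^n. \<Sum>k<2^n. cnj (ent Y k j) * (\<Sum>l<2^n. \<rho> $$ (k, l) * ent Y l j))"
      unfolding Re_sum
    proof (rule sum_nonneg)
      fix j :: nat
      define v where "v = Matrix.vec (2^n) (\<lambda>k. ent Y k j)"
      have "Matrix.vec_index (\<rho> *\<^sub>v v) k = (\<Sum>l<2^n. \<rho> $$ (k, l) * ent Y l j)" if "k < 2^n" for k
        using that carrier by (simp add: v_def scalar_prod_def atLeast0LessThan)
      then have "(\<Sum>k<2^n. cnj (Matrix.vec_index v k) * Matrix.vec_index (\<rho> *\<^sub>v v) k)
        = (\<Sum>k<2^n. cnj (ent Y k j) * (\<Sum>l<2^n. \<rho> $$ (k, l) * ent Y l j))"
        by (intro sum.cong) (simp_all add: v_def)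
      then show "0 \<le> (\<Sum>k<2^n. Re (cnj (ent Y k j) * (\<Sum>l<2^n. \<rho> $$ (k, l) * ent Y l j)))"
        using pos[of v] unfolding Re_sum[symmetric] by (simp only:) (simp add: v_def del: Re_sum)
    qed
    also have "\<dots> = 2^n * tr (star Y * (emb n \<rho> * Y))"
      using Y by (simp add: tr_eq[of n] lev_mult lev_star lev_emb ent_mult[of n] ent_emb del: Re_sum)
    also have "tr (star Y * (emb n \<rho> * Y)) = tr (emb n \<rho> * (Y * star Y))"
      using tr_commute[of "star Y" "emb n \<rho> * Y"] by (simp add: mult.assoc)
    finally show ?thesis
      using mult_le_cancel_left_pos[of "2^n::real" 0 "tr (emb n \<rho> * (Y * star Y))"] by simp
  qed
  then show "state n (emb n \<rho>)" using st by (simp add: state_def lev_emb)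
  show t: "2^n * tr (emb n \<rho>) = 1" using tr_emb[OF carrier] trace by simp
  have sum1: "(\<Sum>k<2^n. Re (\<rho> $$ (k, k))) = 1"
    using arg_cong[OF trace, of Re] carrier by (simp add: mtrace_def)
  have "2^n * tr (emb n \<rho> * emb n \<rho>) = (\<Sum>k<2^n. \<Sum>l<2^n. (cmod (\<rho> $$ (k, l)))\<^sup>2)"
    using tr_square_eq[OF lev_emb, of n \<rho>] by (simp add: st ent_emb)
  also have "\<dots> \<le> (\<Sum>k<2^n. \<Sum>l<2^n. Re (\<rho> $$ (k, k)) * Re (\<rho> $$ (l, l)))"
    by (intro sum_mono density_matrix_entry_le(2)[OF \<rho>]) auto
  also have "\<dots> = 1" by (simp add: sum1 flip: sum_product)
  finally show "2^n * tr (emb n \<rho> * emb n \<rho>) \<le> 1" .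
qed

text \<open>The variance of Y in the state X is nonnegative.\<close>

lemma state_square_le:
  assumes X: "state n X" "2^n * tr X = 1" and Y: "lev n Y" "star Y = Y"
  shows "(2^n * tr (X * Y))\<^sup>2 \<le> 2^n * tr (X * (Y * Y))"
proof -
  define c where "c = 2^n * tr (X * Y)"
  have "star (Y - c *\<^sub>R 1) = Y - c *\<^sub>R 1" "lev n (Y - c *\<^sub>R 1)"
    using Y by (simp_all add: star_diff star_scaleR star_1 lev_diff lev_scaleR lev_1)
  then have "0 \<le> tr (X * ((Y - c *\<^sub>R 1) * (Y - c *\<^sub>R 1)))"
    using X(1) unfolding state_def by metis
  also have "\<dots> = tr (X * (Y * Y)) - 2 * c * tr (X * Y) + c\<^sup>2 * tr X"
    by (simp add: algebra_simps power2_eq_square)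
  finally have "0 \<le> 2^n * (tr (X * (Y * Y)) - 2 * c * tr (X * Y) + c\<^sup>2 * tr X)" by simp
  also have "\<dots> = 2^n * tr (X * (Y * Y)) - 2 * c * (2^n * tr (X * Y)) + c\<^sup>2 * (2^n * tr X)"
    by (simp add: algebra_simps)
  finally show ?thesis using X(2) by (simp add: c_def[symmetric] power2_eq_square)
qed

text \<open>The variance bound repeatedly replaces Y by its square; the last step is Cauchy-Schwarz
  with purity at most one. After taking a root of order k = 2^(j+1), the factor 2^n on the right
  becomes 2^(n/k).\<close>

lemma state_power_le:
  assumes "state n X" "2^n * tr X = 1" "2^n * tr (X * X) \<le> 1" and Y: "lev n Y" "star Y = Y"
  shows "(2^n * tr (X * Y)) ^ (2 ^ Suc j) \<le> 2^n * tr (Y ^ (2 ^ Suc j))"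
  using Y
proof (induction j arbitrary: Y)
  case 0
  have X: "star X = X" using assms(1) by (simp add: state_def)
  have Y2: "0 \<le> tr (Y * Y)" using tr_square_nonneg[of Y] 0 by simp
  have "(2^n * tr (X * Y))\<^sup>2 = 2^n * 2^n * (tr (X * Y))\<^sup>2"
    by (simp add: power2_eq_square)
  also have "\<dots> \<le> 2^n * 2^n * (tr (X * X) * tr (Y * Y))"
    using tr_Cauchy_Schwarz[of X Y] X 0 by (intro mult_left_mono) auto
  also have "\<dots> = (2^n * tr (X * X)) * (2^n * tr (Y * Y))" by simp
  also have "\<dots> \<le> 1 * (2^n * tr (Y * Y))"
    using assms(3) Y2 by (intro mult_right_mono) auto
  finally show ?case by (simp add: power2_eq_square)
next
  case (Suc j)
  have sq: "(2^n * tr (X * Y))\<^sup>2 \<le> 2^n * tr (X * (Y * Y))"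
    using state_square_le[OF assms(1,2) Suc.prems] .
  have "(2^n * tr (X * Y)) ^ (2 ^ Suc (Suc j)) = ((2^n * tr (X * Y))\<^sup>2) ^ (2 ^ Suc j)"
    by (simp flip: power_mult)
  also have "\<dots> \<le> (2^n * tr (X * (Y * Y))) ^ (2 ^ Suc j)"
    using sq by (intro power_mono) auto
  also have "\<dots> \<le> 2^n * tr ((Y * Y) ^ (2 ^ Suc j))"
    using Suc.prems by (intro Suc.IH) (simp_all add: lev_mult star_mult)
  also have "(Y * Y) ^ (2 ^ Suc j) = Y ^ (2 ^ Suc (Suc j))"
    by (simp add: power_mult flip: power2_eq_square)
  finally show ?case .
qed

text \<open>With y = n/k - 1 in [0, 1], convexity gives 2^y \<le> 1 + y, hence 2^(n/k) \<le> 2n/k.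
  Multiplied by a unit linear in k, this is linear in n wherever n lies between consecutive powers
  of two.\<close>

lemma two_pow_le_ratio_power:
  assumes "k \<le> n" "n \<le> 2 * k" "0 < k"
  shows "2 ^ n \<le> (2 * real n / real k) ^ k"
proof -
  define y where "y = real n / real k - 1"
  have y: "0 \<le> y" "y \<le> 1" using assms by (simp_all add: y_def field_simps)
  have "exp ((1 - y) *\<^sub>R 0 + y *\<^sub>R ln 2) \<le> (1 - y) * exp 0 + y * exp (ln 2 :: real)"
    using exp_convex y by (intro convex_onD[of UNIV]) auto
  then have "2 powr y \<le> 1 + y" by (simp add: powr_def algebra_simps)
  then have "2 powr (1 + y) \<le> 2 * (1 + y)" by (simp add: powr_add)
  then have "(2 powr (1 + y)) ^ k \<le> (2 * (1 + y)) ^ k" by (intro power_mono) auto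
  also have "(2 powr (1 + y)) ^ k = 2 powr ((1 + y) * real k)"
    by (simp add: powr_powr flip: powr_realpow)
  also have "(1 + y) * real k = real n" using assms by (simp add: y_def)
  finally show ?thesis by (simp add: y_def powr_realpow)
qed

lemma obtain_power_2:
  fixes n :: nat assumes "2 \<le> n" obtains j where "2 ^ Suc j \<le> n" "n \<le> 2 * 2 ^ Suc j"
proof -
  obtain i where i: "2 ^ i \<le> n" "n < 2 ^ Suc i"
    using ex_power_ivl1[of 2 n] assms by auto
  then obtain j where "i = Suc j" using assms by (cases i) auto
  with i that[of j] show ?thesis by simp
qed

text \<open>For a power of two k with k \<le> n \<le> 2k, the root of the moment bound is at most
  (2n/k) (7k/10) s = 7/5 n s, and 7/5 < sqrt 2.\<close>

theorem tame_expectation_le: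
  assumes "state n X" "2^n * tr X = 1" "2^n * tr (X * X) \<le> 1" and Y: "tame n s Y" "0 \<le> s" and n: "2 \<le> n"
  shows "\<bar>2^n * tr (X * Y)\<bar> \<le> sqrt 2 * real n * s"
proof -
  obtain j where j: "2 ^ Suc j \<le> n" "n \<le> 2 * 2 ^ Suc j" using obtain_power_2[OF n] .
  define k :: nat where "k = 2 ^ Suc j"
  have k: "k \<le> n" "n \<le> 2 * k" "0 < k" "even k" "2 \<le> k"
    using j one_le_power[of "2::nat" j] by (simp_all add: k_def)
  have nf: "0 < nfac k" using k by (simp add: nfac_def)
  have "\<bar>2^n * tr (X * Y)\<bar> ^ k = (2^n * tr (X * Y)) ^ k"
    using k by (simp add: power_even_abs)
  also have "\<dots> \<le> 2^n * tr (Y ^ k)"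
    using state_power_le[OF assms(1-3), of Y j] Y by (simp add: k_def tame_def)
  also have "\<dots> \<le> 2^n * (nfac k * s) ^ k"
    using Y(1) unfolding tame_def k_def by (intro mult_left_mono) auto
  also have "\<dots> \<le> (2 * real n / real k) ^ k * (nfac k * s) ^ k"
    using two_pow_le_ratio_power[OF k(1-3)] nf Y(2) by (intro mult_right_mono) auto
  also have "\<dots> = (2 * real n / real k * (nfac k * s)) ^ k"
    by (simp only: power_mult_distrib)
  finally have "\<bar>2^n * tr (X * Y)\<bar> \<le> 2 * real n / real k * (nfac k * s)"
    using k nf Y(2) by (simp add: power_mono_iff)
  also have "\<dots> = (2 * nfac k / real k) * (real n * s)" by simp
  also have "\<dots> \<le> sqrt 2 * (real n * s)"
  proof (rule mult_right_mono)
    have "2 * nfac k / real k \<le> 7/5" using k by (simp add: nfac_def field_simps)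
    also have "\<dots> \<le> sqrt 2" by (rule real_le_rsqrt) (simp add: power_divide)
    finally show "2 * nfac k / real k \<le> sqrt 2" .
  qed (use Y(2) in simp)
  finally show ?thesis by simp
qed

text \<open>Conjugation by X on qubit i changes the sign, so the trace vanishes; the operator
  squares to the identity, so all its even moments are 1.\<close>

lemma tame_sz:
  assumes "i < n" "j < n" "i \<noteq> j" shows "tame n 1 (sz i * sz j)"
proof -
  define P where "P = sz i * sz j"
  have P: "lev n P" "star P = P" "P * P = 1"
    using assms sz_commute[of i j]
    by (simp_all add: P_def lev_mult lev_sz star_mult star_sz pauli_rules)
      (metis mult.assoc mult.right_neutral sz_square)
  have "tr P = tr (sx i * P * sx i)"
    using tr_commute[of "sx i * P" "sx i"] by (simp add: sx_square flip: mult.assoc)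
  also have "sx i * P * sx i = - P"
  proof -
    have "sx i * P * sx i = sx i * sz i * sx i * sz j"
      using sx_sz_commute[OF assms(3)] by (simp add: P_def mult.assoc)
    then show ?thesis by (simp add: P_def pauli_rules)
  qed
  finally have "tr P = 0" by simp
  moreover have "tr (P ^ (2 ^ Suc m)) \<le> (nfac (2 ^ Suc m) * 1) ^ (2 ^ Suc m)" for m
  proof -
    have "P ^ (2 ^ Suc m) = 1" using P(3) by (simp add: power_mult power2_eq_square)
    moreover have "1 \<le> nfac (2 ^ Suc m)"
      using one_le_power[of "2::real" m] by (simp add: nfac_def)
    ultimately show ?thesis by (simp add: one_le_power)
  qed
  ultimately show ?thesis using P by (simp add: tame_def P_def[symmetric])
qed

text \<open>Pair the state with the projector onto the k-th basis vector, which has the form Y *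
  star Y.\<close>

lemma state_diag_nonneg:
  assumes "state n X" "k < 2^n" shows "0 \<le> Re (ent X k k)"
proof -
  define Y where "Y = emb n (mat (2^n) (2^n) (\<lambda>(i, j). if i = k \<and> j = k then 1 else 0))"
  have Y: "lev n Y" and e: "ent Y i j = (if i = k \<and> j = k then 1 else 0)" if "i < 2^n" "j < 2^n" for i j
    using that by (simp_all add: Y_def lev_emb ent_emb)
  have Yl: "lev n Y" by (simp add: Y_def lev_emb)
  have YY: "Y * star Y = Y"
    using assms(2) Yl
    by (intro lev_eqI[of n]) (auto simp: lev_mult lev_star ent_mult[of n] e if_distrib[of "\<lambda>x. x * _"] if_distrib[of cnj] cong: if_cong)
  have X: "lev n X" using assms(1) by (simp add: state_def)
  have "0 \<le> tr (X * Y)" using assms(1) Yl YY unfolding state_def by metis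
  also have "tr (X * Y) = Re (\<Sum>i<2^n. \<Sum>j<2^n. ent X i j * (if j = k \<and> i = k then 1 else 0)) / 2^n"
    using X Yl by (simp add: tr_eq[of n] lev_mult ent_mult[of n] e del: Re_sum)
  also have "(\<Sum>i<2^n. \<Sum>j<2^n. ent X i j * (if j = k \<and> i = k then 1 else 0)) = (\<Sum>i<2^n. if i = k then ent X k k else 0)"
    using assms(2) by (intro sum.cong refl) (auto simp: if_distrib[of "\<lambda>x. _ * x"] cong: if_cong)
  also have "\<dots> = ent X k k" using assms(2) by simp
  finally show ?thesis by (simp add: pos_le_divide_eq)
qed

text \<open>The interface to the rest of the proof, which knows the circuit only as an outcome
  distribution whose off-diagonal correlations are small.\<close>

theorem noisy_circuit_correlations:
  assumes "density_matrix n \<rho>0" "\<forall>L\<in>set C. valid_layer n L" "0 \<le> p" "p \<le> 1"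
  defines "\<rho> \<equiv> noisy_circuit n p C \<rho>0"
  shows "\<And>k. k < 2^n \<Longrightarrow> 0 \<le> Re (\<rho> $$ (k, k))"
    and "(\<Sum>k<2^n. Re (\<rho> $$ (k, k))) = 1"
    and "\<And>i j. i < n \<Longrightarrow> j < n \<Longrightarrow>
      corr_mat n \<rho> $$ (i, j) = (\<Sum>k<2^n. Re (\<rho> $$ (k, k)) * (zvec n k i * zvec n k j))"
    and "\<And>i j. i < n \<Longrightarrow> j < n \<Longrightarrow> i \<noteq> j \<Longrightarrow>
      \<bar>corr_mat n \<rho> $$ (i, j)\<bar> \<le> sqrt 2 * real n * (1 - p) ^ length C"
proof -
  have \<rho>0: "\<rho>0 \<in> carrier_mat (2^n) (2^n)" using assms(1) by (simp add: density_matrix_def)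
  note H = noisy_circuit_Heisenberg[OF assms(2-4) \<rho>0, folded \<rho>_def]
  note D = density_matrix_state[OF assms(1)]
  have \<rho>: "\<rho> \<in> carrier_mat (2^n) (2^n)" by (rule H)
  show diag: "0 \<le> Re (\<rho> $$ (k, k))" if "k < 2^n" for k
    using state_diag_nonneg[OF H(2)[OF D(1)] that] that by (simp add: ent_emb)
  show "(\<Sum>k<2^n. Re (\<rho> $$ (k, k))) = 1"
    using D(2) tr_emb[OF \<rho>] \<rho> by (simp add: H(3) mtrace_def)
  have corr: "corr_mat n \<rho> $$ (i, j) = 2^n * tr (emb n \<rho> * (sz i * sz j))" if "i < n" "j < n" for i j
  proof -
    have Z: "Zop n i \<in> carrier_mat (2^n) (2^n)" for i by (simp add: Zop_def)
    have "2^n * tr (emb n (\<rho> * Zop n i * Zop n j)) = Re (mtrace (\<rho> * Zop n i * Zop n j))"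
      using \<rho> Z by (intro tr_emb) (meson mult_carrier_mat)
    moreover have "emb n (\<rho> * Zop n i * Zop n j) = emb n \<rho> * (sz i * sz j)"
      using \<rho> Z that by (simp add: emb_mult[OF _ Z] emb_mult[OF \<rho> Z] emb_Zop mult.assoc)
    ultimately show ?thesis using that by (simp add: corr_mat_def)
  qed
  show "corr_mat n \<rho> $$ (i, j) = (\<Sum>k<2^n. Re (\<rho> $$ (k, k)) * (zvec n k i * zvec n k j))" if ij: "i < n" "j < n" for i j
  proof -
    have "2^n * tr (emb n \<rho> * (sz i * sz j)) = Re (\<Sum>k<2^n. ent (emb n \<rho> * (sz i * sz j)) k k)"
      using ij by (subst tr_eq[of n]) (simp_all add: lev_mult lev_emb lev_sz)
    also have "\<dots> = (\<Sum>k<2^n. Re (\<rho> $$ (k, k)) * (sgn_bit i k * sgn_bit j k))"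
      unfolding Re_sum by (intro sum.cong refl) (simp add: ent_mult_sz ent_emb sgn_bit_def flip: mult.assoc)
    also have "\<dots> = (\<Sum>k<2^n. Re (\<rho> $$ (k, k)) * (zvec n k i * zvec n k j))"
      using ij by (intro sum.cong refl) (simp add: zvec_def sgn_bit_def qbit_eq)
    finally show ?thesis using corr[OF ij] by simp
  qed
  show "\<bar>corr_mat n \<rho> $$ (i, j)\<bar> \<le> sqrt 2 * real n * (1 - p) ^ length C" if ij: "i < n" "j < n" "i \<noteq> j" for i j
  proof -
    obtain Y where Y: "tame n (1 * (1 - p) ^ length C) Y"
      "tr (emb n \<rho> * (sz i * sz j)) = tr (emb n \<rho>0 * Y)"
      using H(4)[OF _ tame_sz[OF ij]] by auto
    then show ?thesis
      using tame_expectation_le[OF D Y(1)] assms(4) ij by (simp add: corr)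
  qed
qed

section \<open>Gaussian rounding\<close>

text \<open>For nonzero c the rotation is a composition of two affine substitutions in one variable
  each, with Fubini in between; their Jacobians cancel. For c = 0 it exchanges the coordinates up to
  signs.\<close>

lemma nn_integral_lborel_rotate:
  fixes G :: "real \<times> real \<Rightarrow> ennreal"
  assumes [measurable]: "G \<in> borel_measurable (borel \<Otimes>\<^sub>M borel)" and cs: "c\<^sup>2 + s\<^sup>2 = 1"
  shows "(\<integral>\<^sup>+x. \<integral>\<^sup>+y. G (c * x - s * y, s * x + c * y) \<partial>lborel \<partial>lborel) = (\<integral>\<^sup>+x. \<integral>\<^sup>+y. G (x, y) \<partial>lborel \<partial>lborel)"
proof (cases "c = 0")
  case False
  have "(\<integral>\<^sup>+x. \<integral>\<^sup>+y. G (c * x - s * y, s * x + c * y) \<partial>lborel \<partial>lborel)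
    = (\<integral>\<^sup>+y. \<integral>\<^sup>+x. G (c * x - s * y, s * x + c * y) \<partial>lborel \<partial>lborel)"
    by (rule lborel_pair.Fubini') measurable
  also have "\<dots> = (\<integral>\<^sup>+y. ennreal (1 / \<bar>c\<bar>) * (\<integral>\<^sup>+x. G (x, (s * x + y) / c) \<partial>lborel) \<partial>lborel)"
  proof (rule nn_integral_cong)
    fix y
    have "(\<integral>\<^sup>+x. G (x, (s * x + y) / c) \<partial>lborel)
       = ennreal \<bar>c\<bar> * (\<integral>\<^sup>+x. G (- (s * y) + c * x, (s * (- (s * y) + c * x) + y) / c) \<partial>lborel)"
      by (rule nn_integral_real_affine[OF _ False]) measurable
    also have "(\<lambda>x. (s * (- (s * y) + c * x) + y) / c) = (\<lambda>x. s * x + c * y)"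
    proof
      fix x
      have "s * (- (s * y) + c * x) + y = (1 - s\<^sup>2) * y + s * c * x"
        by (simp add: algebra_simps power2_eq_square)
      also have "1 - s\<^sup>2 = c * c" using cs by (simp add: power2_eq_square)
      finally show "(s * (- (s * y) + c * x) + y) / c = s * x + c * y"
        using False by (simp add: field_simps)
    qed
    finally show "(\<integral>\<^sup>+x. G (c * x - s * y, s * x + c * y) \<partial>lborel)
      = ennreal (1 / \<bar>c\<bar>) * (\<integral>\<^sup>+x. G (x, (s * x + y) / c) \<partial>lborel)"
      using False by (simp add: mult.assoc[symmetric] ennreal_mult[symmetric] fun_eq_iff add.commute)
  qed
  also have "\<dots> = ennreal (1 / \<bar>c\<bar>) * (\<integral>\<^sup>+y. \<integral>\<^sup>+x. G (x, (s * x + y) / c) \<partial>lborel \<partial>lborel)"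
    by (rule nn_integral_cmult) measurable
  also have "(\<integral>\<^sup>+y. \<integral>\<^sup>+x. G (x, (s * x + y) / c) \<partial>lborel \<partial>lborel)
    = (\<integral>\<^sup>+x. \<integral>\<^sup>+y. G (x, (s * x + y) / c) \<partial>lborel \<partial>lborel)"
    by (rule lborel_pair.Fubini') measurable
  also have "ennreal (1 / \<bar>c\<bar>) * \<dots> = (\<integral>\<^sup>+x. ennreal (1 / \<bar>c\<bar>) * (\<integral>\<^sup>+y. G (x, (s * x + y) / c) \<partial>lborel) \<partial>lborel)"
    by (rule nn_integral_cmult[symmetric]) measurable
  also have "\<dots> = (\<integral>\<^sup>+x. \<integral>\<^sup>+y. G (x, y) \<partial>lborel \<partial>lborel)"
  proof (rule nn_integral_cong)
    fix x
    have "(\<integral>\<^sup>+y. G (x, y) \<partial>lborel) = ennreal \<bar>1 / c\<bar> * (\<integral>\<^sup>+y. G (x, s * x / c + (1 / c) * y) \<partial>lborel)"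
      by (rule nn_integral_real_affine) (measurable, use False in simp)
    then show "ennreal (1 / \<bar>c\<bar>) * (\<integral>\<^sup>+y. G (x, (s * x + y) / c) \<partial>lborel) = (\<integral>\<^sup>+y. G (x, y) \<partial>lborel)"
      by (simp add: add_divide_distrib)
  qed
  finally show ?thesis .
next
  case True
  then have "s\<^sup>2 = 1" using cs by simp
  then have s: "s = 1 \<or> s = -1" by (simp add: power2_eq_1_iff)
  have affine: "(\<integral>\<^sup>+y. f (\<sigma> * y) \<partial>lborel) = (\<integral>\<^sup>+y. f y \<partial>lborel)"
    if "\<sigma> = 1 \<or> \<sigma> = -1" "f \<in> borel_measurable borel" for f :: "real \<Rightarrow> ennreal" and \<sigma>
    using that nn_integral_real_affine[of f \<sigma> 0] by auto
  have "(\<integral>\<^sup>+x. \<integral>\<^sup>+y. G (c * x - s * y, s * x + c * y) \<partial>lborel \<partial>lborel)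
     = (\<integral>\<^sup>+x. \<integral>\<^sup>+y. G ((- s) * y, s * x) \<partial>lborel \<partial>lborel)" using True by simp
  also have "\<dots> = (\<integral>\<^sup>+x. \<integral>\<^sup>+y. G (y, s * x) \<partial>lborel \<partial>lborel)"
    by (rule nn_integral_cong, rule affine) (use s in auto)
  also have "\<dots> = (\<integral>\<^sup>+y. \<integral>\<^sup>+x. G (y, s * x) \<partial>lborel \<partial>lborel)"
    by (rule lborel_pair.Fubini') measurable
  also have "\<dots> = (\<integral>\<^sup>+y. \<integral>\<^sup>+x. G (y, x) \<partial>lborel \<partial>lborel)"
    by (rule nn_integral_cong, rule affine) (use s in auto)
  finally show ?thesis .
qed

section \<open>Independent standard Gaussians\<close>

lemma sets_std_normal [measurable_cong, simp]: "sets std_normal_measure = sets borel"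
  by (simp add: std_normal_measure_def)

lemma space_std_normal [simp]: "space std_normal_measure = UNIV"
  by (simp add: std_normal_measure_def)

lemma prob_space_std_normal: "prob_space std_normal_measure"
  unfolding std_normal_measure_def by (rule prob_space_normal_density) simp

interpretation std_normal: prob_space std_normal_measure
  by (rule prob_space_std_normal)

interpretation std_normal_pair: pair_sigma_finite std_normal_measure std_normal_measure
  by standard

interpretation std_normal_prod: product_sigma_finite "\<lambda>_::nat. std_normal_measure"
  by standard

lemma nn_integral_std_normal:
  "f \<in> borel_measurable borel \<Longrightarrow>
   (\<integral>\<^sup>+x. f x \<partial>std_normal_measure) = (\<integral>\<^sup>+x. ennreal (std_normal_density x) * f x \<partial>lborel)"
  unfolding std_normal_measure_def by (simp add: nn_integral_density)

lemma std_normal_density_mult: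
  "std_normal_density x * std_normal_density y = exp (- ((x\<^sup>2 + y\<^sup>2) / 2)) / (2 * pi)"
proof -
  have "exp (- x\<^sup>2 / 2) * exp (- y\<^sup>2 / 2) = exp (- x\<^sup>2 / 2 + - y\<^sup>2 / 2)"
    by (rule exp_add[symmetric])
  also have "- x\<^sup>2 / 2 + - y\<^sup>2 / 2 = - ((x\<^sup>2 + y\<^sup>2) / 2)"
    by (simp add: add_divide_distrib)
  finally have e: "exp (- x\<^sup>2 / 2) * exp (- y\<^sup>2 / 2) = exp (- ((x\<^sup>2 + y\<^sup>2) / 2))" .
  have c: "1 / sqrt (2 * pi) * (1 / sqrt (2 * pi)) = 1 / (2 * pi)"
    by (simp del: real_sqrt_mult)
  have "(r * p) * (r * q) = (r * r) * (p * q)" for p q r :: real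
    by simp
  then show ?thesis
    unfolding std_normal_density_def by (simp only: c e) simp
qed

lemma nn_integral_std_normal_pair:
  assumes [measurable]: "F \<in> borel_measurable (borel \<Otimes>\<^sub>M borel)"
  shows "(\<integral>\<^sup>+x. \<integral>\<^sup>+y. F (x, y) \<partial>std_normal_measure \<partial>std_normal_measure)
    = (\<integral>\<^sup>+x. \<integral>\<^sup>+y. ennreal (exp (- ((x\<^sup>2 + y\<^sup>2) / 2)) / (2 * pi)) * F (x, y) \<partial>lborel \<partial>lborel)"
proof -
  have "(\<integral>\<^sup>+x. \<integral>\<^sup>+y. F (x, y) \<partial>std_normal_measure \<partial>std_normal_measure)
    = (\<integral>\<^sup>+x. ennreal (std_normal_density x) * (\<integral>\<^sup>+y. ennreal (std_normal_density y) * F (x, y) \<partial>lborel) \<partial>lborel)"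
    by (subst nn_integral_std_normal) (auto simp: nn_integral_std_normal)
  also have "\<dots> = (\<integral>\<^sup>+x. \<integral>\<^sup>+y. ennreal (std_normal_density x) * (ennreal (std_normal_density y) * F (x, y)) \<partial>lborel \<partial>lborel)"
    by (intro nn_integral_cong nn_integral_cmult[symmetric]) measurable
  also have "\<dots> = (\<integral>\<^sup>+x. \<integral>\<^sup>+y. ennreal (exp (- ((x\<^sup>2 + y\<^sup>2) / 2)) / (2 * pi)) * F (x, y) \<partial>lborel \<partial>lborel)"
    by (intro nn_integral_cong) (simp only: std_normal_density_mult[symmetric]
        ennreal_mult[OF normal_density_nonneg normal_density_nonneg] mult.assoc)
  finally show ?thesis .
qed

lemma std_normal_rotate:
  assumes [measurable]: "F \<in> borel_measurable (borel \<Otimes>\<^sub>M borel)" and cs: "c\<^sup>2 + s\<^sup>2 = 1"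
  shows "(\<integral>\<^sup>+x. \<integral>\<^sup>+y. F (c * x - s * y, s * x + c * y) \<partial>std_normal_measure \<partial>std_normal_measure)
    = (\<integral>\<^sup>+x. \<integral>\<^sup>+y. F (x, y) \<partial>std_normal_measure \<partial>std_normal_measure)"
proof -
  define G where "G = (\<lambda>(x, y). ennreal (exp (- ((x\<^sup>2 + y\<^sup>2) / 2)) / (2 * pi)) * F (x, y))"
  have [measurable]: "G \<in> borel_measurable (borel \<Otimes>\<^sub>M borel)" unfolding G_def by measurable
  have r: "(c * x - s * y)\<^sup>2 + (s * x + c * y)\<^sup>2 = x\<^sup>2 + y\<^sup>2" for x y
  proof -
    have "(c * x - s * y)\<^sup>2 + (s * x + c * y)\<^sup>2 = (c\<^sup>2 + s\<^sup>2) * (x\<^sup>2 + y\<^sup>2)"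
      by (simp add: power2_eq_square algebra_simps)
    then show ?thesis using cs by simp
  qed
  define F' where "F' = (\<lambda>(x, y). F (c * x - s * y, s * x + c * y))"
  have [measurable]: "F' \<in> borel_measurable (borel \<Otimes>\<^sub>M borel)" unfolding F'_def by measurable
  have "(\<integral>\<^sup>+x. \<integral>\<^sup>+y. F' (x, y) \<partial>std_normal_measure \<partial>std_normal_measure)
    = (\<integral>\<^sup>+x. \<integral>\<^sup>+y. G (c * x - s * y, s * x + c * y) \<partial>lborel \<partial>lborel)"
    unfolding nn_integral_std_normal_pair[OF \<open>F' \<in> _\<close>] by (simp add: G_def F'_def r)
  also have "\<dots> = (\<integral>\<^sup>+x. \<integral>\<^sup>+y. F (x, y) \<partial>std_normal_measure \<partial>std_normal_measure)"
    unfolding nn_integral_lborel_rotate[OF \<open>G \<in> _\<close> cs] nn_integral_std_normal_pair[OF assms(1)]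
    by (simp add: G_def)
  finally show ?thesis by (simp add: F'_def)
qed

lemma obtain_rotation:
  fixes a b :: real
  obtains c s where "c\<^sup>2 + s\<^sup>2 = 1" "a * c + b * s = sqrt (a\<^sup>2 + b\<^sup>2)" "b * c = a * s"
proof (cases "a = 0 \<and> b = 0")
  case True
  then show ?thesis using that[of 1 0] by simp
next
  case False
  define r where "r = sqrt (a\<^sup>2 + b\<^sup>2)"
  have r: "0 < r" "r\<^sup>2 = a\<^sup>2 + b\<^sup>2" using False by (auto simp: r_def sum_power2_gt_zero_iff)
  show ?thesis
  proof (rule that[of "a / r" "b / r"])
    show "(a / r)\<^sup>2 + (b / r)\<^sup>2 = 1"
    proof -
      have "(a / r)\<^sup>2 + (b / r)\<^sup>2 = (a\<^sup>2 + b\<^sup>2) / r\<^sup>2"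
        by (simp add: power_divide add_divide_distrib)
      then show ?thesis using r(1) by (simp flip: r(2))
    qed
    have "a * (a / r) + b * (b / r) = r\<^sup>2 / r"
      unfolding r(2) by (simp add: add_divide_distrib power2_eq_square)
    also have "\<dots> = r" using r(1) by (simp add: power2_eq_square)
    finally show "a * (a / r) + b * (b / r) = sqrt (a\<^sup>2 + b\<^sup>2)" unfolding r_def .
  qed simp
qed

text \<open>Rotate so that the linear form depends on the first coordinate alone; the second then
  integrates to one.\<close>

lemma std_normal_add:
  assumes [measurable]: "f \<in> borel_measurable borel"
  shows "(\<integral>\<^sup>+x. \<integral>\<^sup>+y. f (a * x + b * y) \<partial>std_normal_measure \<partial>std_normal_measure)
    = (\<integral>\<^sup>+x. f (sqrt (a\<^sup>2 + b\<^sup>2) * x) \<partial>std_normal_measure)"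
proof -
  obtain c s where cs: "c\<^sup>2 + s\<^sup>2 = 1" "a * c + b * s = sqrt (a\<^sup>2 + b\<^sup>2)" "b * c = a * s"
    using obtain_rotation .
  have "(\<integral>\<^sup>+x. \<integral>\<^sup>+y. f (a * x + b * y) \<partial>std_normal_measure \<partial>std_normal_measure)
    = (\<integral>\<^sup>+x. \<integral>\<^sup>+y. f (a * (c * x - s * y) + b * (s * x + c * y)) \<partial>std_normal_measure \<partial>std_normal_measure)"
    using std_normal_rotate[of "\<lambda>(x, y). f (a * x + b * y)", OF _ cs(1)] by simp
  also have "(\<lambda>x y. a * (c * x - s * y) + b * (s * x + c * y)) = (\<lambda>x y. sqrt (a\<^sup>2 + b\<^sup>2) * x)"
  proof (intro ext)
    fix x y
    have "a * (c * x - s * y) + b * (s * x + c * y) = (a * c + b * s) * x + (b * c - a * s) * y"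
      by (simp add: algebra_simps)
    then show "a * (c * x - s * y) + b * (s * x + c * y) = sqrt (a\<^sup>2 + b\<^sup>2) * x"
      using cs by simp
  qed
  finally show ?thesis by (simp add: fun_eq_iff std_normal.emeasure_space_1[simplified])
qed

text \<open>A pair of linear forms of a standard Gaussian vector has the law of \<open>(a x, d x + e y)\<close>
  with the same covariance, where \<open>x\<close>, \<open>y\<close> are independent standard Gaussians: Givens rotations
  make the coefficient matrix lower triangular, one coordinate at a time.\<close>

lemma gaussian_pair_law:
  fixes u w :: "nat \<Rightarrow> real"
  shows "\<exists>a d e. 0 \<le> a \<and> 0 \<le> e \<and> a\<^sup>2 = (\<Sum>k<n. (u k)\<^sup>2) \<and> a * d = (\<Sum>k<n. u k * w k) \<and>
    d\<^sup>2 + e\<^sup>2 = (\<Sum>k<n. (w k)\<^sup>2) \<and>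
    (\<forall>F \<in> borel_measurable (borel \<Otimes>\<^sub>M borel).
      (\<integral>\<^sup>+g. F (\<Sum>k<n. u k * g k, \<Sum>k<n. w k * g k) \<partial>PiM {..<n} (\<lambda>_. std_normal_measure))
      = (\<integral>\<^sup>+x. \<integral>\<^sup>+y. F (a * x, d * x + e * y) \<partial>std_normal_measure \<partial>std_normal_measure))"
proof (induction n)
  case 0
  show ?case
    by (intro exI[of _ 0]) (simp add: PiM_empty std_normal.emeasure_space_1[simplified])
next
  case (Suc n)
  then obtain a d e where IH: "0 \<le> a" "0 \<le> e" "a\<^sup>2 = (\<Sum>k<n. (u k)\<^sup>2)" "a * d = (\<Sum>k<n. u k * w k)"
    "d\<^sup>2 + e\<^sup>2 = (\<Sum>k<n. (w k)\<^sup>2)"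
    "\<And>F. F \<in> borel_measurable (borel \<Otimes>\<^sub>M borel) \<Longrightarrow>
      (\<integral>\<^sup>+g. F (\<Sum>k<n. u k * g k, \<Sum>k<n. w k * g k) \<partial>PiM {..<n} (\<lambda>_. std_normal_measure))
      = (\<integral>\<^sup>+x. \<integral>\<^sup>+y. F (a * x, d * x + e * y) \<partial>std_normal_measure \<partial>std_normal_measure)"
    by blast
  define p q where "p = u n" and "q = w n"
  obtain c s where cs: "c\<^sup>2 + s\<^sup>2 = 1" "a * c + p * s = sqrt (a\<^sup>2 + p\<^sup>2)" "p * c = a * s"
    using obtain_rotation .
  \<comment> \<open>The rotation removes the second variable from the first form and leaves it in
    the second form with coefficient f, where it merges with the independent term of coefficient
    e.\<close>
  define d' f where "d' = d * c + q * s" and "f = q * c - d * s"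
  define a' where "a' = sqrt (a\<^sup>2 + p\<^sup>2)"
  define e' where "e' = sqrt (f\<^sup>2 + e\<^sup>2)"
  have "a'\<^sup>2 = (\<Sum>k<Suc n. (u k)\<^sup>2)" by (simp add: a'_def IH(3) p_def sum_nonneg)
  moreover have "a' * d' = (\<Sum>k<Suc n. u k * w k)"
  proof -
    have "a' * d' = (a * c + p * s) * (d * c + q * s) + (p * c - a * s) * (q * c - d * s)"
      using cs by (simp add: a'_def d'_def)
    also have "\<dots> = (c\<^sup>2 + s\<^sup>2) * (a * d + p * q)"
      by (simp add: algebra_simps power2_eq_square)
    finally show ?thesis using cs IH(4) by (simp add: p_def q_def)
  qed
  moreover have "d'\<^sup>2 + e'\<^sup>2 = (\<Sum>k<Suc n. (w k)\<^sup>2)"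
  proof -
    have "d'\<^sup>2 + e'\<^sup>2 = (c\<^sup>2 + s\<^sup>2) * (d\<^sup>2 + q\<^sup>2) + e\<^sup>2"
      by (simp add: e'_def d'_def f_def) (simp add: algebra_simps power2_eq_square)
    then show ?thesis using cs IH(5) by (simp add: q_def)
  qed
  moreover have "(\<integral>\<^sup>+g. F (\<Sum>k<Suc n. u k * g k, \<Sum>k<Suc n. w k * g k) \<partial>PiM {..<Suc n} (\<lambda>_. std_normal_measure))
      = (\<integral>\<^sup>+x. \<integral>\<^sup>+y. F (a' * x, d' * x + e' * y) \<partial>std_normal_measure \<partial>std_normal_measure)"
    if [measurable]: "F \<in> borel_measurable (borel \<Otimes>\<^sub>M borel)" for F
  proof -
    let ?N = std_normal_measure
    have "(\<integral>\<^sup>+g. F (\<Sum>k<Suc n. u k * g k, \<Sum>k<Suc n. w k * g k) \<partial>PiM {..<Suc n} (\<lambda>_. ?N))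
      = (\<integral>\<^sup>+t. \<integral>\<^sup>+g. F (\<Sum>k<Suc n. u k * (g(n := t)) k, \<Sum>k<Suc n. w k * (g(n := t)) k) \<partial>PiM {..<n} (\<lambda>_. ?N) \<partial>?N)"
      unfolding lessThan_Suc
      by (subst std_normal_prod.product_nn_integral_insert_rev) (simp_all, measurable)
    also have "\<dots> = (\<integral>\<^sup>+t. \<integral>\<^sup>+g. F ((\<Sum>k<n. u k * g k) + p * t, (\<Sum>k<n. w k * g k) + q * t) \<partial>PiM {..<n} (\<lambda>_. ?N) \<partial>?N)"
    proof -
      have "(\<Sum>k<n. v k * (g(n := t)) k) = (\<Sum>k<n. v k * g k)" for v g and t :: real
        by (rule sum.cong) auto
      then show ?thesis by (simp add: p_def q_def del: fun_upd_apply) (simp add: fun_upd_apply)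
    qed
    also have "\<dots> = (\<integral>\<^sup>+t. \<integral>\<^sup>+x. \<integral>\<^sup>+y. F (a * x + p * t, d * x + e * y + q * t) \<partial>?N \<partial>?N \<partial>?N)"
    proof (rule nn_integral_cong)
      fix t
      show "(\<integral>\<^sup>+g. F ((\<Sum>k<n. u k * g k) + p * t, (\<Sum>k<n. w k * g k) + q * t) \<partial>PiM {..<n} (\<lambda>_. ?N))
        = (\<integral>\<^sup>+x. \<integral>\<^sup>+y. F (a * x + p * t, d * x + e * y + q * t) \<partial>?N \<partial>?N)"
        using IH(6)[of "\<lambda>(x, y). F (x + p * t, y + q * t)"] by simp
    qed
    also have "\<dots> = (\<integral>\<^sup>+x. \<integral>\<^sup>+t. \<integral>\<^sup>+y. F (a * x + p * t, d * x + e * y + q * t) \<partial>?N \<partial>?N \<partial>?N)"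
      by (rule std_normal_pair.Fubini') measurable
    also have "\<dots> = (\<integral>\<^sup>+x. \<integral>\<^sup>+t. \<integral>\<^sup>+y. F (a * (c * x - s * t) + p * (s * x + c * t),
        d * (c * x - s * t) + e * y + q * (s * x + c * t)) \<partial>?N \<partial>?N \<partial>?N)"
      using std_normal_rotate[of "\<lambda>(x, t). \<integral>\<^sup>+y. F (a * x + p * t, d * x + e * y + q * t) \<partial>?N", OF _ cs(1)]
      by simp
    also have "\<dots> = (\<integral>\<^sup>+x. \<integral>\<^sup>+t. \<integral>\<^sup>+y. F (a' * x, d' * x + (f * t + e * y)) \<partial>?N \<partial>?N \<partial>?N)"
    proof -
      have "a * (c * x - s * t) + p * (s * x + c * t) = a' * x" for x t
      proof -
        have "a * (c * x - s * t) + p * (s * x + c * t) = (a * c + p * s) * x + (p * c - a * s) * t"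
          by (simp add: algebra_simps)
        then show ?thesis using cs by (simp add: a'_def)
      qed
      moreover have "d * (c * x - s * t) + e * y + q * (s * x + c * t) = d' * x + (f * t + e * y)" for x t y
        by (simp add: d'_def f_def algebra_simps)
      ultimately show ?thesis by (simp only:)
    qed
    also have "\<dots> = (\<integral>\<^sup>+x. \<integral>\<^sup>+y. F (a' * x, d' * x + e' * y) \<partial>?N \<partial>?N)"
      unfolding e'_def
      by (intro nn_integral_cong std_normal_add[of "\<lambda>z. F (a' * _, d' * _ + z)"]) measurable
    finally show ?thesis .
  qed
  moreover have "0 \<le> a'" "0 \<le> e'" by (simp_all add: a'_def e'_def)
  ultimately show ?case by blast
qed

subsection \<open>The arcsine law\<close>

lemma nn_integral_Rayleigh:
  fixes b :: real assumes "0 < b"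
  shows "(\<integral>\<^sup>+x. ennreal (x * exp (- (b * x\<^sup>2 / 2))) * indicator {0..} x \<partial>lborel) = ennreal (1 / b)"
proof -
  have "(\<integral>\<^sup>+x. ennreal (x * exp (- (b * x\<^sup>2 / 2))) * indicator {0..} x \<partial>lborel)
    = ennreal (0 - (\<lambda>x. - exp (- (b * x\<^sup>2 / 2)) / b) 0)"
  proof (rule nn_integral_FTC_atLeast)
    show "((\<lambda>x. - exp (- (b * x\<^sup>2 / 2)) / b) \<longlongrightarrow> 0) at_top"
      using assms by real_asymp
    show "((\<lambda>x. - exp (- (b * x\<^sup>2 / 2)) / b) has_real_derivative x * exp (- (b * x\<^sup>2 / 2))) (at x)" for x
      using assms by (auto intro!: derivative_eq_intros simp: field_simps)
  qed auto
  then show ?thesis by simp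
qed

lemma nn_integral_arctan:
  "(\<integral>\<^sup>+s. ennreal (1 / (1 + s\<^sup>2)) * indicator {..a} s \<partial>lborel) = ennreal (pi / 2 + arctan a)"
proof -
  have "(\<integral>\<^sup>+s. ennreal (1 / (1 + s\<^sup>2)) * indicator {..a} s \<partial>lborel)
    = (\<integral>\<^sup>+s. ennreal (1 / (1 + s\<^sup>2)) * indicator {-a..} s \<partial>lborel)"
    by (subst nn_integral_real_affine[of _ "-1" 0]) (auto intro!: nn_integral_cong split: split_indicator)
  also have "\<dots> = ennreal (pi / 2 - arctan (- a))"
  proof (rule nn_integral_FTC_atLeast)
    show "(arctan has_real_derivative 1 / (1 + x\<^sup>2)) (at x)" for x
      using DERIV_arctan[of x] by (simp add: divide_inverse)
  qed (auto simp: tendsto_arctan_at_top add_nonneg_nonneg)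
  finally show ?thesis by (simp add: arctan_minus)
qed

text \<open>The region is a wedge of angle pi/2 + arctan a. Substituting y = x s and integrating
  over x first gives, for each slope s, a Rayleigh integral 1/(1 + s^2), the derivative of the
  arctangent.\<close>

lemma std_normal_half_plane:
  "(\<integral>\<^sup>+x. \<integral>\<^sup>+y. indicator {(x, y). 0 < x \<and> y \<le> a * x} (x, y) \<partial>std_normal_measure \<partial>std_normal_measure)
    = ennreal ((pi / 2 + arctan a) / (2 * pi))"
proof -
  have [measurable]: "{(x, y). 0 < x \<and> y \<le> a * x} \<in> sets (borel \<Otimes>\<^sub>M borel)"
  proof -
    have "{z \<in> space (borel \<Otimes>\<^sub>M borel). 0 < fst z \<and> snd z \<le> a * fst z} \<in> sets (borel \<Otimes>\<^sub>M (borel :: real measure))"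
      by measurable
    moreover have "{(x, y). 0 < x \<and> y \<le> a * x} = {z. 0 < fst z \<and> snd z \<le> a * fst z}" by auto
    ultimately show ?thesis by (simp add: space_pair_measure)
  qed
  have "(\<integral>\<^sup>+x. \<integral>\<^sup>+y. indicator {(x, y). 0 < x \<and> y \<le> a * x} (x, y) \<partial>std_normal_measure \<partial>std_normal_measure)
    = (\<integral>\<^sup>+x. \<integral>\<^sup>+y. ennreal (exp (- ((x\<^sup>2 + y\<^sup>2) / 2)) / (2 * pi)) * indicator {(x, y). 0 < x \<and> y \<le> a * x} (x, y) \<partial>lborel \<partial>lborel)"
    by (rule nn_integral_std_normal_pair) measurable
  also have "\<dots> = (\<integral>\<^sup>+x. \<integral>\<^sup>+s. ennreal (x * exp (- ((1 + s\<^sup>2) * x\<^sup>2 / 2))) * indicator {0..} x *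
      (ennreal (1 / (2 * pi)) * indicator {..a} s) \<partial>lborel \<partial>lborel)"
  proof (rule nn_integral_cong)
    fix x :: real
    let ?f = "\<lambda>y. ennreal (exp (- ((x\<^sup>2 + y\<^sup>2) / 2)) / (2 * pi)) * indicator {(x, y). 0 < x \<and> y \<le> a * x} (x, y)"
    show "(\<integral>\<^sup>+y. ?f y \<partial>lborel) = (\<integral>\<^sup>+s. ennreal (x * exp (- ((1 + s\<^sup>2) * x\<^sup>2 / 2))) * indicator {0..} x *
      (ennreal (1 / (2 * pi)) * indicator {..a} s) \<partial>lborel)"
    proof (cases "0 < x")
      case False
      then have "x < 0 \<or> x = 0" by auto
      then show ?thesis by (auto simp: indicator_def)
    next
      case True
      define f where "f y = ennreal (exp (- ((x\<^sup>2 + y\<^sup>2) / 2)) / (2 * pi)) * indicator {..a * x} y" for y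
      have [measurable]: "f \<in> borel_measurable borel" unfolding f_def by measurable
      have "(\<integral>\<^sup>+y. ?f y \<partial>lborel) = (\<integral>\<^sup>+y. f y \<partial>lborel)"
        using True by (intro nn_integral_cong) (simp add: f_def indicator_def)
      also have "\<dots> = ennreal \<bar>x\<bar> * (\<integral>\<^sup>+s. f (0 + x * s) \<partial>lborel)"
        by (rule nn_integral_real_affine) (measurable, use True in simp)
      also have "\<dots> = (\<integral>\<^sup>+s. ennreal \<bar>x\<bar> * f (0 + x * s) \<partial>lborel)"
        by (rule nn_integral_cmult[symmetric]) measurable
      also have "\<dots> = (\<integral>\<^sup>+s. ennreal (x * exp (- ((1 + s\<^sup>2) * x\<^sup>2 / 2))) * indicator {0..} x *
        (ennreal (1 / (2 * pi)) * indicator {..a} s) \<partial>lborel)"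
      proof (rule nn_integral_cong)
        fix s :: real
        have "x * s \<le> a * x \<longleftrightarrow> s \<le> a" using True by (simp add: mult.commute)
        moreover have "x\<^sup>2 + (x * s)\<^sup>2 = (1 + s\<^sup>2) * x\<^sup>2" by (simp add: algebra_simps power2_eq_square)
        ultimately show "ennreal \<bar>x\<bar> * f (0 + x * s) = ennreal (x * exp (- ((1 + s\<^sup>2) * x\<^sup>2 / 2))) * indicator {0..} x *
          (ennreal (1 / (2 * pi)) * indicator {..a} s)"
          using True by (simp add: f_def indicator_def ennreal_mult[symmetric])
      qed
      finally show ?thesis .
    qed
  qed
  also have "\<dots> = (\<integral>\<^sup>+s. \<integral>\<^sup>+x. ennreal (x * exp (- ((1 + s\<^sup>2) * x\<^sup>2 / 2))) * indicator {0..} x *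
      (ennreal (1 / (2 * pi)) * indicator {..a} s) \<partial>lborel \<partial>lborel)"
    by (rule lborel_pair.Fubini') measurable
  also have "\<dots> = (\<integral>\<^sup>+s. ennreal (1 / (1 + s\<^sup>2)) * (ennreal (1 / (2 * pi)) * indicator {..a} s) \<partial>lborel)"
  proof (rule nn_integral_cong)
    fix s :: real
    have "0 < 1 + s\<^sup>2" by (simp add: add_pos_nonneg)
    then show "(\<integral>\<^sup>+x. ennreal (x * exp (- ((1 + s\<^sup>2) * x\<^sup>2 / 2))) * indicator {0..} x *
      (ennreal (1 / (2 * pi)) * indicator {..a} s) \<partial>lborel)
      = ennreal (1 / (1 + s\<^sup>2)) * (ennreal (1 / (2 * pi)) * indicator {..a} s)"
      by (subst nn_integral_multc) (simp_all add: nn_integral_Rayleigh)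
  qed
  also have "\<dots> = ennreal (1 / (2 * pi)) * (\<integral>\<^sup>+s. ennreal (1 / (1 + s\<^sup>2)) * indicator {..a} s \<partial>lborel)"
    by (subst nn_integral_cmult[symmetric]) (auto simp: mult_ac)
  also have "\<dots> = ennreal ((pi / 2 + arctan a) / (2 * pi))"
    unfolding nn_integral_arctan by (simp add: ennreal_mult'[symmetric])
  finally show ?thesis .
qed

definition sg :: "real \<Rightarrow> real" where
  "sg t = (if t \<ge> 0 then 1 else -1)"

lemma sg_measurable [measurable]: "sg \<in> borel_measurable borel"
  unfolding sg_def by measurable

lemma AE_std_normal_neq: "AE x in std_normal_measure. x \<noteq> c"
  unfolding std_normal_measure_def
  by (subst AE_density) (auto intro: AE_mp[OF AE_lborel_singleton[of c]])

text \<open>Up to null sets the signs differ on two opposite wedges, exchanged by the half turn and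
  bounded by the line of slope - d/e. For e = 0 this slope is meaningless, but the two forms are
  then equal or opposite.\<close>

lemma sign_disagreement:
  assumes de: "d\<^sup>2 + e\<^sup>2 = 1" "0 \<le> e"
  shows "(\<integral>\<^sup>+x. \<integral>\<^sup>+y. indicator {(x, y). sg x \<noteq> sg y} (x, d * x + e * y) \<partial>std_normal_measure \<partial>std_normal_measure)
    = ennreal (1 / 2 - arcsin d / pi)"
proof (cases "e = 0")
  case True
  then have "d = 1 \<or> d = -1" using de by (simp add: power2_eq_1_iff)
  then show ?thesis
  proof
    assume "d = 1"
    then show ?thesis using True by (simp add: indicator_def)
  next
    assume d: "d = -1"
    have "(\<integral>\<^sup>+x. \<integral>\<^sup>+y. indicator {(x, y). sg x \<noteq> sg y} (x, d * x + e * y) \<partial>std_normal_measure \<partial>std_normal_measure)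
      = (\<integral>\<^sup>+x. 1 \<partial>std_normal_measure)"
      by (rule nn_integral_cong_AE, use AE_std_normal_neq[of 0] in eventually_elim)
        (auto simp: True d sg_def indicator_def std_normal.emeasure_space_1[simplified])
    then show ?thesis using d by (simp add: std_normal.emeasure_space_1[simplified])
  qed
next
  case False
  with de have e: "0 < e" by simp
  define a where "a = - d / e"
  let ?N = std_normal_measure
  define S where "S = {(x :: real, y :: real). 0 < x \<and> y \<le> a * x}"
  have [measurable]: "S \<in> sets (borel \<Otimes>\<^sub>M borel)"
  proof -
    have "{z \<in> space (borel \<Otimes>\<^sub>M borel). 0 < fst z \<and> snd z \<le> a * fst z} \<in> sets (borel \<Otimes>\<^sub>M (borel :: real measure))"
      by measurable
    moreover have "S = {z. 0 < fst z \<and> snd z \<le> a * fst z}" by (auto simp: S_def)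
    ultimately show ?thesis by (simp add: space_pair_measure)
  qed
  define J where "J = (\<integral>\<^sup>+x. \<integral>\<^sup>+y. indicator S (x, y) \<partial>?N \<partial>?N)"
  have J: "J = ennreal ((pi / 2 + arctan a) / (2 * pi))"
    unfolding J_def S_def by (rule std_normal_half_plane)
  have J': "J = (\<integral>\<^sup>+x. \<integral>\<^sup>+y. indicator S (- x, - y) \<partial>?N \<partial>?N)"
    unfolding J_def using std_normal_rotate[of "indicator S" "-1" 0] by simp
  have "(\<integral>\<^sup>+x. \<integral>\<^sup>+y. indicator {(x, y). sg x \<noteq> sg y} (x, d * x + e * y) \<partial>?N \<partial>?N)
    = (\<integral>\<^sup>+x. \<integral>\<^sup>+y. indicator S (x, y) + indicator S (- x, - y) \<partial>?N \<partial>?N)"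
  proof (rule nn_integral_cong_AE, use AE_std_normal_neq[of 0] in eventually_elim)
    fix x :: real assume x: "x \<noteq> 0"
    show "(\<integral>\<^sup>+y. indicator {(x, y). sg x \<noteq> sg y} (x, d * x + e * y) \<partial>?N)
      = (\<integral>\<^sup>+y. indicator S (x, y) + indicator S (- x, - y) \<partial>?N)"
    proof (rule nn_integral_cong_AE, use AE_std_normal_neq[of "a * x"] in eventually_elim)
      fix y assume y: "y \<noteq> a * x"
      have "0 \<le> d * x + e * y \<longleftrightarrow> a * x \<le> y"
        using e by (simp add: a_def field_simps) linarith
      then show "indicator {(x, y). sg x \<noteq> sg y} (x, d * x + e * y) = (indicator S (x, y) + indicator S (- x, - y) :: ennreal)"
        using x y by (auto simp: sg_def S_def indicator_def)
    qed
  qed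
  also have "\<dots> = (\<integral>\<^sup>+x. (\<integral>\<^sup>+y. indicator S (x, y) \<partial>?N) + (\<integral>\<^sup>+y. indicator S (- x, - y) \<partial>?N) \<partial>?N)"
    by (intro nn_integral_cong nn_integral_add) measurable
  also have "\<dots> = J + J"
    unfolding J_def by (subst nn_integral_add) (measurable, simp add: J'[symmetric] J_def[symmetric])
  also have "\<dots> = ennreal (1 / 2 + arctan a / pi)"
  proof -
    have "0 \<le> pi / 2 + arctan a" using arctan_lbound[of a] by simp
    moreover have "(pi / 2 + t) / (2 * pi) + (pi / 2 + t) / (2 * pi) = 1 / 2 + t / pi" for t
      by (simp add: field_simps)
    ultimately show ?thesis unfolding J by (subst ennreal_plus[symmetric]) auto
  qed
  also have "arctan a = - arcsin d"
  proof -
    have "d\<^sup>2 < 1" using de e by (smt (verit) zero_less_power2)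
    then have d: "-1 < d" "d < 1" by (auto simp: power2_less_1_iff abs_less_iff abs_square_less_1)
    have "e = sqrt (1 - d\<^sup>2)" using de by (metis add_diff_cancel_left' real_sqrt_unique)
    then have "tan (arcsin d) = d / e"
      using d by (simp add: tan_def sin_arcsin cos_arcsin)
    then have "arctan (d / e) = arcsin d"
      using arcsin_bounded[of d] arcsin_lt_bounded[of d] d by (metis arctan_tan)
    then show ?thesis by (simp add: a_def arctan_minus)
  qed
  finally show ?thesis by simp
qed

text \<open>The product of two signs is 1 minus twice the indicator of their disagreement.\<close>

theorem gaussian_sign_correlation:
  fixes u w :: "nat \<Rightarrow> real"
  assumes u: "(\<Sum>k<n. (u k)\<^sup>2) = 1" and w: "(\<Sum>k<n. (w k)\<^sup>2) = 1"
  defines "M \<equiv> PiM {..<n} (\<lambda>_. std_normal_measure)"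
  shows "integrable M (\<lambda>g. sg (\<Sum>k<n. u k * g k) * sg (\<Sum>k<n. w k * g k))"
    and "(\<integral>g. sg (\<Sum>k<n. u k * g k) * sg (\<Sum>k<n. w k * g k) \<partial>M) = 2 / pi * arcsin (\<Sum>k<n. u k * w k)"
proof -
  interpret M: prob_space M
    unfolding M_def by (intro prob_space_PiM prob_space_std_normal)
  obtain a d e where ade: "0 \<le> a" "0 \<le> e" "a\<^sup>2 = (\<Sum>k<n. (u k)\<^sup>2)" "a * d = (\<Sum>k<n. u k * w k)"
    "d\<^sup>2 + e\<^sup>2 = (\<Sum>k<n. (w k)\<^sup>2)"
    "\<And>F. F \<in> borel_measurable (borel \<Otimes>\<^sub>M borel) \<Longrightarrow>
      (\<integral>\<^sup>+g. F (\<Sum>k<n. u k * g k, \<Sum>k<n. w k * g k) \<partial>M)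
      = (\<integral>\<^sup>+x. \<integral>\<^sup>+y. F (a * x, d * x + e * y) \<partial>std_normal_measure \<partial>std_normal_measure)"
    using gaussian_pair_law[where n = n and u = u and w = w] unfolding M_def by blast
  have a: "a = 1" using ade(1,3) u by (simp add: power2_eq_1_iff)
  have d: "d = (\<Sum>k<n. u k * w k)" using ade(4) a by simp
  define E where "E = {g \<in> space M. sg (\<Sum>k<n. u k * g k) \<noteq> sg (\<Sum>k<n. w k * g k)}"
  have sgM [measurable]: "(\<lambda>g. sg (\<Sum>k<n. v k * g k)) \<in> borel_measurable M" for v
    unfolding M_def by measurable
  have [measurable]: "E \<in> sets M"
    unfolding E_def by (rule borel_measurable_neq) (rule sgM)+
  have SS [measurable]: "{(x, y). sg x \<noteq> sg y} \<in> sets (borel \<Otimes>\<^sub>M borel)"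
  proof -
    have "{z \<in> space (borel \<Otimes>\<^sub>M borel). sg (fst z) \<noteq> sg (snd z)} \<in> sets (borel \<Otimes>\<^sub>M borel)"
      by measurable
    moreover have "{(x, y). sg x \<noteq> sg y} = {z. sg (fst z) \<noteq> sg (snd z)}" by auto
    ultimately show ?thesis by (simp add: space_pair_measure)
  qed
  have "emeasure M E = (\<integral>\<^sup>+g. indicator E g \<partial>M)" by simp
  also have "\<dots> = (\<integral>\<^sup>+g. indicator {(x, y). sg x \<noteq> sg y} (\<Sum>k<n. u k * g k, \<Sum>k<n. w k * g k) \<partial>M)"
    by (rule nn_integral_cong) (auto simp: E_def indicator_def)
  also have "\<dots> = ennreal (1 / 2 - arcsin d / pi)"
    using ade(2,5) w by (subst ade(6)) (auto simp: a sign_disagreement)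
  finally have E: "emeasure M E = ennreal (1 / 2 - arcsin d / pi)" .
  have "d\<^sup>2 \<le> 1" using ade(5) w by (metis le_add_same_cancel1 zero_le_power2)
  then have "\<bar>d\<bar> \<le> 1" by (simp add: abs_square_le_1)
  then have "arcsin d \<le> pi / 2" using arcsin_ubound[of d] by auto
  then have mE: "measure M E = 1 / 2 - arcsin d / pi"
    using E by (simp add: measure_def field_simps)
  show "integrable M (\<lambda>g. sg (\<Sum>k<n. u k * g k) * sg (\<Sum>k<n. w k * g k))"
    by (rule M.integrable_const_bound[of _ 1]) (simp add: sg_def, intro borel_measurable_times sgM)
  have "(\<integral>g. sg (\<Sum>k<n. u k * g k) * sg (\<Sum>k<n. w k * g k) \<partial>M) = (\<integral>g. 1 - 2 * indicator E g \<partial>M)"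
    by (rule Bochner_Integration.integral_cong) (auto simp: E_def indicator_def sg_def)
  also have "\<dots> = 1 - 2 * measure M E"
    by (subst Bochner_Integration.integral_diff) (auto simp: M.prob_space M.emeasure_eq_measure)
  finally show "(\<integral>g. sg (\<Sum>k<n. u k * g k) * sg (\<Sum>k<n. w k * g k) \<partial>M) = 2 / pi * arcsin (\<Sum>k<n. u k * w k)"
    unfolding mE d by (simp add: field_simps)
qed

subsection \<open>The rounding algorithm\<close>

text \<open>Elimination of the last variable, with singular S included. It guarantees that the
  choice in \<open>gauss_factor\<close> yields a genuine factor of \<Sigma>.\<close>

lemma cholesky:
  fixes S :: "nat \<Rightarrow> nat \<Rightarrow> real"
  assumes sym: "\<And>i j. i < n \<Longrightarrow> j < n \<Longrightarrow> S i j = S j i"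
    and psd: "\<And>v. 0 \<le> (\<Sum>i<n. \<Sum>j<n. v i * v j * S i j)"
  shows "\<exists>L. \<forall>i<n. \<forall>j<n. (\<Sum>k<n. L i k * L j k) = S i j"
  using assms
proof (induction n arbitrary: S)
  case (Suc n)
  define b where "b = S n n"
  define q where "q v = (\<Sum>i<n. \<Sum>j<n. v i * v j * S i j)" for v
  define l where "l v = (\<Sum>i<n. v i * S i n)" for v
  have form: "0 \<le> q v + 2 * t * l v + t\<^sup>2 * b" for v t
  proof -
    let ?v = "v(n := t)"
    have "(\<Sum>i<Suc n. \<Sum>j<Suc n. ?v i * ?v j * S i j)
      = (\<Sum>i<n. (\<Sum>j<n. v i * v j * S i j) + v i * t * S i n) + ((\<Sum>j<n. t * v j * S n j) + t * t * b)"
      by (simp add: b_def)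
    also have "(\<Sum>j<n. t * v j * S n j) = t * l v"
      unfolding l_def sum_distrib_left by (rule sum.cong) (simp_all add: Suc.prems(1)[of n])
    also have "(\<Sum>i<n. (\<Sum>j<n. v i * v j * S i j) + v i * t * S i n) = q v + t * l v"
      by (simp add: sum.distrib q_def l_def sum_distrib_left mult_ac)
    finally show ?thesis
      using Suc.prems(2)[of ?v] by (simp add: power2_eq_square algebra_simps)
  qed
  have b: "0 \<le> b" using form[of "\<lambda>_. 0" 1] by (simp add: q_def l_def)
  have l0: "l v = 0" if "b = 0" for v
  proof (rule ccontr)
    assume "l v \<noteq> 0"
    then show False using form[of v "- (q v + 1) / (2 * l v)"] that by (simp add: field_simps)
  qed
  have S0: "S i n = 0" if "b = 0" "i < n" for i
    using l0[OF that(1), of "\<lambda>j. if j = i then 1 else 0"] that(2)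
    by (simp add: l_def if_distrib[of "\<lambda>x. x * _"] cong: if_cong)
  have bb: "x / sqrt b * (y / sqrt b) = x * y / b" for x y
    using b by simp
  \<comment> \<open>The Schur complement of the last diagonal entry b. If b = 0, then S' = S by the
    convention for division by zero, and this is right because the last column vanishes.\<close>
  define S' where "S' i j = S i j - S i n * S j n / b" for i j
  have "\<exists>L. \<forall>i<n. \<forall>j<n. (\<Sum>k<n. L i k * L j k) = S' i j"
  proof (rule Suc.IH)
    show "S' i j = S' j i" if "i < n" "j < n" for i j
      using that Suc.prems(1)[of i j] by (simp add: S'_def)
    fix v :: "nat \<Rightarrow> real"
    have "(\<Sum>i<n. \<Sum>j<n. v i * v j * S' i j) = q v - (\<Sum>i<n. \<Sum>j<n. v i * S i n * (v j * S j n) / b)"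
      by (simp add: q_def S'_def algebra_simps sum_subtractf)
    also have "(\<Sum>i<n. \<Sum>j<n. v i * S i n * (v j * S j n) / b) = (l v)\<^sup>2 / b"
      by (simp add: l_def power2_eq_square sum_product sum_divide_distrib)
    also have "0 \<le> q v - (l v)\<^sup>2 / b"
    proof (cases "b = 0")
      case True
      then show ?thesis using form[of v 0] by simp
    next
      case False
      then show ?thesis using form[of v "- l v / b"] by (simp add: field_simps power2_eq_square)
    qed
    finally show "0 \<le> (\<Sum>i<n. \<Sum>j<n. v i * v j * S' i j)" .
  qed
  then obtain L where L: "\<And>i j. i < n \<Longrightarrow> j < n \<Longrightarrow> (\<Sum>k<n. L i k * L j k) = S' i j"
    by blast
  define L' where "L' i k = (if k < n then if i < n then L i k else 0 else S i n / sqrt b)" for i k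
  have "(\<Sum>k<Suc n. L' i k * L' j k) = S i j" if ij: "i < Suc n" "j < Suc n" for i j
  proof -
    have "(\<Sum>k<Suc n. L' i k * L' j k) = (if i < n \<and> j < n then S' i j else 0) + S i n * S j n / b"
      by (auto simp: L'_def bb L[symmetric] abs_of_nonneg[OF b])
    also have "\<dots> = S i j"
    proof (cases "i < n \<and> j < n")
      case True
      then show ?thesis by (simp add: S'_def)
    next
      case False
      then have "i = n \<or> j = n" using ij by auto
      then show ?thesis
        using False ij S0[of i] S0[of j] Suc.prems(1)[of i j] by (cases "b = 0") (auto simp: b_def less_Suc_eq)
    qed
    finally show ?thesis .
  qed
  then show ?case by blast
qed simp

lemma gauss_factor:
  assumes S: "S \<in> carrier_mat n n" "\<And>i j. i < n \<Longrightarrow> j < n \<Longrightarrow> S $$ (i, j) = S $$ (j, i)"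
    and psd: "\<And>v. 0 \<le> (\<Sum>i<n. \<Sum>j<n. v i * v j * S $$ (i, j))"
    and ij: "i < n" "j < n"
  shows "(\<Sum>k<n. gauss_factor n S $$ (i, k) * gauss_factor n S $$ (j, k)) = S $$ (i, j)"
proof -
  obtain L where L: "\<And>i j. i < n \<Longrightarrow> j < n \<Longrightarrow> (\<Sum>k<n. L i k * L j k) = S $$ (i, j)"
    using cholesky[of n "\<lambda>i j. S $$ (i, j)"] S(2) psd by blast
  define M where "M = mat n n (\<lambda>(i, k). L i k)"
  have "M \<in> carrier_mat n n \<and> M * transpose_mat M = S"
    using S(1) L by (auto intro!: eq_matI simp: M_def scalar_prod_def atLeast0LessThan)
  then have "gauss_factor n S \<in> carrier_mat n n \<and> gauss_factor n S * transpose_mat (gauss_factor n S) = S"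
    unfolding gauss_factor_def by (rule someI)
  then obtain G where G: "G = gauss_factor n S" "G \<in> carrier_mat n n" "G * transpose_mat G = S"
    by blast
  have "(G * transpose_mat G) $$ (i, j) = (\<Sum>k<n. G $$ (i, k) * G $$ (j, k))"
    using G(2) ij by (simp add: scalar_prod_def atLeast0LessThan)
  then have "S $$ (i, j) = (\<Sum>k<n. G $$ (i, k) * G $$ (j, k))" by (simp only: G(3))
  then show ?thesis by (simp only: G(1))
qed

text \<open>The unit diagonal makes the rows of the factor unit vectors, so the arcsine law applies
  to each pair of rows.\<close>

theorem gaussian_rounding_cost:
  assumes S: "S \<in> carrier_mat n n" "\<And>i j. i < n \<Longrightarrow> j < n \<Longrightarrow> S $$ (i, j) = S $$ (j, i)"
    and psd: "\<And>v. 0 \<le> (\<Sum>i<n. \<Sum>j<n. v i * v j * S $$ (i, j))"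
    and diag: "\<And>i. i < n \<Longrightarrow> S $$ (i, i) = 1"
  shows "(\<integral>z. qubo_cost n A z \<partial>gaussian_rounding n S)
    = (\<Sum>i<n. \<Sum>j<n. A $$ (i, j) * (2 / pi * arcsin (S $$ (i, j))))"
proof -
  define G where "G = gauss_factor n S"
  have G: "(\<Sum>k<n. G $$ (i, k) * G $$ (j, k)) = S $$ (i, j)" if "i < n" "j < n" for i j
    unfolding G_def using that S psd by (intro gauss_factor)
  define M where "M = PiM {..<n} (\<lambda>_. std_normal_measure)"
  define B where "B = PiM {..<n} (\<lambda>_. borel :: real measure)"
  define Y where "Y g = (\<lambda>i\<in>{..<n}. \<Sum>k<n. G $$ (i, k) * g k)" for g :: "nat \<Rightarrow> real"
  define R where "R y = (\<lambda>i\<in>{..<n}. if y i \<ge> 0 then 1 else -1 :: real)" for y :: "nat \<Rightarrow> real"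
  have Y: "Y \<in> measurable M B"
    unfolding Y_def M_def B_def by (rule measurable_restrict) measurable
  have R: "R \<in> measurable B B"
    unfolding R_def B_def by (rule measurable_restrict) measurable
  have Q: "qubo_cost n A \<in> borel_measurable B"
    unfolding qubo_cost_def B_def by measurable
  have "gaussian_rounding n S = distr (distr M B Y) B R"
    by (simp add: gaussian_rounding_def gaussian_measure_def M_def B_def Y_def[abs_def] R_def[abs_def] G_def)
  then have "(\<integral>z. qubo_cost n A z \<partial>gaussian_rounding n S) = (\<integral>g. qubo_cost n A (R (Y g)) \<partial>M)"
    using Y R Q by (simp add: integral_distr)
  also have "\<dots> = (\<integral>g. (\<Sum>i<n. \<Sum>j<n. A $$ (i, j) * (sg (\<Sum>k<n. G $$ (i, k) * g k) * sg (\<Sum>k<n. G $$ (j, k) * g k))) \<partial>M)"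
    by (simp add: qubo_cost_def R_def Y_def sg_def mult.assoc)
  also have "\<dots> = (\<Sum>i<n. \<Sum>j<n. A $$ (i, j) * (2 / pi * arcsin (S $$ (i, j))))"
  proof -
    have c: "integrable M (\<lambda>g. sg (\<Sum>k<n. G $$ (i, k) * g k) * sg (\<Sum>k<n. G $$ (j, k) * g k))"
      "(\<integral>g. sg (\<Sum>k<n. G $$ (i, k) * g k) * sg (\<Sum>k<n. G $$ (j, k) * g k) \<partial>M) = 2 / pi * arcsin (S $$ (i, j))"
      if "i < n" "j < n" for i j
      using gaussian_sign_correlation[of "\<lambda>k. G $$ (i, k)" n "\<lambda>k. G $$ (j, k)"] that G diag
      by (simp_all add: M_def power2_eq_square)
    define X where "X i j g = A $$ (i, j) * (sg (\<Sum>k<n. G $$ (i, k) * g k) * sg (\<Sum>k<n. G $$ (j, k) * g k))" for i j g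
    have X: "integrable M (X i j)" "(\<integral>g. X i j g \<partial>M) = A $$ (i, j) * (2 / pi * arcsin (S $$ (i, j)))"
      if "i \<in> {..<n}" "j \<in> {..<n}" for i j
      using c[of i j] that by (simp_all add: X_def[abs_def])
    have "(\<integral>g. (\<Sum>i<n. \<Sum>j<n. X i j g) \<partial>M) = (\<Sum>i<n. \<integral>g. (\<Sum>j<n. X i j g) \<partial>M)"
      by (rule Bochner_Integration.integral_sum) (intro Bochner_Integration.integrable_sum X)
    also have "\<dots> = (\<Sum>i<n. \<Sum>j<n. \<integral>g. X i j g \<partial>M)"
      by (intro sum.cong refl Bochner_Integration.integral_sum X)
    also have "\<dots> = (\<Sum>i<n. \<Sum>j<n. A $$ (i, j) * (2 / pi * arcsin (S $$ (i, j))))"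
      by (intro sum.cong refl X)
    finally show ?thesis by (simp add: X_def)
  qed
  finally show ?thesis .
qed

section \<open>The arcsine function\<close>

text \<open>Termwise integration of the binomial series of the derivative of arcsine;
  \<open>g\<close> is that series with zeros in the odd places.\<close>

lemma arcsin_power_series:
  obtains f :: "nat \<Rightarrow> real" where "\<And>k. 0 \<le> f k" "f 0 = 1"
    "\<And>x. \<bar>x\<bar> < 1 \<Longrightarrow> (\<lambda>k. f k * x ^ Suc k) sums arcsin x"
proof -
  define b :: "nat \<Rightarrow> real" where "b m = pochhammer (1/2) m / fact m" for m
  define g where "g k = (if even k then b (k div 2) else 0)" for k
  define f where "f k = g k / real (Suc k)" for k
  have b0: "0 \<le> b m" for m by (simp add: b_def pochhammer_nonneg)
  have f0: "0 \<le> f k" for k using b0 by (simp add: f_def g_def)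
  have g: "(\<lambda>k. g k * x ^ k) sums ((1 - x\<^sup>2) powr (-1/2))" if "\<bar>x\<bar> < 1" for x
  proof -
    have "x\<^sup>2 < 1" using that by (simp add: abs_square_less_1)
    then have "(\<lambda>m. ((-1/2) gchoose m) * (- x\<^sup>2) ^ m) sums ((1 + - x\<^sup>2) powr (-1/2))"
      by (intro gen_binomial_real) simp
    also have "(\<lambda>m. ((-1/2) gchoose m) * (- x\<^sup>2) ^ m) = (\<lambda>m. g (2 * m) * x ^ (2 * m))"
    proof
      fix m
      have "(- x\<^sup>2) ^ m = (-1) ^ m * x ^ (2 * m)"
        by (simp add: power_mult power_minus[of "x\<^sup>2"])
      then show "((-1/2) gchoose m) * (- x\<^sup>2) ^ m = g (2 * m) * x ^ (2 * m)"
        by (simp add: gbinomial_pochhammer g_def b_def)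
    qed
    also have "\<dots> sums ((1 + - x\<^sup>2) powr (-1/2)) \<longleftrightarrow> (\<lambda>k. g k * x ^ k) sums ((1 + - x\<^sup>2) powr (-1/2))"
    proof (rule sums_mono_reindex)
      show "strict_mono (\<lambda>m::nat. 2 * m)" by (simp add: strict_mono_def)
      fix k :: nat assume "k \<notin> range ((*) 2)"
      then have "odd k" by (auto simp: dvd_def)
      then show "g k * x ^ k = 0" by (simp add: g_def)
    qed
    finally show ?thesis by simp
  qed
  have fg: "f k * real (Suc k) = g k" for k by (simp add: f_def)
  have der: "((\<lambda>x. \<Sum>k. f k * x ^ Suc k) has_real_derivative (1 - x\<^sup>2) powr (-1/2)) (at x)"
    if "\<bar>x\<bar> < 1" for x
  proof -
    have "((\<lambda>x. \<Sum>k. f k * x ^ Suc k) has_real_derivative (\<Sum>k. f k * real (Suc k) * x ^ k)) (at x)"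
      by (rule DERIV_power_series'[where R = 1])
        (use that in \<open>auto simp only: fg intro!: sums_summable[OF g], auto\<close>)
    then show ?thesis using sums_unique[OF g[OF that]] by (simp only: fg)
  qed
  have "\<exists>c. \<forall>x\<in>{-1<..<1::real}. (\<Sum>k. f k * x ^ Suc k) - arcsin x = c"
  proof (rule has_field_derivative_zero_constant)
    fix x :: real assume x: "x \<in> {-1<..<1}"
    have "x\<^sup>2 < 1" using x by (simp add: abs_square_less_1 abs_less_iff)
    then have "(1 - x\<^sup>2) powr (-1/2) = inverse (sqrt (1 - x\<^sup>2))"
      by (simp add: powr_minus powr_half_sqrt)
    moreover have "(arcsin has_real_derivative inverse (sqrt (1 - x\<^sup>2))) (at x)"
      using x by (intro DERIV_arcsin) auto
    ultimately have "((\<lambda>x. (\<Sum>k. f k * x ^ Suc k) - arcsin x) has_real_derivative 0) (at x)"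
      using DERIV_diff[OF der[of x]] x by (force simp: abs_less_iff)
    then show "((\<lambda>x. (\<Sum>k. f k * x ^ Suc k) - arcsin x) has_real_derivative 0) (at x within {-1<..<1})"
      by (rule has_field_derivative_at_within)
  qed simp
  then obtain c where c: "\<And>x. \<bar>x\<bar> < 1 \<Longrightarrow> (\<Sum>k. f k * x ^ Suc k) - arcsin x = c"
    by (auto simp: abs_less_iff)
  from c[of 0] have c0: "c = 0" by simp
  have "(\<lambda>k. f k * x ^ Suc k) sums arcsin x" if x: "\<bar>x\<bar> < 1" for x
  proof -
    have "summable (\<lambda>k. f k * x ^ Suc k)"
    proof (rule summable_comparison_test'[where N = 0])
      show "summable (\<lambda>k. g k * \<bar>x\<bar> ^ k)" using g[of "\<bar>x\<bar>"] x by (simp add: sums_iff)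
      fix k :: nat
      have "f k \<le> g k" using b0 by (simp add: f_def g_def field_simps)
      moreover have "\<bar>x\<bar> ^ Suc k \<le> \<bar>x\<bar> ^ k" using x by (intro power_decreasing) auto
      ultimately have "f k * \<bar>x\<bar> ^ Suc k \<le> g k * \<bar>x\<bar> ^ k"
        using f0[of k] by (intro mult_mono) auto
      then show "norm (f k * x ^ Suc k) \<le> g k * \<bar>x\<bar> ^ k"
        using f0[of k] by (simp add: abs_mult power_abs)
    qed
    moreover have "(\<Sum>k. f k * x ^ Suc k) = arcsin x" using c[OF x] c0 by simp
    ultimately show ?thesis by (simp add: sums_iff)
  qed
  moreover have "f 0 = 1" by (simp add: f_def g_def b_def)
  ultimately show ?thesis using that f0 by blast
qed

lemma arcsin_ge: "0 \<le> x \<Longrightarrow> x \<le> 1 \<Longrightarrow> x \<le> arcsin x"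
proof -
  assume x: "0 \<le> x" "x \<le> 1"
  then have "0 \<le> arcsin x" using arcsin_le_mono[of 0 x] by simp
  with x show ?thesis using sin_x_le_x[of "arcsin x"] by simp
qed

text \<open>Sine is concave on [0, pi/2] and so lies above its chord.\<close>

lemma arcsin_le: "0 \<le> x \<Longrightarrow> x \<le> 1 \<Longrightarrow> arcsin x \<le> pi / 2 * x"
proof -
  assume x: "0 \<le> x" "x \<le> 1"
  have "convex_on {0..pi/2} (\<lambda>y. - sin y)"
    by (rule f''_ge0_imp_convex[where f' = "\<lambda>y. - cos y" and f'' = sin])
      (auto intro!: derivative_eq_intros sin_ge_zero)
  then have "- sin ((1 - x) *\<^sub>R 0 + x *\<^sub>R (pi/2)) \<le> (1 - x) * (- sin 0) + x * (- sin (pi/2))"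
    by (rule convex_onD) (use x in auto)
  then have "x \<le> sin (x * (pi / 2))" by simp
  then have "arcsin x \<le> arcsin (sin (x * (pi / 2)))"
    using x by (intro arcsin_le_arcsin) auto
  also have "\<dots> = x * (pi / 2)"
  proof (rule arcsin_sin)
    have "0 \<le> x * (pi / 2)" using x by simp
    then show "- (pi / 2) \<le> x * (pi / 2)" using pi_gt_zero by linarith
    show "x * (pi / 2) \<le> pi / 2" using x by simp
  qed
  finally show ?thesis by (simp add: mult.commute)
qed

lemma arcsin_gap_le:
  assumes "\<bar>x\<bar> \<le> 1" shows "\<bar>x - 2 / pi * arcsin x\<bar> \<le> (1 - 2 / pi) * \<bar>x\<bar>"
proof -
  have pos: "\<bar>x - 2 / pi * arcsin x\<bar> \<le> (1 - 2 / pi) * x" if "0 \<le> x" "x \<le> 1" for x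
  proof -
    have "2 / pi * x \<le> 2 / pi * arcsin x" using arcsin_ge[OF that] by (intro mult_left_mono) auto
    moreover have "2 / pi * arcsin x \<le> x" using arcsin_le[OF that] by (simp add: field_simps)
    ultimately show ?thesis by (simp add: algebra_simps)
  qed
  show ?thesis
  proof (cases "0 \<le> x")
    case False
    then show ?thesis using pos[of "- x"] assms by (simp add: arcsin_minus)
  qed (use pos[of x] assms in auto)
qed

text \<open>Nesterov's inequality: sum the arcsine series over the entrywise powers of \<open>S\<close>. The Schur product
  theorem is not needed in general, because \<open>S\<close> is a mixture of the rank one matrices \<open>z z\<^sup>T\<close>.\<close>

lemma entrywise_power_psd:
  fixes A S :: "nat \<Rightarrow> nat \<Rightarrow> real" and z :: "'k \<Rightarrow> nat \<Rightarrow> real"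
  assumes A: "\<And>v. 0 \<le> (\<Sum>i<n. \<Sum>j<n. A i j * v i * v j)"
    and S: "\<And>i j. i < n \<Longrightarrow> j < n \<Longrightarrow> S i j = (\<Sum>k\<in>K. p k * (z k i * z k j))"
    and p: "\<And>k. k \<in> K \<Longrightarrow> 0 \<le> p k"
  shows "0 \<le> (\<Sum>i<n. \<Sum>j<n. A i j * v i * v j * S i j ^ m)"
proof (induction m arbitrary: v)
  case (Suc m)
  have "(\<Sum>i<n. \<Sum>j<n. A i j * v i * v j * S i j ^ Suc m)
    = (\<Sum>i<n. \<Sum>j<n. \<Sum>k\<in>K. p k * (A i j * (v i * z k i) * (v j * z k j) * S i j ^ m))"
    by (intro sum.cong refl) (simp add: S sum_distrib_left sum_distrib_right mult_ac)
  also have "\<dots> = (\<Sum>k\<in>K. p k * (\<Sum>i<n. \<Sum>j<n. A i j * (v i * z k i) * (v j * z k j) * S i j ^ m))"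
    by (simp only: sum_distrib_left) (subst sum.swap, subst sum.swap[of _ K], simp add: sum.swap[of _ K])
  also have "\<dots> \<ge> 0"
    by (intro sum_nonneg mult_nonneg_nonneg p Suc.IH)
  finally show ?case .
qed (use A in simp)

lemma Nesterov_inequality:
  fixes A S :: "nat \<Rightarrow> nat \<Rightarrow> real" and z :: "'k \<Rightarrow> nat \<Rightarrow> real"
  assumes A: "\<And>v. 0 \<le> (\<Sum>i<n. \<Sum>j<n. A i j * v i * v j)"
    and S: "\<And>i j. i < n \<Longrightarrow> j < n \<Longrightarrow> S i j = (\<Sum>k\<in>K. p k * (z k i * z k j))"
    and p: "\<And>k. k \<in> K \<Longrightarrow> 0 \<le> p k"
    and S1: "\<And>i j. i < n \<Longrightarrow> j < n \<Longrightarrow> \<bar>S i j\<bar> \<le> 1"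
  shows "(\<Sum>i<n. \<Sum>j<n. A i j * S i j) \<le> (\<Sum>i<n. \<Sum>j<n. A i j * arcsin (S i j))"
proof -
  obtain f :: "nat \<Rightarrow> real" where f: "\<And>k. 0 \<le> f k" "f 0 = 1"
    "\<And>x. \<bar>x\<bar> < 1 \<Longrightarrow> (\<lambda>k. f k * x ^ Suc k) sums arcsin x"
    using arcsin_power_series by blast
  \<comment> \<open>The arcsine series is available only inside the open unit interval, while S may
    have entries of modulus 1. For r < 1 the first term of the series is r times the linear sum and
    the others are nonnegative; continuity then gives r = 1.\<close>
  define F where "F r = (\<Sum>i<n. \<Sum>j<n. A i j * arcsin (r * S i j)) - r * (\<Sum>i<n. \<Sum>j<n. A i j * S i j)" for r
  have rS: "\<bar>r * S i j\<bar> \<le> r" if "0 \<le> r" "i < n" "j < n" for r i j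
    using mult_left_mono[OF S1[OF that(2,3)] that(1)] that(1) by (simp add: abs_mult)
  have "0 \<le> F r" if r: "r \<in> {0<..<1}" for r
  proof -
    have "(\<lambda>k. \<Sum>i<n. \<Sum>j<n. A i j * (f k * (r * S i j) ^ Suc k)) sums (\<Sum>i<n. \<Sum>j<n. A i j * arcsin (r * S i j))"
    proof (intro sums_sum sums_mult f(3))
      show "\<bar>r * S i j\<bar> < 1" if "i \<in> {..<n}" "j \<in> {..<n}" for i j
        using rS[of r i j] r that by simp
    qed
    moreover have "(\<Sum>i<n. \<Sum>j<n. A i j * (f k * (r * S i j) ^ Suc k))
      = f k * r ^ Suc k * (\<Sum>i<n. \<Sum>j<n. A i j * 1 * 1 * S i j ^ Suc k)" for k
      by (simp add: sum_distrib_left power_mult_distrib mult_ac)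
    ultimately have sums: "(\<lambda>k. f k * r ^ Suc k * (\<Sum>i<n. \<Sum>j<n. A i j * 1 * 1 * S i j ^ Suc k))
       sums (\<Sum>i<n. \<Sum>j<n. A i j * arcsin (r * S i j))" by simp
    have "(\<Sum>k\<in>{0}. f k * r ^ Suc k * (\<Sum>i<n. \<Sum>j<n. A i j * 1 * 1 * S i j ^ Suc k))
      \<le> (\<Sum>i<n. \<Sum>j<n. A i j * arcsin (r * S i j))"
      unfolding sums_unique[OF sums]
    proof (rule sum_le_suminf[OF sums_summable[OF sums]])
      show "0 \<le> f k * r ^ Suc k * (\<Sum>i<n. \<Sum>j<n. A i j * 1 * 1 * S i j ^ Suc k)" for k
        using entrywise_power_psd[where n = n and A = A and S = S and K = K and p = p and z = z and v = "\<lambda>_. 1" and m = "Suc k"] A S p f(1)[of k] r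
        by (intro mult_nonneg_nonneg) auto
    qed auto
    then show ?thesis by (simp add: F_def f(2))
  qed
  moreover have "continuous_on {0..1} F"
    unfolding F_def
  proof (intro continuous_intros)
    show "\<forall>r\<in>{0..1}. -1 \<le> r * S i j \<and> r * S i j \<le> 1" if "i \<in> {..<n}" "j \<in> {..<n}" for i j
      using rS[of _ i j] that by (force simp: abs_le_iff)
  qed
  ultimately have "0 \<le> F 1"
    by (intro continuous_ge_on_Ioo[of 0 1 F 0 1]) auto
  then show ?thesis by (simp add: F_def)
qed

section \<open>The approximation ratio\<close>

lemma pos_def_sym_form:
  assumes "pos_def_sym n A"
  shows "(\<exists>i<n. v i \<noteq> 0) \<Longrightarrow> 0 < (\<Sum>i<n. \<Sum>j<n. A $$ (i, j) * v i * v j)"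
    and "0 \<le> (\<Sum>i<n. \<Sum>j<n. A $$ (i, j) * v i * v j)"
    and "i < n \<Longrightarrow> j < n \<Longrightarrow> A $$ (i, j) = A $$ (j, i)"
proof -
  have A: "A \<in> carrier_mat n n" "transpose_mat A = A"
    and pd: "\<And>v. v \<in> carrier_vec n \<Longrightarrow> v \<noteq> 0\<^sub>v n \<Longrightarrow> 0 < Matrix.scalar_prod v (A *\<^sub>v v)"
    using assms by (auto simp: pos_def_sym_def)
  have form: "Matrix.scalar_prod (Matrix.vec n v) (A *\<^sub>v Matrix.vec n v) = (\<Sum>i<n. \<Sum>j<n. A $$ (i, j) * v i * v j)"
    using A by (simp add: scalar_prod_def atLeast0LessThan sum_distrib_left mult_ac)
  show pos: "0 < (\<Sum>i<n. \<Sum>j<n. A $$ (i, j) * v i * v j)" if "\<exists>i<n. v i \<noteq> 0"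
  proof -
    have "Matrix.vec n v \<noteq> 0\<^sub>v n"
    proof
      assume "Matrix.vec n v = 0\<^sub>v n"
      then have "Matrix.vec_index (Matrix.vec n v) i = Matrix.vec_index (0\<^sub>v n) i" for i by simp
      with that show False by (metis index_vec index_zero_vec(1))
    qed
    then show ?thesis using pd[of "Matrix.vec n v"] form by simp
  qed
  show "0 \<le> (\<Sum>i<n. \<Sum>j<n. A $$ (i, j) * v i * v j)"
  proof (cases "\<exists>i<n. v i \<noteq> 0")
    case True
    then show ?thesis using pos by simp
  next
    case False
    then have "(\<Sum>i<n. \<Sum>j<n. A $$ (i, j) * v i * v j) = 0" by (intro sum.neutral ballI) auto
    then show ?thesis by simp
  qed
  show "A $$ (i, j) = A $$ (j, i)" if "i < n" "j < n"
    using that A by (metis carrier_matD index_transpose_mat(1))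
qed

text \<open>Evaluate the form at e_i + e_j and at e_i - e_j.\<close>

lemma pos_def_entry_le:
  assumes "pos_def_sym n A" "i < n" "j < n" "i \<noteq> j"
  shows "\<bar>A $$ (i, j)\<bar> \<le> (A $$ (i, i) + A $$ (j, j)) / 2"
proof -
  have "0 \<le> A $$ (i, i) + A $$ (j, j) + 2 * s * A $$ (i, j)" if s: "s * s = 1" for s
  proof -
    define v where "v k = (if k = i then 1 else 0) + (if k = j then s else 0)" for k
    have "(\<Sum>k<n. \<Sum>l<n. A $$ (k, l) * v k * v l) = (\<Sum>k<n. v k * (A $$ (k, i) + A $$ (k, j) * s))"
    proof (rule sum.cong[OF refl])
      fix k
      have "(\<Sum>l<n. A $$ (k, l) * v k * v l) = (\<Sum>l<n. (if l = i then v k * A $$ (k, i) else 0) + (if l = j then v k * (A $$ (k, j) * s) else 0))"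
        by (intro sum.cong refl) (auto simp: v_def[of l for l] algebra_simps)
      then show "(\<Sum>l<n. A $$ (k, l) * v k * v l) = v k * (A $$ (k, i) + A $$ (k, j) * s)"
        using assms by (simp add: sum.distrib algebra_simps)
    qed
    also have "\<dots> = (\<Sum>k<n. (if k = i then A $$ (i, i) + A $$ (i, j) * s else 0) + (if k = j then s * (A $$ (j, i) + A $$ (j, j) * s) else 0))"
      using assms(4) by (intro sum.cong refl) (auto simp: v_def)
    also have "\<dots> = A $$ (i, i) + A $$ (i, j) * s + s * (A $$ (j, i) + A $$ (j, j) * s)"
      using assms by (simp add: sum.distrib)
    also have "\<dots> = A $$ (i, i) + (s * s) * A $$ (j, j) + 2 * s * A $$ (i, j)"
      using pos_def_sym_form(3)[OF assms(1-3)] by (simp add: algebra_simps)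
    finally show ?thesis
      using pos_def_sym_form(2)[OF assms(1), of v] s by simp
  qed
  from this[of 1] this[of "-1"] show ?thesis by (simp add: abs_le_iff)
qed

text \<open>Each entry is charged half to either endpoint of its edge; since neighbourhoods are
  symmetric, \<open>A $$ (i, i)\<close> is charged once per neighbour of i.\<close>

lemma sum_off_diagonal_le:
  assumes A: "pos_def_sym n A" and n: "1 \<le> n"
  shows "(\<Sum>i<n. \<Sum>j\<in>{..<n} - {i}. \<bar>A $$ (i, j)\<bar>) \<le> real (max_degree n A) * (\<Sum>i<n. A $$ (i, i))"
proof -
  define N where "N i = {j. j < n \<and> j \<noteq> i \<and> A $$ (i, j) \<noteq> 0}" for i
  have fin: "finite (N i)" for i by (rule finite_subset[of _ "{..<n}"]) (auto simp: N_def)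
  have deg: "card (N i) \<le> max_degree n A" if "i < n" for i
    unfolding max_degree_def N_def using that by (intro Max_ge) auto
  have diag: "0 \<le> A $$ (i, i)" if "i < n" for i
    using pos_def_sym_form(2)[OF A, of "\<lambda>k. if k = i then 1 else 0"] that
    by (simp add: if_distrib[of "\<lambda>x. _ * x"] cong: if_cong)
  have "(\<Sum>i<n. \<Sum>j\<in>{..<n} - {i}. \<bar>A $$ (i, j)\<bar>) = (\<Sum>i<n. \<Sum>j\<in>N i. \<bar>A $$ (i, j)\<bar>)"
    by (intro sum.cong refl sum.mono_neutral_right) (auto simp: N_def)
  also have "\<dots> \<le> (\<Sum>i<n. \<Sum>j\<in>N i. A $$ (i, i) / 2 + A $$ (j, j) / 2)"
  proof (intro sum_mono)
    fix i j assume "i \<in> {..<n}" "j \<in> N i"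
    then show "\<bar>A $$ (i, j)\<bar> \<le> A $$ (i, i) / 2 + A $$ (j, j) / 2"
      using pos_def_entry_le[OF A, of i j] by (auto simp: N_def add_divide_distrib)
  qed
  also have "\<dots> = (\<Sum>i<n. \<Sum>j\<in>N i. A $$ (i, i) / 2) + (\<Sum>i<n. \<Sum>j\<in>N i. A $$ (j, j) / 2)"
    by (simp add: sum.distrib)
  also have "(\<Sum>i<n. \<Sum>j\<in>N i. A $$ (j, j) / 2) = (\<Sum>j<n. \<Sum>i\<in>N j. A $$ (j, j) / 2)"
  proof -
    have "(\<Sum>i<n. \<Sum>j\<in>N i. A $$ (j, j) / 2) = (\<Sum>i<n. \<Sum>j | j < n \<and> j \<in> N i. A $$ (j, j) / 2)"
      by (intro sum.cong) (auto simp: N_def)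
    also have "\<dots> = (\<Sum>j<n. \<Sum>i | i < n \<and> j \<in> N i. A $$ (j, j) / 2)"
      using sum.swap_restrict[of "{..<n}" "{..<n}" "\<lambda>i j. A $$ (j, j) / 2" "\<lambda>i j. j \<in> N i"] by simp
    also have "\<dots> = (\<Sum>j<n. \<Sum>i\<in>N j. A $$ (j, j) / 2)"
    proof (intro sum.cong refl)
      fix j assume "j \<in> {..<n}"
      then show "{i. i < n \<and> j \<in> N i} = N j"
        using pos_def_sym_form(3)[OF A] by (auto simp: N_def)
    qed
    finally show ?thesis .
  qed
  also have "(\<Sum>i<n. \<Sum>j\<in>N i. A $$ (i, i) / 2) + (\<Sum>j<n. \<Sum>i\<in>N j. A $$ (j, j) / 2)
    = (\<Sum>i<n. real (card (N i)) * A $$ (i, i))"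
    by (simp add: sum.distrib[symmetric])
  also have "\<dots> \<le> (\<Sum>i<n. real (max_degree n A) * A $$ (i, i))"
    using deg diag by (intro sum_mono mult_right_mono) auto
  finally show ?thesis by (simp add: sum_distrib_left)
qed

theorem theorem5:
  fixes n D :: nat and A :: "real mat" and p :: real
    and C :: "gate list list" and \<rho>0 :: "complex mat"
  assumes "n \<ge> 1"
    and "pos_def_sym n A"
    and "0 \<le> p" and "p \<le> 1"
    and "length C = D" and "\<forall>L \<in> set C. valid_layer n L"
    and "density_matrix n \<rho>0"
  shows
    "let \<rho> = noisy_circuit n p C \<rho>0; \<Sigma> = corr_mat n \<rho>;
         ratio = (\<integral>z. qubo_cost n A z \<partial>gaussian_rounding n \<Sigma>) / meas_expect n \<rho> (qubo_cost n A)
     in ratio = (2 * (\<Sum>i<n. \<Sum>j<n. A $$ (i, j) * arcsin (\<Sigma> $$ (i, j))))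
                  / (pi * (\<Sum>i<n. \<Sum>j<n. A $$ (i, j) * \<Sigma> $$ (i, j)))
      \<and> ratio \<ge> 1 - sqrt 2 * (2 * pi - 4) / pi * real (max_degree n A) * real n * (1 - p) ^ D"
proof -
  define \<rho> where "\<rho> = noisy_circuit n p C \<rho>0"
  define S where "S = corr_mat n \<rho>"
  define P where "P k = Re (\<rho> $$ (k, k))" for k
  define num where "num = (\<Sum>i<n. \<Sum>j<n. A $$ (i, j) * arcsin (S $$ (i, j)))"
  define den where "den = (\<Sum>i<n. \<Sum>j<n. A $$ (i, j) * S $$ (i, j))"
  define T where "T = (\<Sum>i<n. A $$ (i, i))"
  define \<epsilon> where "\<epsilon> = sqrt 2 * real n * (1 - p) ^ D"
  define \<Delta> where "\<Delta> = real (max_degree n A)"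
  define c where "c = 1 - 2 / pi"
  note corr = noisy_circuit_correlations[OF assms(7,6,3,4), folded \<rho>_def S_def]
  have P: "0 \<le> P k" if "k \<in> {..<2^n}" for k using corr(1) that by (simp add: P_def)
  have P1: "(\<Sum>k<2^n. P k) = 1" using corr(2) by (simp add: P_def)
  have SP: "S $$ (i, j) = (\<Sum>k<2^n. P k * (zvec n k i * zvec n k j))" if "i < n" "j < n" for i j
    using corr(3)[OF that] by (simp add: P_def)
  have zz: "\<bar>zvec n k i * zvec n k j\<bar> = 1" "zvec n k i * zvec n k i = 1" if "i < n" "j < n" for k i j
    using that by (simp_all add: zvec_def)
  have S1: "\<bar>S $$ (i, j)\<bar> \<le> 1" if "i < n" "j < n" for i j
  proof -
    have "\<bar>S $$ (i, j)\<bar> \<le> (\<Sum>k<2^n. \<bar>P k * (zvec n k i * zvec n k j)\<bar>)"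
      unfolding SP[OF that] by (rule sum_abs)
    also have "\<dots> = (\<Sum>k<2^n. P k)"
      by (intro sum.cong refl) (simp add: abs_mult[of "P _"] zz that P)
    finally show ?thesis using P1 by simp
  qed
  have diag: "S $$ (i, i) = 1" if "i < n" for i
    using SP[OF that that] zz(2)[OF that that] P1 by simp
  have Sc: "S \<in> carrier_mat n n" by (simp add: S_def corr_mat_def)
  have Ssym: "S $$ (i, j) = S $$ (j, i)" if "i < n" "j < n" for i j
    using SP that by (simp add: mult.commute[of "zvec n _ i"])
  have Spsd: "0 \<le> (\<Sum>i<n. \<Sum>j<n. v i * v j * S $$ (i, j))" for v
  proof -
    have "0 \<le> (\<Sum>i<n. v i) * (\<Sum>j<n. v j)" for v :: "nat \<Rightarrow> real" by simp
    then have "0 \<le> (\<Sum>i<n. \<Sum>j<n. 1 * v i * v j)" for v :: "nat \<Rightarrow> real"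
      by (simp add: sum_product)
    \<comment> \<open>With the all-ones matrix for A and exponent 1, this is positive
      semidefiniteness of a mixture of rank one matrices.\<close>
    from entrywise_power_psd[where n = n and A = "\<lambda>_ _. 1" and S = "\<lambda>i j. S $$ (i, j)" and K = "{..<2^n}"
        and p = P and z = "zvec n" and v = v and m = 1, OF this SP P]
    show ?thesis by simp
  qed
  have E: "(\<integral>z. qubo_cost n A z \<partial>gaussian_rounding n S) = 2 / pi * num"
    using gaussian_rounding_cost[OF Sc Ssym Spsd diag, of A]
    by (simp add: num_def sum_distrib_left mult_ac)
  have M: "meas_expect n \<rho> (qubo_cost n A) = den"
  proof -
    have "meas_expect n \<rho> (qubo_cost n A) = (\<Sum>k<2^n. \<Sum>i<n. \<Sum>j<n. A $$ (i, j) * (P k * (zvec n k i * zvec n k j)))"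
      by (simp add: meas_expect_def qubo_cost_def P_def sum_distrib_left mult_ac)
    also have "\<dots> = (\<Sum>i<n. \<Sum>j<n. \<Sum>k<2^n. A $$ (i, j) * (P k * (zvec n k i * zvec n k j)))"
      by (subst sum.swap) (intro sum.cong refl sum.swap)
    also have "\<dots> = den"
      unfolding den_def by (intro sum.cong refl) (simp add: SP sum_distrib_left)
    finally show ?thesis .
  qed
  \<comment> \<open>The denominator is the mean of a cost that is positive at every outcome, and
    some outcome has positive probability.\<close>
  have den: "0 < den"
  proof -
    have pos: "0 < qubo_cost n A (zvec n k)" for k
      unfolding qubo_cost_def
      by (rule pos_def_sym_form(1)[OF assms(2)]) (use assms(1) in \<open>auto simp: zvec_def intro!: exI[of _ 0]\<close>)
    have "\<exists>k\<in>{..<2^n}. P k \<noteq> 0"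
    proof (rule ccontr)
      assume "\<not> ?thesis"
      then have "(\<Sum>k<2^n. P k) = 0" by (intro sum.neutral) auto
      with P1 show False by simp
    qed
    then obtain k where k: "k \<in> {..<2^n}" "0 < P k" using P by (metis less_eq_real_def)
    have "0 < (\<Sum>k<2^n. P k * qubo_cost n A (zvec n k))"
      using k P pos by (intro sum_pos2[of _ k]) (auto intro: mult_nonneg_nonneg less_imp_le)
    then show ?thesis unfolding M[symmetric] by (simp add: meas_expect_def P_def)
  qed
  have ratio: "2 / pi * num / den = 2 * num / (pi * den)" by simp
  have c: "0 < c" using pi_gt3 by (simp add: c_def)
  have q: "0 \<le> (1 - p) ^ D" using assms(4) by simp
  have \<epsilon>: "0 \<le> \<epsilon>" using q by (simp add: \<epsilon>_def)
  have T: "0 \<le> T"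
    unfolding T_def
  proof (rule sum_nonneg)
    fix i assume "i \<in> {..<n}"
    then show "0 \<le> A $$ (i, i)"
      using pos_def_sym_form(2)[OF assms(2), of "\<lambda>k. if k = i then 1 else 0"]
      by (simp add: if_distrib[of "\<lambda>x. _ * x"] cong: if_cong)
  qed
  have off: "(\<Sum>i<n. \<Sum>j\<in>{..<n} - {i}. \<bar>A $$ (i, j)\<bar> * \<bar>S $$ (i, j)\<bar>) \<le> \<Delta> * \<epsilon> * T"
  proof -
    have "(\<Sum>i<n. \<Sum>j\<in>{..<n} - {i}. \<bar>A $$ (i, j)\<bar> * \<bar>S $$ (i, j)\<bar>) \<le> (\<Sum>i<n. \<Sum>j\<in>{..<n} - {i}. \<epsilon> * \<bar>A $$ (i, j)\<bar>)"
    proof (intro sum_mono)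
      fix i j assume "i \<in> {..<n}" "j \<in> {..<n} - {i}"
      then have "\<bar>S $$ (i, j)\<bar> \<le> \<epsilon>" using corr(4)[of i j] assms(5) by (simp add: \<epsilon>_def)
      then have "\<bar>S $$ (i, j)\<bar> * \<bar>A $$ (i, j)\<bar> \<le> \<epsilon> * \<bar>A $$ (i, j)\<bar>" by (intro mult_right_mono) auto
      then show "\<bar>A $$ (i, j)\<bar> * \<bar>S $$ (i, j)\<bar> \<le> \<epsilon> * \<bar>A $$ (i, j)\<bar>" by (simp add: mult.commute)
    qed
    also have "\<dots> = \<epsilon> * (\<Sum>i<n. \<Sum>j\<in>{..<n} - {i}. \<bar>A $$ (i, j)\<bar>)"
      by (simp add: sum_distrib_left)
    also have "\<dots> \<le> \<epsilon> * (\<Delta> * T)"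
      using sum_off_diagonal_le[OF assms(2,1)] \<epsilon> by (intro mult_left_mono) (simp_all add: \<Delta>_def T_def)
    finally show ?thesis by (simp add: mult_ac)
  qed
  have split: "(\<Sum>i<n. \<Sum>j<n. f i j) = (\<Sum>i<n. f i i) + (\<Sum>i<n. \<Sum>j\<in>{..<n} - {i}. f i j)" for f :: "nat \<Rightarrow> nat \<Rightarrow> real"
    by (simp add: sum.remove[of "{..<n}"] flip: sum.distrib)
  have gap: "den - 2 / pi * num \<le> c * (\<Delta> * \<epsilon> * T)"
  proof -
    have "den - 2 / pi * num = (\<Sum>i<n. \<Sum>j<n. A $$ (i, j) * (S $$ (i, j) - 2 / pi * arcsin (S $$ (i, j))))"
      by (simp add: den_def num_def sum_distrib_left right_diff_distrib sum_subtractf mult_ac)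
    also have "\<dots> = (\<Sum>i<n. \<Sum>j\<in>{..<n} - {i}. A $$ (i, j) * (S $$ (i, j) - 2 / pi * arcsin (S $$ (i, j))))"
      by (subst split) (simp add: diag)
    also have "\<dots> \<le> (\<Sum>i<n. \<Sum>j\<in>{..<n} - {i}. c * (\<bar>A $$ (i, j)\<bar> * \<bar>S $$ (i, j)\<bar>))"
    proof (intro sum_mono)
      fix i j assume ij: "i \<in> {..<n}" "j \<in> {..<n} - {i}"
      have "A $$ (i, j) * (S $$ (i, j) - 2 / pi * arcsin (S $$ (i, j)))
        \<le> \<bar>A $$ (i, j)\<bar> * \<bar>S $$ (i, j) - 2 / pi * arcsin (S $$ (i, j))\<bar>"
        by (metis abs_ge_self abs_mult)
      also have "\<dots> \<le> \<bar>A $$ (i, j)\<bar> * (c * \<bar>S $$ (i, j)\<bar>)"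
        using ij S1[of i j] arcsin_gap_le unfolding c_def by (intro mult_left_mono) auto
      finally show "A $$ (i, j) * (S $$ (i, j) - 2 / pi * arcsin (S $$ (i, j))) \<le> c * (\<bar>A $$ (i, j)\<bar> * \<bar>S $$ (i, j)\<bar>)"
        by (simp add: mult_ac)
    qed
    also have "\<dots> \<le> c * (\<Delta> * \<epsilon> * T)"
      using off c by (simp flip: sum_distrib_left)
    finally show ?thesis .
  qed
  \<comment> \<open>The factor 2 pays for T \<le> 2 * den in the first case and makes 2 * \<Delta> *
    \<epsilon> exceed 1 in the second.\<close>
  have "den - 2 / pi * num \<le> c * (2 * \<Delta> * \<epsilon>) * den"
  proof (cases "\<Delta> * \<epsilon> \<le> 1/2")
    case True
    have "T - den \<le> \<Delta> * \<epsilon> * T"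
    proof -
      have "T - den = - (\<Sum>i<n. \<Sum>j\<in>{..<n} - {i}. A $$ (i, j) * S $$ (i, j))"
        unfolding den_def by (subst split) (simp add: diag T_def)
      also have "\<dots> = (\<Sum>i<n. \<Sum>j\<in>{..<n} - {i}. - (A $$ (i, j) * S $$ (i, j)))"
        by (simp add: sum_negf)
      also have "\<dots> \<le> (\<Sum>i<n. \<Sum>j\<in>{..<n} - {i}. \<bar>A $$ (i, j)\<bar> * \<bar>S $$ (i, j)\<bar>)"
        by (intro sum_mono) (simp flip: abs_mult)
      finally show ?thesis using off by simp
    qed
    moreover have "\<Delta> * \<epsilon> * T \<le> 1/2 * T" using True T by (intro mult_right_mono)
    ultimately have "T \<le> 2 * den" by simp
    then have "c * (\<Delta> * \<epsilon> * T) \<le> c * (\<Delta> * \<epsilon> * (2 * den))"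
      using c \<epsilon> by (intro mult_left_mono) (auto simp: \<Delta>_def)
    with gap show ?thesis by (simp add: mult_ac)
  next
    case False
    have "den \<le> num"
      unfolding den_def num_def
      by (rule Nesterov_inequality[OF pos_def_sym_form(2)[OF assms(2)] SP P S1])
    then have "2 / pi * den \<le> 2 / pi * num" by (intro mult_left_mono) auto
    then have "den - 2 / pi * num \<le> c * den" by (simp add: c_def algebra_simps)
    also have "\<dots> = c * 1 * den" by simp
    also have "\<dots> \<le> c * (2 * \<Delta> * \<epsilon>) * den"
      using False c den by (intro mult_right_mono mult_left_mono) auto
    finally show ?thesis .
  qed
  then have "1 - 2 / pi * num / den \<le> c * (2 * \<Delta> * \<epsilon>)"
    using den by (simp add: field_simps)
  moreover have "c * (2 * \<Delta> * \<epsilon>) = sqrt 2 * (2 * pi - 4) / pi * \<Delta> * real n * (1 - p) ^ D"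
    by (simp add: c_def \<epsilon>_def field_simps)
  ultimately have "1 - sqrt 2 * (2 * pi - 4) / pi * \<Delta> * real n * (1 - p) ^ D \<le> 2 / pi * num / den"
    by linarith
  then show ?thesis
    unfolding Let_def \<rho>_def[symmetric] S_def[symmetric] E M num_def[symmetric] den_def[symmetric] \<Delta>_def[symmetric]
    using ratio by blast
qed

end
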